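(* Let $f(Z)=\sum_{i=1}^d \alpha_i Z^i\in\mathbb{R}[Z]$ be any polynomial of degree $d\ge 3$, and let $a,q$ be integers with $q\ge 1$, $\gcd(a,q)=1$ and $$\left|\alpha_d-\frac aq\right|<\frac1{q^2}.$$ Let $\ell$ be a positive integer and let $0\le s\le r$ be integers. Then $$|S_f(r,\ell,s)|\le 2^{(1/2+o(1))r}\binom rs^{1/2}\left(\ell^{\eta_1(d)}q^{-\eta_1(d)}+\ell^{\vartheta(d)}2^{-\zeta_1(d)r}+2^{-\zeta_2(d)r}+2^{-\zeta_3(d)r}q^{\eta_2(d)}\right)^{1/2}$$ as $r\to\infty$, where $$\eta_1(d)=\frac1{d^2-2d+2},\qquad \eta_2(d)=\frac1{(d-1)^2},\qquad \vartheta(d)=\frac1{d(d-1)},$$ $$\zeta_1(d)=\frac{d-2}{d(d-1)},\qquad \zeta_2(d)=\frac1{d^2-3d+3},\qquad \zeta_3(d)=\frac1{d-1}.$$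
   Context: Let $\mathbf{e}(z)=\exp(2\pi i z)$, and let $\sigma(n)$ denote the sum of the binary digits of $n$. For integers $0\le s\le r$ put $$\mathcal{G}_s(r)=\{0\le n<2^r:\ \sigma(n)=s\},\qquad S_f(r,\ell,s)=\sum_{n\in\mathcal{G}_s(r)}\mathbf{e}(\ell f(n)).$$ The notation $o(1)$ means: for every $\varepsilon>0$ there is $r_0$, depending only on $\varepsilon$ and $d$ (and not on $f,a,q,\ell,s$), such that for all $r\ge r_0$ the bound holds with $o(1)$ replaced by $\varepsilon$. *)

theory Defs
  imports Complex_Main "HOL-Computational_Algebra.Polynomial"
begin

definition e2pi :: "complex \<Rightarrow> complex" where
  "e2pi z = exp (2 * of_real pi * \<i> * z)"

fun binary_digit_sum :: "nat \<Rightarrow> nat" where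
  "binary_digit_sum n = (if n = 0 then 0 else n mod 2 + binary_digit_sum (n div 2))"

declare binary_digit_sum.simps [simp del]

definition digit_sum_set :: "nat \<Rightarrow> nat \<Rightarrow> nat set" where
  "digit_sum_set s r = {n. n < 2 ^ r \<and> binary_digit_sum n = s}"

definition S_sum :: "real poly \<Rightarrow> nat \<Rightarrow> nat \<Rightarrow> nat \<Rightarrow> complex" where
  "S_sum f r l s = (\<Sum>n\<in>digit_sum_set s r. e2pi (of_real (real l * poly f (real n))))"

definition \<eta>\<^sub>1 :: "nat \<Rightarrow> real" where
  "\<eta>\<^sub>1 d = 1 / (real d ^ 2 - 2 * real d + 2)"

definition \<eta>\<^sub>2 :: "nat \<Rightarrow> real" where
  "\<eta>\<^sub>2 d = 1 / (real d - 1) ^ 2"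

definition \<theta> :: "nat \<Rightarrow> real" where
  "\<theta> d = 1 / (real d * (real d - 1))"

definition \<zeta>\<^sub>1 :: "nat \<Rightarrow> real" where
  "\<zeta>\<^sub>1 d = (real d - 2) / (real d * (real d - 1))"

definition \<zeta>\<^sub>2 :: "nat \<Rightarrow> real" where
  "\<zeta>\<^sub>2 d = 1 / (real d ^ 2 - 3 * real d + 3)"

definition \<zeta>\<^sub>3 :: "nat \<Rightarrow> real" where
  "\<zeta>\<^sub>3 d = 1 / (real d - 1)"

end

theory Submission
  imports Defs "HOL-Analysis.Analysis" "HOL-Number_Theory.Cong"
begin

text \<open>
  Write \<open>n = u + W v\<close> with \<open>W = 2 ^ w\<close> and \<open>u < W\<close>. Grouping by the digit sum of \<open>u\<close>, Cauchy's inequality over \<open>v\<close>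
  followed by completing the sum over \<open>v\<close> removes the leading term of \<open>f\<close>: off the diagonal there remain Weyl sums of
  degree \<open>d - 1\<close> with leading coefficient \<open>l d \<alpha> (u1 - u2) W ^ (d - 1)\<close>, where \<open>\<alpha>\<close> is the leading coefficient of \<open>f\<close>.
  Shifting \<open>v\<close> moves the coefficient of degree \<open>d - 2\<close> along an arithmetic progression, so these sums are controlled by
  the Vinogradov mean value of degree \<open>k = d - 2\<close> at its critical exponent \<open>k (k + 1)\<close> and by a count of the \<open>z\<close> for
  which a multiple of \<open>\<alpha> z\<close> is close to an integer. The four terms of the bound are exactly the constraints under
  which the off-diagonal sums save the factor \<open>W\<close> gained on the diagonal, and \<open>W\<close> is chosen as large as they permit.

  The mean value is obtained from \<open>\<ell>\<^sup>p\<close> decoupling for the moment curve over the \<open>p\<close>-adic integers, following the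
  bilinear method of Guo, Li, Yung and Zorin-Kranich (after Wooley's nested efficient congruencing), by induction on \<open>k\<close>.
  If \<open>I\<close> and \<open>I'\<close> are residue classes that are distinct modulo \<open>p\<close>, and \<open>I'\<close> is the class of \<open>\<xi>'\<close> modulo \<open>p ^ b\<close>, then
  the characters given by polynomials divisible by \<open>(x - \<xi>') ^ (k - l + 1)\<close>, with denominator \<open>p ^ ((k - l + 1) b)\<close>, are
  trivial on \<open>I'\<close>; averaging over them decouples \<open>I\<close> in dimension \<open>l < k\<close> into classes modulo \<open>p ^ c\<close> with \<open>c\<close>
  close to \<open>(k - l + 1) b / l\<close>. Alternating the roles of \<open>I\<close> and \<open>I'\<close> through Hoelder's inequality gains arbitrarily much
  over the best known exponent, which must therefore be optimal.
\<close>

section \<open>Characters and decoupling inequalities\<close>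

text \<open>Frequencies are coefficient vectors modulo \<open>p ^ (k * B)\<close>: every mean value
  is a finite sum, translation by a polynomial is exact, and no smooth cutoffs occur. The prime
  \<open>p\<close> is fixed once \<open>k\<close> is, and only \<open>B\<close> grows. It exceeds
  \<open>k\<close> so that \<open>fact k\<close> is a unit, and it is at least 16 so that one level
  of classes outweighs the constant lost in isolating transversal pairs. The exponents of the final
  bound come from one count. With \<open>P = (d - 2) * (d - 1)\<close>, saving a factor
  \<open>W\<close> in an average of \<open>P\<close>-th powers requires that at most about
  \<open>N / W ^ P\<close> of the \<open>z < N\<close> bring a multiple of the leading coefficient
  near an integer. Up to constants their number is bounded by
  \<open>(l * W ^ d * N / q + 1) * (q / N ^ (d - 2) + 1)\<close>. With \<open>N = 2 ^ r / W\<close>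
  the four products bound powers of \<open>W\<close> with exponents \<open>P + d\<close>,
  \<open>P + d + (d - 2)\<close>, \<open>P + 1\<close> and \<open>P + (d - 1)\<close>, whose
  reciprocals are \<open>\<eta>\<^sub>1 d\<close>, \<open>\<theta> d\<close>,
  \<open>\<zeta>\<^sub>2 d\<close> and \<open>\<eta>\<^sub>2 d\<close>.\<close>

definition ee :: "real \<Rightarrow> complex" where "ee x = cis (2 * pi * x)"

lemma norm_ee [simp]: "norm (ee x) = 1"
  by (simp add: ee_def)

lemma ee_add: "ee (x + y) = ee x * ee y"
  by (simp add: ee_def cis_mult ring_distribs)

lemma ee_0 [simp]: "ee 0 = 1"
  by (simp add: ee_def)

lemma ee_int [simp]: "ee (of_int m) = 1"
  unfolding ee_def by (metis cis_multiple_2pi Ints_of_int mult.assoc)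

lemma ee_minus: "ee (- x) = cnj (ee x)"
  by (simp add: ee_def cis_cnj)

lemma ee_cong:
  fixes a b q :: int
  assumes "q > 0" "a mod q = b mod q"
  shows "ee (a / q) = ee (b / q)"
proof -
  obtain m where "a = b + q * m"
    using assms(2) by (metis mod_eqE)
  then have "real_of_int a / q = b / q + of_int m"
    using assms(1) by (simp add: field_simps)
  then show ?thesis by (simp add: ee_add)
qed

definition phase :: "nat \<Rightarrow> (nat \<Rightarrow> int) \<Rightarrow> int \<Rightarrow> int" where
  "phase k c n = (\<Sum>i\<le>k. c i * n ^ i)"

definition poly_char :: "nat \<Rightarrow> int \<Rightarrow> (nat \<Rightarrow> int) \<Rightarrow> int \<Rightarrow> complex" where
  "poly_char k q c n = ee (phase k c n / q)"

text \<open>The constant coefficient only multiplies a character by a scalar of modulus one. It is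
  kept so that every integer polynomial of degree at most \<open>k\<close> acts on the set by
  translation.\<close>

definition freqs :: "nat \<Rightarrow> int \<Rightarrow> (nat \<Rightarrow> int) set" where
  "freqs k q = PiE {..k} (\<lambda>_. {0..<q})"

definition expsum :: "int set \<Rightarrow> (int \<Rightarrow> complex) \<Rightarrow> (int \<Rightarrow> complex) \<Rightarrow> complex" where
  "expsum A a \<psi> = (\<Sum>n\<in>A. a n * \<psi> n)"

definition residue_class :: "int set \<Rightarrow> int \<Rightarrow> int \<Rightarrow> int set" where
  "residue_class A m \<xi> = {n \<in> A. n mod m = \<xi>}"

lemma finite_residue_class [simp]: "finite A \<Longrightarrow> finite (residue_class A m \<xi>)"
  by (simp add: residue_class_def)

lemma residue_class_subset: "residue_class A m \<xi> \<subseteq> A"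
  by (auto simp: residue_class_def)

lemma finite_freqs [simp]: "finite (freqs k q)"
  by (simp add: freqs_def finite_PiE)

lemma card_freqs: "q \<ge> 0 \<Longrightarrow> card (freqs k q) = nat q ^ (k + 1)"
  by (simp add: freqs_def card_PiE)

lemma phase_mod: "phase k (\<lambda>i\<in>{..k}. (c i) mod q) n mod q = phase k c n mod q"
proof -
  have "phase k (\<lambda>i\<in>{..k}. (c i) mod q) n = (\<Sum>i\<le>k. (c i mod q) * n ^ i)"
    unfolding phase_def by (intro sum.cong) auto
  moreover have "(\<Sum>i\<le>k. (c i mod q) * n ^ i) mod q = (\<Sum>i\<le>k. c i * n ^ i) mod q"
    by (subst (1 2) mod_sum_eq [symmetric]) (simp add: mod_mult_left_eq)
  ultimately show ?thesis by (simp add: phase_def)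
qed

lemma bij_mod_shift:
  fixes q s :: int
  assumes "q > 0"
  shows "bij_betw (\<lambda>x. (x + s) mod q) {0..<q} {0..<q}"
proof (rule bij_betwI[where g = "\<lambda>x. (x - s) mod q"])
  show "(\<lambda>x. (x + s) mod q) \<in> {0..<q} \<rightarrow> {0..<q}" "(\<lambda>x. (x - s) mod q) \<in> {0..<q} \<rightarrow> {0..<q}"
    using assms by auto
qed (simp_all add: mod_simps)

lemma bij_freqs_shift:
  assumes "q > 0"
  shows "bij_betw (\<lambda>c. \<lambda>i\<in>{..k}. (c i + s i) mod q) (freqs k q) (freqs k q)"
proof (rule bij_betwI[where g = "\<lambda>c. \<lambda>i\<in>{..k}. (c i - s i) mod q"])
  show "(\<lambda>c. \<lambda>i\<in>{..k}. (c i + s i) mod q) \<in> freqs k q \<rightarrow> freqs k q"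
    "(\<lambda>c. \<lambda>i\<in>{..k}. (c i - s i) mod q) \<in> freqs k q \<rightarrow> freqs k q"
    using assms by (auto simp: freqs_def)
next
  fix c assume c: "c \<in> freqs k q"
  show "(\<lambda>i\<in>{..k}. ((\<lambda>i\<in>{..k}. (c i + s i) mod q) i - s i) mod q) = c"
    using c by (intro ext) (auto simp: freqs_def mod_simps PiE_def extensional_def Pi_iff)
  show "(\<lambda>i\<in>{..k}. ((\<lambda>i\<in>{..k}. (c i - s i) mod q) i + s i) mod q) = c"
    using c by (intro ext) (auto simp: freqs_def mod_simps PiE_def extensional_def Pi_iff)
qed

lemma poly_eq_phase:
  assumes "degree R \<le> k"
  shows "poly R n = phase k (coeff R) n"
proof -
  have "(\<Sum>i\<le>degree R. coeff R i * n ^ i) = (\<Sum>i\<le>k. coeff R i * n ^ i)"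
    by (rule sum.mono_neutral_left) (use assms in \<open>auto simp: coeff_eq_0\<close>)
  then show ?thesis by (simp add: phase_def poly_altdef)
qed

text \<open>Adding the coefficients of \<open>R\<close> modulo \<open>q\<close> permutes the
  frequencies. \<open>H\<close> is any functional of the character, so a whole weighted moment is
  transported at once.\<close>

lemma freqs_shift:
  fixes H :: "(int \<Rightarrow> complex) \<Rightarrow> real"
  assumes "q > 0" "degree R \<le> k"
  shows "(\<Sum>c\<in>freqs k q. H (poly_char k q c)) = (\<Sum>c\<in>freqs k q. H (\<lambda>n. poly_char k q c n * ee (poly R n / q)))"
proof -
  have "poly_char k q (\<lambda>i\<in>{..k}. (c i + coeff R i) mod q) = (\<lambda>n. poly_char k q c n * ee (poly R n / q))" for c
  proof
    fix n
    have "poly_char k q (\<lambda>i\<in>{..k}. (c i + coeff R i) mod q) n = ee (phase k (\<lambda>i. c i + coeff R i) n / q)"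
      unfolding poly_char_def by (intro ee_cong assms phase_mod)
    also have "phase k (\<lambda>i. c i + coeff R i) n = phase k c n + poly R n"
      unfolding poly_eq_phase[OF assms(2)] by (simp add: phase_def ring_distribs sum.distrib)
    also have "ee (of_int (phase k c n + poly R n) / q) = poly_char k q c n * ee (poly R n / q)"
      by (simp add: poly_char_def ee_add[symmetric] add_divide_distrib)
    finally show "poly_char k q (\<lambda>i\<in>{..k}. (c i + coeff R i) mod q) n = poly_char k q c n * ee (poly R n / q)" .
  qed
  then show ?thesis
    using sum.reindex_bij_betw[OF bij_freqs_shift[OF assms(1)], of "\<lambda>c. H (poly_char k q c)" "coeff R" k] by simp
qed

definition vexp :: "nat \<Rightarrow> nat" where "vexp k = k * (k + 1)"

text \<open>This denominator matches classes modulo \<open>p ^ B\<close>: for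
  \<open>n = \<xi> + p ^ B * t\<close> the top term \<open>(p ^ B * t) ^ k\<close> is just trivial
  modulo it.\<close>

abbreviation pfreqs :: "int \<Rightarrow> nat \<Rightarrow> nat \<Rightarrow> (nat \<Rightarrow> int) set" where
  "pfreqs p k B \<equiv> freqs k (p ^ (k * B))"

abbreviation amp :: "int \<Rightarrow> nat \<Rightarrow> nat \<Rightarrow> int set \<Rightarrow> (int \<Rightarrow> complex) \<Rightarrow> (nat \<Rightarrow> int) \<Rightarrow> real" where
  "amp p k B A a \<gamma> \<equiv> norm (expsum A a (poly_char k (p ^ (k * B)) \<gamma>))"

text \<open>The \<open>\<ell>\<^sup>p\<close> decoupling inequality with constant \<open>K\<close> for the moment curve over the \<open>p\<close>-adic integers,
  at the critical exponent, into residue classes modulo \<open>p ^ B\<close>.\<close>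

definition decouples :: "int \<Rightarrow> nat \<Rightarrow> nat \<Rightarrow> real \<Rightarrow> bool" where
  "decouples p k B K \<longleftrightarrow> (\<forall>A a. finite A \<longrightarrow>
     (\<Sum>c\<in>pfreqs p k B. amp p k B A a c ^ vexp k)
     \<le> K * (\<Sum>\<xi>\<in>{0..<p ^ B}. \<Sum>c\<in>pfreqs p k B.
            amp p k B (residue_class A (p ^ B) \<xi>) a c ^ vexp k))"

definition subclasses :: "int \<Rightarrow> nat \<Rightarrow> nat \<Rightarrow> int \<Rightarrow> int set" where
  "subclasses p c c' \<xi> = {\<xi>' \<in> {0..<p ^ c'}. \<xi>' mod p ^ c = \<xi>}"

lemma finite_subclasses [simp]: "finite (subclasses p c c' \<xi>)"
  by (rule finite_subset[of _ "{0..<p ^ c'}"]) (auto simp: subclasses_def)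

lemma subclasses_bij:
  assumes "p > 1" "\<xi> \<in> {0..<p ^ c}"
  shows "bij_betw (\<lambda>\<eta>. \<xi> + p ^ c * \<eta>) {0..<p ^ b} (subclasses p c (c + b) \<xi>)"
proof (rule bij_betwI[where g = "\<lambda>x. x div p ^ c"])
  have pc: "p ^ c > 0" using assms by simp
  show "(\<lambda>\<eta>. \<xi> + p ^ c * \<eta>) \<in> {0..<p ^ b} \<rightarrow> subclasses p c (c + b) \<xi>"
  proof
    fix \<eta> assume \<eta>: "\<eta> \<in> {0..<p ^ b}"
    then have "p ^ c * \<eta> \<le> p ^ c * (p ^ b - 1)" using pc by (intro mult_left_mono) auto
    then have "\<xi> + p ^ c * \<eta> < p ^ (c + b)" using assms(2) by (simp add: power_add algebra_simps)
    then show "\<xi> + p ^ c * \<eta> \<in> subclasses p c (c + b) \<xi>"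
      using \<eta> assms pc by (auto simp: subclasses_def)
  qed
  show "(\<lambda>x. x div p ^ c) \<in> subclasses p c (c + b) \<xi> \<rightarrow> {0..<p ^ b}"
  proof
    fix x assume "x \<in> subclasses p c (c + b) \<xi>"
    then have x: "0 \<le> x" "x < p ^ b * p ^ c" by (auto simp: subclasses_def power_add mult.commute)
    have "x div p ^ c * p ^ c \<le> x"
      using pc by (metis add.commute add_increasing2 div_mult_mod_eq order_refl pos_mod_sign le_add_same_cancel1)
    then have "x div p ^ c < p ^ b"
      using x(2) pc by (meson mult_less_cancel_right_pos order_le_less_trans)
    then show "x div p ^ c \<in> {0..<p ^ b}"
      using x(1) pc by (simp add: pos_imp_zdiv_nonneg_iff)
  qed
  fix x assume "x \<in> {0..<p ^ b}"
  show "(\<xi> + p ^ c * x) div p ^ c = x" using assms by (subst div_mult_self2) auto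
next
  fix x assume "x \<in> subclasses p c (c + b) \<xi>"
  then show "\<xi> + p ^ c * (x div p ^ c) = x"
    by (auto simp: subclasses_def mult.commute)
qed

lemma card_subclasses:
  assumes "p > 1" "\<xi> \<in> {0..<p ^ c}" "c \<le> c'"
  shows "card (subclasses p c c' \<xi>) = nat p ^ (c' - c)"
  using bij_betw_same_card[OF subclasses_bij[OF assms(1,2), of "c' - c"]] assms by (simp add: nat_power_eq)

text \<open>Adding a polynomial \<open>R\<close> to the frequency multiplies every character by \<open>ee (R / q)\<close>. Averaging over polynomials \<open>R\<close>
  that run through the characters of degree \<open>l\<close> on the class of \<open>\<xi>\<close> brings in the decoupling inequality in dimension \<open>l\<close>.\<close>

lemma transfer:
  fixes W :: "(int \<Rightarrow> complex) \<Rightarrow> real"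
  assumes dec: "decouples p l b K" and p: "p > 1" and q: "q > 0"
    and \<xi>: "\<xi> \<in> {0..<p ^ c}" and A: "finite A" "\<And>n. n \<in> A \<Longrightarrow> n mod p ^ c = \<xi>"
    and W: "\<And>\<psi>. W \<psi> \<ge> 0"
    and R: "\<And>d. \<exists>R u. degree R \<le> k \<and> norm u = 1 \<and>
        (\<forall>t. ee (poly R (\<xi> + p ^ c * t) / q) = u * poly_char l (p ^ (l * b)) d t) \<and>
        (\<forall>\<psi>. W (\<lambda>n. \<psi> n * ee (poly R n / q)) = W \<psi>)"
  shows "(\<Sum>\<gamma>\<in>freqs k q. W (poly_char k q \<gamma>) * norm (expsum A a (poly_char k q \<gamma>)) ^ vexp l)
    \<le> K * (\<Sum>\<xi>'\<in>subclasses p c (c + b) \<xi>. \<Sum>\<gamma>\<in>freqs k q.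
        W (poly_char k q \<gamma>) * norm (expsum (residue_class A (p ^ (c + b)) \<xi>') a (poly_char k q \<gamma>)) ^ vexp l)"
proof -
  define \<Omega> where "\<Omega> = freqs l (p ^ (l * b))"
  define X where "X = poly_char l (p ^ (l * b))"
  have pc: "p ^ c > 0" using p by simp
  have "\<exists>Ru. \<forall>d. degree (fst (Ru d)) \<le> k \<and> norm (snd (Ru d)) = 1 \<and>
      (\<forall>t. ee (poly (fst (Ru d)) (\<xi> + p ^ c * t) / q) = snd (Ru d) * X d t) \<and>
      (\<forall>\<psi>. W (\<lambda>n. \<psi> n * ee (poly (fst (Ru d)) n / q)) = W \<psi>)"
    unfolding X_def by (rule choice) (use R in \<open>simp add: split_paired_Ex\<close>)
  then obtain Ru where Ru: "degree (fst (Ru d)) \<le> k \<and> norm (snd (Ru d)) = 1 \<and>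
      (\<forall>t. ee (poly (fst (Ru d)) (\<xi> + p ^ c * t) / q) = snd (Ru d) * X d t) \<and>
      (\<forall>\<psi>. W (\<lambda>n. \<psi> n * ee (poly (fst (Ru d)) n / q)) = W \<psi>)" for d by auto
  define R where "R = (\<lambda>d. fst (Ru d))"
  define u where "u = (\<lambda>d. snd (Ru d))"
  have Rdeg: "\<And>d. degree (R d) \<le> k" and u: "\<And>d. norm (u d :: complex) = 1"
    and RX: "\<And>d t. ee (poly (R d) (\<xi> + p ^ c * t) / q) = u d * X d t"
    and RW: "\<And>d \<psi>. W (\<lambda>n. \<psi> n * ee (poly (R d) n / q)) = W \<psi>"
    using Ru by (auto simp: R_def u_def)
  define T where "T = (\<lambda>n. (n - \<xi>) div p ^ c)"
  have T: "n = \<xi> + p ^ c * T n" if "n \<in> A" for n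
  proof -
    have "p ^ c dvd n - \<xi>" using A(2)[OF that] by (metis dvd_minus_mod)
    then show ?thesis by (simp add: T_def)
  qed
  have Tinj: "inj_on T A'" if "A' \<subseteq> A" for A'
  proof (rule inj_onI)
    fix x y assume "x \<in> A'" "y \<in> A'" "T x = T y"
    then show "x = y" using T[of x] T[of y] that by (auto simp: subset_iff)
  qed
  \<comment> \<open>The character of \<open>\<gamma>\<close> goes into the coefficients; this is why
    \<open>decouples\<close> has to hold for arbitrary \<open>a\<close>.\<close>
  define w where "w = (\<lambda>\<gamma> t. a (\<xi> + p ^ c * t) * poly_char k q \<gamma> (\<xi> + p ^ c * t))"
  \<comment> \<open>For every \<open>d\<close> the moment over \<open>freqs k q\<close> is the same,
    so summing over \<open>\<Omega>\<close> costs only its cardinality and places a complete moment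
    of dimension \<open>l\<close> inside, for each \<open>\<gamma>\<close> separately.\<close>
  have expand: "of_nat (card \<Omega>) * (\<Sum>\<gamma>\<in>freqs k q. W (poly_char k q \<gamma>) * norm (expsum A' a (poly_char k q \<gamma>)) ^ vexp l)
     = (\<Sum>\<gamma>\<in>freqs k q. W (poly_char k q \<gamma>) * (\<Sum>d\<in>\<Omega>. norm (expsum (T ` A') (w \<gamma>) (X d)) ^ vexp l))"
    if A': "A' \<subseteq> A" for A'
  proof -
    have "(\<Sum>\<gamma>\<in>freqs k q. W (poly_char k q \<gamma>) * norm (expsum A' a (poly_char k q \<gamma>)) ^ vexp l) =
       (\<Sum>\<gamma>\<in>freqs k q. W (poly_char k q \<gamma>) * norm (expsum (T ` A') (w \<gamma>) (X d)) ^ vexp l)" for d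
    proof (subst freqs_shift[OF q Rdeg[of d]], rule sum.cong[OF refl])
      fix \<gamma>
      have "expsum A' a (\<lambda>n. poly_char k q \<gamma> n * ee (poly (R d) n / q)) = u d * expsum (T ` A') (w \<gamma>) (X d)"
        unfolding expsum_def sum.reindex[OF Tinj[OF A']] sum_distrib_left
      proof (rule sum.cong[OF refl])
        fix n assume "n \<in> A'"
        then have n: "\<xi> + p ^ c * T n = n" using T[of n] A' by auto
        show "a n * (poly_char k q \<gamma> n * ee (poly (R d) n / q)) = u d * ((\<lambda>n. w \<gamma> n * X d n) \<circ> T) n"
          using RX[of d "T n"] by (simp add: w_def o_def n)
      qed
      then show "W (\<lambda>n. poly_char k q \<gamma> n * ee (poly (R d) n / q)) *
           norm (expsum A' a (\<lambda>n. poly_char k q \<gamma> n * ee (poly (R d) n / q))) ^ vexp l =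
           W (poly_char k q \<gamma>) * norm (expsum (T ` A') (w \<gamma>) (X d)) ^ vexp l"
        by (simp add: RW norm_mult u)
    qed
    then have "of_nat (card \<Omega>) * (\<Sum>\<gamma>\<in>freqs k q. W (poly_char k q \<gamma>) * norm (expsum A' a (poly_char k q \<gamma>)) ^ vexp l)
      = (\<Sum>d\<in>\<Omega>. \<Sum>\<gamma>\<in>freqs k q. W (poly_char k q \<gamma>) * norm (expsum (T ` A') (w \<gamma>) (X d)) ^ vexp l)"
      by simp
    also have "\<dots> = (\<Sum>\<gamma>\<in>freqs k q. W (poly_char k q \<gamma>) * (\<Sum>d\<in>\<Omega>. norm (expsum (T ` A') (w \<gamma>) (X d)) ^ vexp l))"
      by (subst sum.swap) (simp add: sum_distrib_left)
    finally show ?thesis .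
  qed
  have T_residue_class: "residue_class (T ` A) (p ^ b) \<eta> = T ` residue_class A (p ^ (c + b)) (\<xi> + p ^ c * \<eta>)" if \<eta>: "\<eta> \<in> {0..<p ^ b}" for \<eta>
  proof -
    have "T n mod p ^ b = \<eta> \<longleftrightarrow> n mod p ^ (c + b) = \<xi> + p ^ c * \<eta>" if "n \<in> A" for n
    proof -
      have "n mod p ^ (c + b) = p ^ c * (n div p ^ c mod p ^ b) + n mod p ^ c"
        unfolding power_add by (rule zmod_zmult2_eq) (use p in auto)
      also have "n div p ^ c = T n"
        using \<xi> p by (subst T[OF that], subst div_mult_self2) auto
      finally show ?thesis using A(2)[OF that] p by auto
    qed
    then show ?thesis by (auto simp: residue_class_def)
  qed
  have "of_nat (card \<Omega>) * (\<Sum>\<gamma>\<in>freqs k q. W (poly_char k q \<gamma>) * norm (expsum A a (poly_char k q \<gamma>)) ^ vexp l)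
    \<le> (\<Sum>\<gamma>\<in>freqs k q. W (poly_char k q \<gamma>) * (K * (\<Sum>\<eta>\<in>{0..<p ^ b}. \<Sum>d\<in>\<Omega>. norm (expsum (residue_class (T ` A) (p ^ b) \<eta>) (w \<gamma>) (X d)) ^ vexp l)))"
    unfolding expand[OF order.refl]
    using dec A(1) by (intro sum_mono mult_left_mono W) (auto simp: decouples_def \<Omega>_def X_def)
  also have "\<dots> = K * (\<Sum>\<eta>\<in>{0..<p ^ b}. \<Sum>\<gamma>\<in>freqs k q. W (poly_char k q \<gamma>) * (\<Sum>d\<in>\<Omega>. norm (expsum (residue_class (T ` A) (p ^ b) \<eta>) (w \<gamma>) (X d)) ^ vexp l))"
    by (subst sum.swap) (simp add: sum_distrib_left mult_ac)
  also have "(\<Sum>\<eta>\<in>{0..<p ^ b}. \<Sum>\<gamma>\<in>freqs k q. W (poly_char k q \<gamma>) * (\<Sum>d\<in>\<Omega>. norm (expsum (residue_class (T ` A) (p ^ b) \<eta>) (w \<gamma>) (X d)) ^ vexp l))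
     = (\<Sum>\<eta>\<in>{0..<p ^ b}. of_nat (card \<Omega>) * (\<Sum>\<gamma>\<in>freqs k q. W (poly_char k q \<gamma>) * norm (expsum (residue_class A (p ^ (c + b)) (\<xi> + p ^ c * \<eta>)) a (poly_char k q \<gamma>)) ^ vexp l))"
    by (intro sum.cong refl) (simp add: T_residue_class expand[OF residue_class_subset])
  also have "\<dots> = of_nat (card \<Omega>) * (\<Sum>\<xi>'\<in>subclasses p c (c + b) \<xi>. \<Sum>\<gamma>\<in>freqs k q. W (poly_char k q \<gamma>) * norm (expsum (residue_class A (p ^ (c + b)) \<xi>') a (poly_char k q \<gamma>)) ^ vexp l)"
    by (simp add: sum_distrib_left sum.reindex_bij_betw[OF subclasses_bij[OF p \<xi>, of b], symmetric])
  finally have "of_nat (card \<Omega>) * (\<Sum>\<gamma>\<in>freqs k q. W (poly_char k q \<gamma>) * norm (expsum A a (poly_char k q \<gamma>)) ^ vexp l) \<le>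
     of_nat (card \<Omega>) * (K * (\<Sum>\<xi>'\<in>subclasses p c (c + b) \<xi>. \<Sum>\<gamma>\<in>freqs k q. W (poly_char k q \<gamma>) * norm (expsum (residue_class A (p ^ (c + b)) \<xi>') a (poly_char k q \<gamma>)) ^ vexp l))"
    by (simp add: mult_ac)
  moreover have "card \<Omega> > 0"
    using p by (simp add: \<Omega>_def card_freqs)
  ultimately show ?thesis by (simp only: mult_le_cancel_left_pos of_nat_0_less_iff)
qed

lemma ee_zero_mod:
  fixes a q :: int
  assumes "q dvd a" "q > 0"
  shows "ee (a / q) = 1"
  using ee_cong[of q a 0] assms by simp

lemma phase_as_poly: "\<exists>R. degree R \<le> k \<and> (\<forall>n. poly R n = phase k c n)"
proof (intro exI conjI allI)
  show "degree (\<Sum>i\<le>k. monom (c i) i) \<le> k"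
    by (intro degree_sum_le) (auto intro: order_trans[OF degree_monom_le])
  show "poly (\<Sum>i\<le>k. monom (c i) i) n = phase k c n" for n
    by (simp add: poly_sum poly_monom phase_def)
qed

text \<open>The substitution \<open>n = \<xi> + p ^ c * t\<close> spreads a class modulo
  \<open>p ^ c\<close> over all integers \<open>t\<close> and leaves only \<open>B - c\<close>
  levels; it is \<open>transfer\<close> with the trivial weight.\<close>

lemma rescaled_decoupling:
  assumes dec: "decouples p k (B - c) K" and p: "p > 1" and cB: "c \<le> B"
    and \<xi>: "\<xi> \<in> {0..<p ^ c}" and A: "finite A" "\<And>n. n \<in> A \<Longrightarrow> n mod p ^ c = \<xi>"
  shows "(\<Sum>\<gamma>\<in>pfreqs p k B. amp p k B A a \<gamma> ^ vexp k)
    \<le> K * (\<Sum>\<xi>'\<in>subclasses p c B \<xi>. \<Sum>\<gamma>\<in>pfreqs p k B.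
        amp p k B (residue_class A (p ^ B) \<xi>') a \<gamma> ^ vexp k)"
proof -
  have "\<exists>R u. degree R \<le> k \<and> norm u = 1 \<and>
        (\<forall>t. ee (poly R (\<xi> + p ^ c * t) / real_of_int (p ^ (k * B))) = u * poly_char k (p ^ (k * (B - c))) d t)" for d
  proof -
    \<comment> \<open>The factor \<open>p ^ (k * c - j * c)\<close> completes
      \<open>(p ^ c * t) ^ j\<close>, so that all monomials share the factor
      \<open>p ^ (k * c)\<close>, which cancels against the denominator.\<close>
    obtain R0 where R0: "degree R0 \<le> k" "\<And>n. poly R0 n = phase k (\<lambda>j. d j * p ^ (k * c - j * c)) n"
      using phase_as_poly by metis
    define R where "R = R0 \<circ>\<^sub>p [:- \<xi>, 1:]"
    have "poly R (\<xi> + p ^ c * t) = p ^ (k * c) * phase k d t" for t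
    proof -
      have "poly R (\<xi> + p ^ c * t) = phase k (\<lambda>j. d j * p ^ (k * c - j * c)) (p ^ c * t)"
        by (simp add: R_def poly_pcompose R0)
      also have "\<dots> = (\<Sum>j\<le>k. p ^ (k * c) * (d j * t ^ j))"
        unfolding phase_def
      proof (intro sum.cong refl)
        fix j assume "j \<in> {..k}"
        then have "p ^ (k * c) = p ^ (k * c - j * c) * p ^ (j * c)"
          by (simp add: power_add[symmetric])
        then show "d j * p ^ (k * c - j * c) * (p ^ c * t) ^ j = p ^ (k * c) * (d j * t ^ j)"
          by (simp add: power_mult_distrib power_mult[symmetric] mult_ac)
      qed
      finally show ?thesis by (simp add: phase_def sum_distrib_left)
    qed
    moreover have "p ^ (k * B) = p ^ (k * c) * p ^ (k * (B - c))"
      using cB by (simp add: power_add[symmetric] add_mult_distrib2[symmetric])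
    ultimately have "real_of_int (poly R (\<xi> + p ^ c * t)) / real_of_int (p ^ (k * B)) =
        real_of_int (phase k d t) / real_of_int (p ^ (k * (B - c)))" for t
      using p by simp
    moreover have "degree R \<le> k"
      using R0(1) by (simp add: R_def degree_pcompose)
    ultimately show ?thesis
      by (intro exI[of _ R] exI[of _ 1]) (simp add: poly_char_def)
  qed
  then show ?thesis
    using transfer[OF dec p _ \<xi> A, of "p ^ (k * B)" "\<lambda>_. 1" k] p cB by simp
qed

section \<open>Polynomials that are flat on one residue class and a single monomial near
  another\<close>

lemma poly_ext_int: "(\<And>x. poly f x = poly g x) \<Longrightarrow> f = g" for f g :: "int poly"
  by (simp add: poly_eq_poly_eq_iff[symmetric] fun_eq_iff)

text \<open>The factor \<open>fact k\<close> clears the denominators \<open>j + 1\<close> of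
  termwise integration.\<close>

lemma antiderivative:
  fixes g :: "int poly"
  assumes "degree g < k"
  shows "\<exists>G. degree G \<le> k \<and> coeff G 0 = 0 \<and> pderiv G = smult (fact k) g"
proof -
  define G where "G = (\<Sum>j<k. monom (fact k div int (Suc j) * coeff g j) (Suc j))"
  have c: "coeff G i = (if 0 < i \<and> i \<le> k then fact k div int i * coeff g (i - 1) else 0)" for i
  proof (cases i)
    case (Suc j)
    have "coeff G i = (\<Sum>j'<k. if j' = j then fact k div int (Suc j) * coeff g j else 0)"
      unfolding G_def coeff_sum by (intro sum.cong) (auto simp: Suc)
    then show ?thesis by (simp add: Suc)
  qed (simp add: G_def coeff_sum)
  have "coeff (pderiv G) j = coeff (smult (fact k) g) j" for j
  proof (cases "j < k")
    case True
    have "int (Suc j) dvd int (fact k)" using True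
      by (intro of_nat_dvd_iff[THEN iffD2] dvd_fact) auto
    then have "int (Suc j) dvd fact k" by simp
    then have "int (Suc j) * (fact k div int (Suc j)) = fact k" by simp
    then have "int (Suc j) * (fact k div int (Suc j) * coeff g j) = fact k * coeff g j"
      by (metis mult.assoc)
    then show ?thesis using True by (simp add: coeff_pderiv c)
  next
    case False
    then show ?thesis using assms by (simp add: coeff_pderiv c coeff_eq_0)
  qed
  moreover have "degree G \<le> k" by (rule degree_le) (simp add: c)
  ultimately show ?thesis by (intro exI[of _ G]) (simp add: c poly_eq_iff)
qed

lemma cutoff_decomp:
  fixes g :: "'a :: comm_ring_1 poly"
  shows "\<exists>h. g = poly_cutoff l g + monom 1 l * h"
proof (intro exI)
  show "g = poly_cutoff l g + monom 1 l * poly_shift l g"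
    by (simp add: poly_eq_iff coeff_poly_cutoff coeff_monom_mult coeff_poly_shift)
qed

text \<open>\<open>G\<close> is an antiderivative of \<open>x ^ m * Q\<close>, where \<open>Q\<close> is a multiple of the Taylor polynomial at \<open>\<xi>\<close> of
  \<open>(x - \<xi>) ^ (i - 1) / x ^ m\<close>.\<close>

lemma adapted_polynomial:
  fixes \<xi> :: int
  assumes "1 \<le> i" "i \<le> l" "k = m + l"
  shows "\<exists>G u H. degree G \<le> k \<and> (\<forall>n. n ^ (m + 1) dvd poly G n) \<and> int i * u = fact k * \<xi> ^ (l * m) \<and>
     (\<forall>h. poly G (\<xi> + h) = poly G \<xi> + u * h ^ i + h ^ (l + 1) * poly H h)"
proof -
  \<comment> \<open>A truncated geometric series: it stands for
    \<open>\<xi> ^ l / (\<xi> + y)\<close> modulo \<open>y ^ l\<close> and avoids a division by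
    \<open>\<xi> + y\<close>.\<close>
  define V where "V = (\<Sum>j<l. monom (\<xi> ^ (l - Suc j) * (- 1) ^ j) j)"
  have polyV: "poly V y = (\<Sum>j<l. \<xi> ^ (l - Suc j) * (- y) ^ j)" for y
    unfolding V_def poly_sum poly_monom by (intro sum.cong refl) (simp add: power_minus' mult_ac power_minus[of y])
  have V: "(\<xi> + y) * poly V y = \<xi> ^ l - (- y) ^ l" for y
    using power_diff_sumr2[of "- y" l \<xi>] by (simp add: polyV algebra_simps)
  \<comment> \<open>Hence \<open>Q0\<close> is
    \<open>\<xi> ^ (l * m) * y ^ (i - 1) / (\<xi> + y) ^ m\<close> modulo \<open>y ^ l\<close>.
    Cutting it off below degree \<open>l\<close> keeps the later antiderivative within degree
    \<open>k\<close>.\<close>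
  define Q0 where "Q0 = V ^ m * monom 1 (i - 1)"
  define Q where "Q = poly_cutoff l Q0"
  obtain h0 where h0: "Q0 = Q + monom 1 l * h0" using cutoff_decomp[of Q0 l] unfolding Q_def by auto
  have degQ: "degree Q \<le> l - 1" unfolding Q_def
    by (rule degree_le) (use assms in \<open>auto simp: coeff_poly_cutoff\<close>)
  define M where "M = (monom 1 l :: int poly)"
  have "[:\<xi>, 1:] * V - [:\<xi> ^ l:] = M * [:- ((- 1) ^ l):]"
  proof (rule poly_ext_int)
    fix y
    have "poly ([:\<xi>, 1:] * V - [:\<xi> ^ l:]) y = (\<xi> + y) * poly V y - \<xi> ^ l" by (simp add: algebra_simps)
    also have "\<dots> = - ((-1) ^ l * y ^ l)" unfolding V by (subst power_minus) simp
    finally show "poly ([:\<xi>, 1:] * V - [:\<xi> ^ l:]) y = poly (M * [:- ((- 1) ^ l):]) y"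
      by (simp add: M_def poly_monom)
  qed
  then have "M dvd [:\<xi>, 1:] * V - [:\<xi> ^ l:]" by (metis dvd_triv_left)
  also have "[:\<xi>, 1:] * V - [:\<xi> ^ l:] dvd ([:\<xi>, 1:] * V) ^ m - [:\<xi> ^ l:] ^ m"
    by (simp add: power_diff_sumr2)
  finally have "M dvd (([:\<xi>, 1:] * V) ^ m - [:\<xi> ^ l:] ^ m) * monom 1 (i - 1)"
    by simp
  moreover have "(([:\<xi>, 1:] * V) ^ m - [:\<xi> ^ l:] ^ m) * monom 1 (i - 1) =
      [:\<xi>, 1:] ^ m * Q0 - [:\<xi> ^ l:] ^ m * monom 1 (i - 1)"
    by (simp only: Q0_def left_diff_distrib power_mult_distrib mult.assoc)
  moreover have "[:\<xi> ^ l:] ^ m * monom 1 (i - 1) = monom (\<xi> ^ (l * m)) (i - 1)"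
    by (simp add: poly_const_pow power_mult smult_monom)
  ultimately have "M dvd [:\<xi>, 1:] ^ m * Q0 - monom (\<xi> ^ (l * m)) (i - 1)" by simp
  then have "M dvd [:\<xi>, 1:] ^ m * Q + M * ([:\<xi>, 1:] ^ m * h0) - monom (\<xi> ^ (l * m)) (i - 1)"
    by (simp add: h0 M_def algebra_simps)
  then have "M dvd [:\<xi>, 1:] ^ m * Q - monom (\<xi> ^ (l * m)) (i - 1)"
    by (metis add_diff_eq diff_add_eq dvd_add_right_iff dvd_triv_left add.commute)
  then obtain h1 where h1: "[:\<xi>, 1:] ^ m * Q - monom (\<xi> ^ (l * m)) (i - 1) = M * h1" by blast
  \<comment> \<open>In the local variable \<open>D\<close> agrees with
    \<open>\<xi> ^ (l * m) * y ^ (i - 1)\<close> below degree \<open>l\<close>, so its integral has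
    a single monomial among the degrees 1 to \<open>l\<close>.\<close>
  define D where "D = [:\<xi>, 1:] ^ m * Q"
  have coeffD: "coeff D j = (if j = i - 1 then \<xi> ^ (l * m) else 0)" if "j < l" for j
  proof -
    have "coeff (D - monom (\<xi> ^ (l * m)) (i - 1)) j = 0"
      unfolding D_def h1 using that by (simp add: M_def coeff_monom_mult)
    then show ?thesis by auto
  qed
  \<comment> \<open>Back in the global variable the factor \<open>(\<xi> + y) ^ m\<close> is a power
    of the variable itself, and integration raises the order of vanishing at 0 to
    \<open>m + 1\<close>.\<close>
  define g where "g = D \<circ>\<^sub>p [:- \<xi>, 1:]"
  have g: "g = monom 1 m * (Q \<circ>\<^sub>p [:- \<xi>, 1:])"
  proof (rule poly_ext_int)
    fix y show "poly g y = poly (monom 1 m * (Q \<circ>\<^sub>p [:- \<xi>, 1:])) y"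
      by (simp add: g_def D_def poly_pcompose poly_monom)
  qed
  have "degree D \<le> m + (l - 1)"
    unfolding D_def by (rule order_trans[OF degree_mult_le]) (use degQ in \<open>simp add: degree_linear_power\<close>)
  then have "degree g < k" using assms by (simp add: g_def degree_pcompose)
  then obtain G where G: "degree G \<le> k" "coeff G 0 = 0" "pderiv G = smult (fact k) g"
    using antiderivative by blast
  define F where "F = G \<circ>\<^sub>p [:\<xi>, 1:]"
  have gD: "g \<circ>\<^sub>p [:\<xi>, 1:] = D"
    by (simp add: g_def pcompose_assoc[symmetric] pcompose_pCons)
  have dF: "pderiv F = smult (fact k) D"
    unfolding F_def pderiv_pcompose G(3) pcompose_smult gD by (simp add: pderiv_pCons)
  have coeffF: "int (Suc j) * coeff F (Suc j) = fact k * (if j = i - 1 then \<xi> ^ (l * m) else 0)" if "j < l" for j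
    using arg_cong[OF dF, of "\<lambda>f. coeff f j"] coeffD[OF that] by (simp add: coeff_pderiv)
  define u where "u = coeff F i"
  have u: "int i * u = fact k * \<xi> ^ (l * m)"
    using coeffF[of "i - 1"] assms by (simp add: u_def)
  obtain H where H: "F = poly_cutoff (l + 1) F + monom 1 (l + 1) * H" using cutoff_decomp[of F "l + 1"] by (elim exE)
  have cut: "poly_cutoff (l + 1) F = [:coeff F 0:] + monom u i"
  proof (rule poly_eqI)
    fix j
    show "coeff (poly_cutoff (l + 1) F) j = coeff ([:coeff F 0:] + monom u i) j"
    proof (cases j)
      case 0
      then show ?thesis using assms by (simp add: coeff_poly_cutoff)
    next
      case (Suc j')
      show ?thesis
      proof (cases "j < l + 1 \<and> j \<noteq> i")
        case True
        then have "int (Suc j') * coeff F (Suc j') = 0" using coeffF[of j'] Suc assms(1) by auto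
        then have "coeff F j = 0" using Suc by simp
        then show ?thesis using True Suc by (simp add: coeff_poly_cutoff)
      next
        case False
        then consider "j = i" | "j \<noteq> i" "\<not> j < l + 1" by blast
        then show ?thesis
        proof cases
          case 1
          then show ?thesis using assms(1,2) by (simp add: coeff_poly_cutoff u_def coeff_pCons split: nat.splits)
        next
          case 2
          then show ?thesis using Suc by (simp add: coeff_poly_cutoff coeff_pCons)
        qed
      qed
    qed
  qed
  have F: "F = [:coeff F 0:] + monom u i + monom 1 (l + 1) * H" by (rule H[unfolded cut])
  have F_eq: "poly G (\<xi> + h) = coeff F 0 + u * h ^ i + h ^ (l + 1) * poly H h" for h
  proof -
    have "poly G (\<xi> + h) = poly F h" by (simp add: F_def poly_pcompose)
    also have "\<dots> = poly ([:coeff F 0:] + monom u i + monom 1 (l + 1) * H) h" using arg_cong[OF F, of "\<lambda>f. poly f h"] .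
    finally show ?thesis by (simp add: poly_monom)
  qed
  have "coeff F 0 = poly G \<xi>" using F_eq[of 0] assms by simp
  moreover have "n ^ (m + 1) dvd poly G n" for n
  proof -
    have "poly_cutoff (m + 1) G = 0"
    proof (rule poly_eqI)
      fix j
      show "coeff (poly_cutoff (m + 1) G) j = coeff 0 j"
      proof (cases j)
        case (Suc j')
        have "int (Suc j') * coeff G (Suc j') = fact k * coeff g j'"
          using arg_cong[OF G(3), of "\<lambda>f. coeff f j'"] by (simp add: coeff_pderiv)
        moreover have "coeff g j' = 0" if "j' < m" using that by (simp add: g coeff_monom_mult)
        ultimately show ?thesis using Suc by (auto simp: coeff_poly_cutoff)
      qed (simp add: coeff_poly_cutoff G(2))
    qed
    then obtain h where "G = monom 1 (m + 1) * h" using cutoff_decomp[of G "m + 1"] by auto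
    then show ?thesis by (simp add: poly_monom)
  qed
  ultimately show ?thesis using G(1) u F_eq by metis
qed

text \<open>The characters divisible by \<open>(x - \<xi>') ^ (k - l + 1)\<close> with denominator \<open>p ^ E\<close> are trivial on \<open>A'\<close>, and modulo \<open>p ^ E\<close>
  their Taylor expansions at \<open>\<xi>\<close> stop at degree \<open>l\<close>.\<close>

lemma key_step:
  assumes dec: "decouples p l b' K" and p: "prime p" "int k < p" and l: "1 \<le> l" "l < k"
    and E: "E \<le> (k - l + 1) * b" "E \<le> (l + 1) * c" "l * (c + b') \<le> E" "E \<le> k * B"
    and \<xi>: "\<xi> \<in> {0..<p ^ c}" and A: "finite A" "\<And>n. n \<in> A \<Longrightarrow> n mod p ^ c = \<xi>"
    and A': "\<And>n. n \<in> A' \<Longrightarrow> n mod p ^ b = \<xi>'" and ndvd: "\<not> p dvd \<xi> - \<xi>'"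
  shows "(\<Sum>\<gamma>\<in>pfreqs p k B. amp p k B A' a \<gamma> ^ e *
        amp p k B A a \<gamma> ^ vexp l)
    \<le> K * (\<Sum>\<xi>\<^sub>1\<in>subclasses p c (c + b') \<xi>. \<Sum>\<gamma>\<in>pfreqs p k B.
        amp p k B A' a \<gamma> ^ e *
        amp p k B (residue_class A (p ^ (c + b')) \<xi>\<^sub>1) a \<gamma> ^ vexp l)"
proof (rule transfer[OF dec _ _ \<xi> A, where W = "\<lambda>\<psi>. norm (expsum A' a \<psi>) ^ e"])
  show "p > 1" "0 < p ^ (k * B)" using p(1) prime_gt_1_int prime_gt_0_int by auto
  then have p0: "p > 0" by simp
  fix d :: "nat \<Rightarrow> int"
  define x where "x = \<xi> - \<xi>'"
  define m where "m = k - l"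
  have ki: "k = m + l" using l by (simp add: m_def)
  have cop_fact: "coprime p (fact k)"
  proof -
    have "\<not> nat p dvd fact k"
      using p by (subst prime_dvd_fact_iff) (auto simp: prime_nat_iff_prime)
    then have "\<not> int (nat p) dvd int (fact k)" by (simp only: of_nat_dvd_iff not_False_eq_True)
    then have "\<not> p dvd fact k" using p0 by simp
    then show ?thesis using p(1) by (simp add: prime_imp_coprime)
  qed
  have cop_x: "coprime p x" using p(1) ndvd by (simp add: prime_imp_coprime x_def)
  \<comment> \<open>The facts for one monomial \<open>i\<close> are bundled so that the polynomials
    for all \<open>i\<close> can be chosen together; \<open>v\<close> is the inverse of the unit
    \<open>u\<close>.\<close>
  define P where "P i G u v C \<longleftrightarrow> degree G \<le> k \<and> (\<forall>n. n ^ (m + 1) dvd poly G n) \<and> [u * v = 1] (mod p ^ E) \<and>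
     (\<forall>h. p ^ c dvd h \<longrightarrow> [poly G (x + h) = C + u * h ^ i] (mod p ^ E))" for i G u v C
  have "\<forall>i\<in>{1..l}. \<exists>z. P i (fst z) (fst (snd z)) (fst (snd (snd z))) (snd (snd (snd z)))"
  proof
    fix i assume i: "i \<in> {1..l}"
    obtain G u H where G: "degree G \<le> k" "\<And>n. n ^ (m + 1) dvd poly G n" "int i * u = fact k * x ^ (l * m)"
      "\<And>h. poly G (x + h) = poly G x + u * h ^ i + h ^ (l + 1) * poly H h"
      using adapted_polynomial[of i l k m x] i ki by auto
    have "coprime p (int i * u)" unfolding G(3) using cop_fact cop_x by simp
    then have "coprime u (p ^ E)" by (simp add: coprime_commute)
    then obtain v where v: "[u * v = 1] (mod p ^ E)" using cong_solve_coprime_int by blast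
    have "[poly G (x + h) = poly G x + u * h ^ i] (mod p ^ E)" if "p ^ c dvd h" for h
    proof -
      have "(p ^ c) ^ (l + 1) dvd h ^ (l + 1)" using that by (rule dvd_power_same)
      moreover have "p ^ E dvd (p ^ c) ^ (l + 1)"
        using E(2) by (simp add: power_mult[symmetric] le_imp_power_dvd mult.commute del: power_Suc)
      ultimately have "p ^ E dvd h ^ (l + 1) * poly H h" by (meson dvd_mult2 dvd_trans)
      then show ?thesis unfolding G(4) by (simp add: cong_iff_dvd_diff)
    qed
    then have "P i G u v (poly G x)" using G(1,2) v by (simp add: P_def)
    then show "\<exists>z. P i (fst z) (fst (snd z)) (fst (snd (snd z))) (snd (snd (snd z)))"
      by (metis fst_conv snd_conv)
  qed
  from bchoice[OF this] obtain z where
    z: "\<forall>i\<in>{1..l}. P i (fst (z i)) (fst (snd (z i))) (fst (snd (snd (z i)))) (snd (snd (snd (z i))))" by blast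
  define G u v C where "G = (\<lambda>i. fst (z i))" and "u = (\<lambda>i. fst (snd (z i)))"
    and "v = (\<lambda>i. fst (snd (snd (z i))))" and "C = (\<lambda>i. snd (snd (snd (z i))))"
  have G: "\<And>i. i \<in> {1..l} \<Longrightarrow> degree (G i) \<le> k"
    "\<And>i n. i \<in> {1..l} \<Longrightarrow> n ^ (m + 1) dvd poly (G i) n"
    "\<And>i. i \<in> {1..l} \<Longrightarrow> [u i * v i = 1] (mod p ^ E)"
    "\<And>i h. i \<in> {1..l} \<Longrightarrow> p ^ c dvd h \<Longrightarrow> [poly (G i) (x + h) = C i + u i * h ^ i] (mod p ^ E)"
    using z by (auto simp: P_def G_def u_def v_def C_def)
  \<comment> \<open>\<open>v i\<close> removes the unit \<open>u i\<close>, and the power of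
    \<open>p\<close> turns \<open>(p ^ c * t) ^ i / p ^ E\<close> into
    \<open>t ^ i / p ^ (l * b')\<close>. The subtraction does not truncate, because
    \<open>l * (c + b') \<le> E\<close>.\<close>
  define f where "f = (\<lambda>i. d i * v i * p ^ (E - c * i - l * b'))"
  define R0 where "R0 = (\<Sum>i\<in>{1..l}. smult (f i) (G i))"
  define R where "R = smult (p ^ (k * B - E)) (R0 \<circ>\<^sub>p [:- \<xi>', 1:])"
  have "degree R0 \<le> k"
    unfolding R0_def by (rule degree_sum_le) (use G(1) in \<open>auto intro: order_trans[OF degree_smult_le]\<close>)
  then have degR: "degree R \<le> k"
    unfolding R_def by (intro order_trans[OF degree_smult_le]) (simp add: degree_pcompose)
  have quot: "real_of_int (poly R n) / real_of_int (p ^ (k * B)) = real_of_int (poly R0 (n - \<xi>')) / real_of_int (p ^ E)" for n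
  proof -
    have "p ^ (k * B) = p ^ (k * B - E) * p ^ E" using E(4) by (simp add: power_add[symmetric])
    then show ?thesis using p0 by (simp add: R_def poly_pcompose)
  qed
  have one: "ee (poly R n / real_of_int (p ^ (k * B))) = 1" if "n \<in> A'" for n
  proof -
    have "p ^ b dvd n - \<xi>'" using A'[OF that] by (metis dvd_minus_mod)
    then have "(p ^ b) ^ (m + 1) dvd (n - \<xi>') ^ (m + 1)" by (rule dvd_power_same)
    moreover have "p ^ E dvd (p ^ b) ^ (m + 1)"
      using E(1) by (simp add: power_mult[symmetric] le_imp_power_dvd mult.commute m_def del: power_Suc)
    ultimately have "p ^ E dvd poly R0 (n - \<xi>')"
      unfolding R0_def poly_sum by (intro dvd_sum) (metis G(2) dvd_trans dvd_mult poly_smult)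
    then show ?thesis unfolding quot using p0 by (intro ee_zero_mod) simp_all
  qed
  have W: "norm (expsum A' a (\<lambda>n. \<psi> n * ee (poly R n / real_of_int (p ^ (k * B))))) ^ e = norm (expsum A' a \<psi>) ^ e" for \<psi>
  proof -
    have "expsum A' a (\<lambda>n. \<psi> n * ee (poly R n / real_of_int (p ^ (k * B)))) = expsum A' a \<psi>"
      unfolding expsum_def by (intro sum.cong refl) (simp only: one mult_1_right)
    then show ?thesis by simp
  qed
  \<comment> \<open>The constant terms \<open>C i\<close> are uncontrolled and the term
    \<open>d 0\<close> is missing; both only produce a factor of modulus one.\<close>
  define C0 where "C0 = (\<Sum>i\<in>{1..l}. f i * C i) - p ^ (E - l * b') * d 0"
  have lb: "l * b' \<le> E" using E(3) by (simp add: distrib_left)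
  have main: "ee (poly R (\<xi> + p ^ c * t) / real_of_int (p ^ (k * B))) = ee (C0 / real_of_int (p ^ E)) * poly_char l (p ^ (l * b')) d t" for t
  proof -
    have "[poly R0 (x + p ^ c * t) = (\<Sum>i\<in>{1..l}. f i * C i + d i * p ^ (E - l * b') * t ^ i)] (mod p ^ E)"
      unfolding R0_def poly_sum poly_smult
    proof (rule cong_sum)
      fix i assume i: "i \<in> {1..l}"
      have "[f i * poly (G i) (x + p ^ c * t) = f i * (C i + u i * (p ^ c * t) ^ i)] (mod p ^ E)"
        using G(4)[OF i, of "p ^ c * t"] by (intro cong_scalar_left) simp
      also have "f i * (C i + u i * (p ^ c * t) ^ i) = f i * C i + (u i * v i) * (d i * p ^ (E - l * b') * t ^ i)"
      proof -
        have "c * i + l * b' \<le> E"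
          using E(3) i by (metis add_mult_distrib2 atLeastAtMost_iff add_le_mono1 mult.commute mult_le_mono2 order_trans)
        then have "p ^ (E - l * b') = p ^ (E - c * i - l * b') * p ^ (c * i)"
          by (simp add: power_add[symmetric])
        then show ?thesis by (simp add: f_def algebra_simps power_mult_distrib power_mult)
      qed
      also have "[\<dots> = f i * C i + 1 * (d i * p ^ (E - l * b') * t ^ i)] (mod p ^ E)"
        by (intro cong_add cong_scalar_right G(3) i) simp
      finally show "[f i * poly (G i) (x + p ^ c * t) = f i * C i + d i * p ^ (E - l * b') * t ^ i] (mod p ^ E)" by simp
    qed
    also have "(\<Sum>i\<in>{1..l}. f i * C i + d i * p ^ (E - l * b') * t ^ i) = C0 + p ^ (E - l * b') * phase l d t"
    proof -
      have "phase l d t = d 0 + (\<Sum>i\<in>{1..l}. d i * t ^ i)"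
      proof -
        have "{..l} = insert 0 {1..l}" by auto
        then show ?thesis unfolding phase_def by (simp add: sum.insert_if)
      qed
      then show ?thesis by (simp add: C0_def sum.distrib sum_distrib_left algebra_simps)
    qed
    finally have "ee (poly R0 (x + p ^ c * t) / real_of_int (p ^ E)) = ee ((C0 + p ^ (E - l * b') * phase l d t) / real_of_int (p ^ E))"
      using p0 by (intro ee_cong) (auto simp: cong_def)
    also have "real_of_int (C0 + p ^ (E - l * b') * phase l d t) / real_of_int (p ^ E) = C0 / real_of_int (p ^ E) + phase l d t / real_of_int (p ^ (l * b'))"
    proof -
      have "p ^ E = p ^ (E - l * b') * p ^ (l * b')" using lb by (simp add: power_add[symmetric])
      then show ?thesis using p0 by (simp add: field_simps)
    qed
    finally show ?thesis unfolding quot by (simp add: x_def algebra_simps ee_add poly_char_def)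
  qed
  show "\<exists>R u. degree R \<le> k \<and> norm u = 1 \<and>
        (\<forall>t. ee (poly R (\<xi> + p ^ c * t) / real_of_int (p ^ (k * B))) = u * poly_char l (p ^ (l * b')) d t) \<and>
        (\<forall>\<psi>. norm (expsum A' a (\<lambda>n. \<psi> n * ee (poly R n / real_of_int (p ^ (k * B))))) ^ e = norm (expsum A' a \<psi>) ^ e)"
    using degR W main by (intro exI[of _ R] exI[of _ "ee (C0 / real_of_int (p ^ E))"]) simp
qed simp_all

section \<open>Convexity and Hoelder's inequality\<close>

lemma convex_on_nonneg_power: "convex_on {0::real..} (\<lambda>x. x ^ n)"
  by (cases "even n") (auto intro: convex_power_odd convex_on_subset[OF convex_power_even])

lemma weighted_power_mean:
  fixes w x :: "'a \<Rightarrow> real"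
  assumes "finite S" "\<And>i. i \<in> S \<Longrightarrow> w i \<ge> 0" "\<And>i. i \<in> S \<Longrightarrow> x i \<ge> 0" "P \<ge> 1"
  shows "(\<Sum>i\<in>S. w i * x i) ^ P \<le> (\<Sum>i\<in>S. w i) ^ (P - 1) * (\<Sum>i\<in>S. w i * x i ^ P)"
proof (cases "(\<Sum>i\<in>S. w i) = 0")
  case True
  then have "w i = 0" if "i \<in> S" for i
    using that assms(1,2) by (simp add: sum_nonneg_eq_0_iff)
  then show ?thesis using assms(4) by (simp add: power_0_left)
next
  case False
  define W where "W = (\<Sum>i\<in>S. w i)"
  have W: "W > 0" using False assms(2) by (simp add: W_def sum_nonneg less_le)
  then have "S \<noteq> {}" by (auto simp: W_def)
  have "(\<Sum>i\<in>S. (w i / W) *\<^sub>R x i) ^ P \<le> (\<Sum>i\<in>S. (w i / W) * x i ^ P)"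
    by (rule convex_on_sum[OF assms(1) \<open>S \<noteq> {}\<close> convex_on_nonneg_power[of P]])
      (use assms W in \<open>auto simp: sum_divide_distrib[symmetric] W_def\<close>)
  then have "((\<Sum>i\<in>S. w i * x i) / W) ^ P \<le> (\<Sum>i\<in>S. w i * x i ^ P) / W"
    by (simp add: sum_divide_distrib)
  then have "(\<Sum>i\<in>S. w i * x i) ^ P \<le> (\<Sum>i\<in>S. w i * x i ^ P) / W * W ^ P"
    using W by (simp add: power_divide field_simps)
  also have "W ^ P = W * W ^ (P - 1)" using assms(4) by (simp add: power_eq_if)
  finally show ?thesis using W by (simp add: W_def mult_ac)
qed

lemma power_mean:
  fixes x :: "'a \<Rightarrow> real"
  assumes "finite S" "\<And>i. i \<in> S \<Longrightarrow> x i \<ge> 0" "P \<ge> 1"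
  shows "(\<Sum>i\<in>S. x i) ^ P \<le> real (card S) ^ (P - 1) * (\<Sum>i\<in>S. x i ^ P)"
  using weighted_power_mean[of S "\<lambda>_. 1" x P] assms by simp

lemma holder_sum:
  fixes u v :: "'a \<Rightarrow> real"
  assumes S: "finite S" and u: "\<And>i. i \<in> S \<Longrightarrow> u i \<ge> 0" and v: "\<And>i. i \<in> S \<Longrightarrow> v i \<ge> 0"
    and t: "0 \<le> t" "t \<le> 1"
  shows "(\<Sum>i\<in>S. u i powr t * v i powr (1 - t)) \<le> (\<Sum>i\<in>S. u i) powr t * (\<Sum>i\<in>S. v i) powr (1 - t)"
proof (cases "(\<Sum>i\<in>S. u i) = 0 \<or> (\<Sum>i\<in>S. v i) = 0")
  case True
  then have "(\<forall>i\<in>S. u i = 0) \<or> (\<forall>i\<in>S. v i = 0)"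
    using S u v by (simp add: sum_nonneg_eq_0_iff)
  then show ?thesis by auto
next
  case False
  define U V where "U = (\<Sum>i\<in>S. u i)" and "V = (\<Sum>i\<in>S. v i)"
  have UV: "U > 0" "V > 0" using False u v by (auto simp: U_def V_def sum_nonneg less_le)
  have *: "u i powr t * v i powr (1 - t) \<le> U powr t * V powr (1 - t) * (t * (u i / U) + (1 - t) * (v i / V))"
    if i: "i \<in> S" for i
  proof (cases "u i = 0 \<or> v i = 0")
    case True
    then have "u i powr t * v i powr (1 - t) = 0" by auto
    also have "\<dots> \<le> U powr t * V powr (1 - t) * (t * (u i / U) + (1 - t) * (v i / V))"
      using UV t u[OF i] v[OF i] by (intro mult_nonneg_nonneg add_nonneg_nonneg) auto
    finally show ?thesis .
  next
    case False
    then have "u i > 0" "v i > 0" using u[OF i] v[OF i] by auto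
    then have "(u i / U) powr t * (v i / V) powr (1 - t) \<le> t * (u i / U) + (1 - t) * (v i / V)"
      using UV t by (intro Youngs_inequality_0) auto
    moreover have "(u i / U) powr t * (v i / V) powr (1 - t) * (U powr t * V powr (1 - t)) = u i powr t * v i powr (1 - t)"
      using UV \<open>u i > 0\<close> \<open>v i > 0\<close> by (simp add: powr_divide)
    moreover have "U powr t * V powr (1 - t) > 0" using UV by simp
    ultimately show ?thesis by (metis mult.commute mult_le_cancel_left_pos)
  qed
  have "(\<Sum>i\<in>S. u i powr t * v i powr (1 - t)) \<le> (\<Sum>i\<in>S. U powr t * V powr (1 - t) * (t * (u i / U) + (1 - t) * (v i / V)))"
    by (intro sum_mono *)
  also have "\<dots> = U powr t * V powr (1 - t) * (t * (\<Sum>i\<in>S. u i / U) + (1 - t) * (\<Sum>i\<in>S. v i / V))"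
    by (simp only: sum_distrib_left[symmetric] sum.distrib)
  also have "\<dots> = U powr t * V powr (1 - t)"
    using UV by (simp add: sum_divide_distrib[symmetric] U_def[symmetric] V_def[symmetric])
  finally show ?thesis by (simp add: U_def V_def)
qed

section \<open>Orthogonality of additive characters\<close>

lemma ee_eq_1_iff: "ee x = 1 \<longleftrightarrow> (\<exists>m. x = of_int m)"
proof
  assume "ee x = 1"
  then have "cos (2 * pi * x) = 1" by (simp add: ee_def complex_eq_iff)
  then obtain m where "2 * pi * x = of_int m * 2 * pi" using cos_one_2pi_int by auto
  then have "x = of_int m" by simp
  then show "\<exists>m. x = of_int m" by blast
qed auto

lemma sum_ee:
  fixes q m :: int
  assumes "q > 0"
  shows "(\<Sum>j\<in>{0..<q}. ee (j * m / q)) = (if q dvd m then of_int q else 0)"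
proof (cases "q dvd m")
  case True
  then have "ee (j * m / q) = 1" for j :: int
    using ee_zero_mod[of q "j * m"] assms by simp
  then show ?thesis using True assms by simp
next
  case False
  have w: "ee (m / q) \<noteq> 1"
  proof
    assume "ee (m / q) = 1"
    then obtain t :: int where "m / q = (of_int t :: real)" using ee_eq_1_iff by blast
    then have "real_of_int m = of_int (q * t)" using assms by (simp add: field_simps)
    then have "m = q * t" by (simp only: of_int_eq_iff)
    then show False using False by simp
  qed
  have "(\<Sum>j\<in>{0..<q}. ee (j * m / q)) = (\<Sum>j\<in>{0..<q}. ee (((j + 1) mod q) * m / q))"
    using sum.reindex_bij_betw[OF bij_mod_shift[OF assms, of 1], of "\<lambda>j. ee (j * m / q)"] by simp
  also have "\<dots> = (\<Sum>j\<in>{0..<q}. ee (m / q) * ee (j * m / q))"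
  proof (intro sum.cong refl)
    fix j :: int
    have "ee (real_of_int ((j + 1) mod q * m) / q) = ee (real_of_int ((j + 1) * m) / q)"
      using assms by (intro ee_cong) (auto simp: mod_mult_left_eq)
    also have "real_of_int ((j + 1) * m) / q = m / q + j * m / q" by (simp add: distrib_right add_divide_distrib)
    finally show "ee (real_of_int ((j + 1) mod q * m) / q) = ee (m / q) * ee (j * m / q)" by (simp add: ee_add)
  qed
  finally have "(\<Sum>j\<in>{0..<q}. ee (j * m / q)) = ee (m / q) * (\<Sum>j\<in>{0..<q}. ee (j * m / q))"
    unfolding sum_distrib_left .
  then show ?thesis using w False by auto
qed

lemma parseval:
  fixes q :: int and z :: "int \<Rightarrow> complex"
  assumes "q > 0"
  shows "(\<Sum>j\<in>{0..<q}. (norm (\<Sum>x\<in>{0..<q}. ee (j * x / q) * z x))\<^sup>2) = q * (\<Sum>x\<in>{0..<q}. (norm (z x))\<^sup>2)"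
proof -
  have "of_real (\<Sum>j\<in>{0..<q}. (norm (\<Sum>x\<in>{0..<q}. ee (j * x / q) * z x))\<^sup>2)
    = (\<Sum>j\<in>{0..<q}. (\<Sum>x\<in>{0..<q}. \<Sum>y\<in>{0..<q}. z x * cnj (z y) * ee (j * (x - y) / q)))"
    unfolding of_real_sum
  proof (intro sum.cong refl)
    fix j :: int
    have "complex_of_real ((norm (\<Sum>x\<in>{0..<q}. ee (j * x / q) * z x))\<^sup>2) =
      (\<Sum>x\<in>{0..<q}. ee (j * x / q) * z x) * (\<Sum>y\<in>{0..<q}. cnj (ee (j * y / q) * z y))"
      by (simp only: complex_norm_square cnj_sum)
    also have "\<dots> = (\<Sum>x\<in>{0..<q}. \<Sum>y\<in>{0..<q}. z x * cnj (z y) * ee (j * (x - y) / q))"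
      unfolding sum_product
    proof (intro sum.cong refl)
      fix x y :: int
      have "ee (j * (x - y) / q) = ee (j * x / q) * cnj (ee (j * y / q))"
        by (simp add: ee_minus[symmetric] ee_add[symmetric] diff_divide_distrib right_diff_distrib)
      then show "ee (j * x / q) * z x * cnj (ee (j * y / q) * z y) = z x * cnj (z y) * ee (j * (x - y) / q)"
        by simp
    qed
    finally show "complex_of_real ((norm (\<Sum>x\<in>{0..<q}. ee (j * x / q) * z x))\<^sup>2) =
      (\<Sum>x\<in>{0..<q}. \<Sum>y\<in>{0..<q}. z x * cnj (z y) * ee (j * (x - y) / q))" .
  qed
  also have "\<dots> = (\<Sum>x\<in>{0..<q}. \<Sum>j\<in>{0..<q}. \<Sum>y\<in>{0..<q}. z x * cnj (z y) * ee (j * (x - y) / q))"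
    by (rule sum.swap)
  also have "\<dots> = (\<Sum>x\<in>{0..<q}. \<Sum>y\<in>{0..<q}. \<Sum>j\<in>{0..<q}. z x * cnj (z y) * ee (j * (x - y) / q))"
    by (rule sum.cong[OF refl], rule sum.swap)
  also have "\<dots> = (\<Sum>x\<in>{0..<q}. \<Sum>y\<in>{0..<q}. z x * cnj (z y) * (\<Sum>j\<in>{0..<q}. ee (j * (x - y) / q)))"
    by (simp only: sum_distrib_left)
  also have "\<dots> = (\<Sum>x\<in>{0..<q}. \<Sum>y\<in>{0..<q}. if y = x then z x * cnj (z x) * of_int q else 0)"
  proof (intro sum.cong refl)
    fix x y assume xy: "x \<in> {0..<q}" "y \<in> {0..<q}"
    have "(\<Sum>j\<in>{0..<q}. ee (j * (x - y) / q)) = (if q dvd x - y then of_int q else 0)"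
      using sum_ee[OF assms, of "x - y"] by simp
    moreover have "q dvd x - y \<longleftrightarrow> y = x"
      using xy by (auto simp: mod_eq_dvd_iff[symmetric])
    ultimately show "z x * cnj (z y) * (\<Sum>j\<in>{0..<q}. ee (j * (x - y) / q)) = (if y = x then z x * cnj (z x) * of_int q else 0)"
      by auto
  qed
  also have "\<dots> = of_real (q * (\<Sum>x\<in>{0..<q}. (norm (z x))\<^sup>2))"
    by (simp add: sum_distrib_left complex_norm_square[unfolded of_real_power] mult_ac)
  finally show ?thesis by (simp only: of_real_eq_iff)
qed

lemma expsum_classes:
  fixes A :: "int set"
  assumes "finite A" "m > 0"
  shows "expsum A a \<psi> = (\<Sum>\<xi>\<in>{0..<m}. expsum (residue_class A m \<xi>) a \<psi>)"
proof -
  have "(\<Sum>\<xi>\<in>{0..<m}. expsum (residue_class A m \<xi>) a \<psi>) = (\<Sum>\<xi>\<in>{0..<m}. \<Sum>n | n \<in> A \<and> n mod m = \<xi>. a n * \<psi> n)"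
    by (simp add: expsum_def residue_class_def)
  also have "\<dots> = expsum A a \<psi>"
    unfolding expsum_def by (rule sum.group) (use assms in auto)
  finally show ?thesis by simp
qed

text \<open>The exponent is 2. Averaging over the linear frequency \<open>j\<close> makes distinct
  classes modulo \<open>p ^ B\<close> orthogonal, so equality holds and the induction on the
  dimension starts without loss.\<close>

lemma decouples_1:
  assumes p: "p > 1"
  shows "decouples p 1 B 1"
  unfolding decouples_def
proof (intro allI impI)
  fix A :: "int set" and a :: "int \<Rightarrow> complex" assume A: "finite A"
  define q where "q = p ^ B"
  have q: "q > 0" using p by (simp add: q_def)
  have "(\<Sum>c\<in>freqs 1 q. (norm (expsum A a (poly_char 1 q c)))\<^sup>2) =
     (\<Sum>c\<in>freqs 1 q. (norm (\<Sum>x\<in>{0..<q}. ee (j * x / q) * expsum (residue_class A q x) a (poly_char 1 q c)))\<^sup>2)" for j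
  proof (subst freqs_shift[OF q, of "monom j 1"])
    show "degree (monom j 1) \<le> 1" by (rule degree_monom_le)
    have "expsum (residue_class A q x) a (\<lambda>n. poly_char 1 q c n * ee (real_of_int (poly (monom j 1) n) / q))
       = ee (j * x / q) * expsum (residue_class A q x) a (poly_char 1 q c)" for x c
      unfolding expsum_def sum_distrib_left
    proof (intro sum.cong refl)
      fix n assume "n \<in> residue_class A q x"
      then have "n mod q = x" by (simp add: residue_class_def)
      then have "ee (real_of_int (j * n) / q) = ee (real_of_int (j * x) / q)"
        using q by (intro ee_cong) (auto simp: mod_mult_right_eq)
      then show "a n * (poly_char 1 q c n * ee (real_of_int (poly (monom j 1) n) / q)) = ee (j * x / q) * (a n * poly_char 1 q c n)"
        by (simp add: poly_monom)
    qed
    then show "(\<Sum>c\<in>freqs 1 q. (norm (expsum A a (\<lambda>n. poly_char 1 q c n * ee (real_of_int (poly (monom j 1) n) / q))))\<^sup>2) =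
       (\<Sum>c\<in>freqs 1 q. (norm (\<Sum>x\<in>{0..<q}. ee (j * x / q) * expsum (residue_class A q x) a (poly_char 1 q c)))\<^sup>2)"
      by (subst expsum_classes[OF A q]) simp
  qed
  then have "of_int q * (\<Sum>c\<in>freqs 1 q. (norm (expsum A a (poly_char 1 q c)))\<^sup>2) =
     (\<Sum>j\<in>{0..<q}. \<Sum>c\<in>freqs 1 q. (norm (\<Sum>x\<in>{0..<q}. ee (j * x / q) * expsum (residue_class A q x) a (poly_char 1 q c)))\<^sup>2)"
    using q by simp
  also have "\<dots> = (\<Sum>c\<in>freqs 1 q. \<Sum>j\<in>{0..<q}. (norm (\<Sum>x\<in>{0..<q}. ee (j * x / q) * expsum (residue_class A q x) a (poly_char 1 q c)))\<^sup>2)"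
    by (rule sum.swap)
  also have "\<dots> = of_int q * (\<Sum>c\<in>freqs 1 q. \<Sum>x\<in>{0..<q}. (norm (expsum (residue_class A q x) a (poly_char 1 q c)))\<^sup>2)"
    by (simp only: parseval[OF q] sum_distrib_left)
  finally have "(\<Sum>c\<in>freqs 1 q. (norm (expsum A a (poly_char 1 q c)))\<^sup>2) =
     (\<Sum>x\<in>{0..<q}. \<Sum>c\<in>freqs 1 q. (norm (expsum (residue_class A q x) a (poly_char 1 q c)))\<^sup>2)"
    using q by (subst sum.swap) simp
  moreover have "vexp 1 = 2" by (simp add: vexp_def)
  ultimately show "(\<Sum>c\<in>freqs 1 (p ^ (1 * B)). norm (expsum A a (poly_char 1 (p ^ (1 * B)) c)) ^ vexp 1)
     \<le> 1 * (\<Sum>\<xi>\<in>{0..<p ^ B}. \<Sum>c\<in>freqs 1 (p ^ (1 * B)).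
            norm (expsum (residue_class A (p ^ B) \<xi>) a (poly_char 1 (p ^ (1 * B)) c)) ^ vexp 1)"
    by (simp add: q_def)
qed

section \<open>Decoupling transversal pieces in lower dimension\<close>

text \<open>With \<open>P = vexp k\<close> this is \<open>P * (1 / 2 - 1 / P)\<close>, the loss per
  level in passing from a square function to an \<open>\<ell>\<^sup>p\<close> sum over the
  classes.\<close>

definition eexp :: "nat \<Rightarrow> real" where "eexp k = real (vexp k) / 2 - 1"

lemma vexp_ge_2: "k \<ge> 1 \<Longrightarrow> vexp k \<ge> 2"
  unfolding vexp_def by (metis add_le_mono1 mult_le_mono nat_mult_1 one_add_one)

lemma eexp_nonneg: "k \<ge> 1 \<Longrightarrow> eexp k \<ge> 0"
  using vexp_ge_2[of k] by (simp add: eexp_def)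

lemma expsum_subclasses:
  assumes "p > 1" "c \<le> c'" "finite A" "\<And>n. n \<in> A \<Longrightarrow> n mod p ^ c = \<xi>"
  shows "expsum A a \<psi> = (\<Sum>\<xi>'\<in>subclasses p c c' \<xi>. expsum (residue_class A (p ^ c') \<xi>') a \<psi>)"
proof -
  have "(\<Sum>\<xi>'\<in>subclasses p c c' \<xi>. expsum (residue_class A (p ^ c') \<xi>') a \<psi>) =
      (\<Sum>\<xi>'\<in>subclasses p c c' \<xi>. \<Sum>n | n \<in> A \<and> n mod p ^ c' = \<xi>'. a n * \<psi> n)"
    by (simp add: expsum_def residue_class_def)
  also have "\<dots> = expsum A a \<psi>"
    unfolding expsum_def
  proof (rule sum.group)
    have "n mod p ^ c' mod p ^ c = n mod p ^ c" for n
      using assms(2) by (simp add: mod_mod_cancel le_imp_power_dvd)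
    then show "(\<lambda>n. n mod p ^ c') ` A \<subseteq> subclasses p c c' \<xi>"
      using assms by (auto simp: subclasses_def)
  qed (use assms in auto)
  finally show ?thesis by simp
qed

lemma norm_expsum_subclasses:
  assumes "p > 1" "c \<le> c'" "finite A" "\<And>n. n \<in> A \<Longrightarrow> n mod p ^ c = \<xi>" "\<xi> \<in> {0..<p ^ c}" "P \<ge> 1"
  shows "norm (expsum A a \<psi>) ^ P \<le> real_of_int p powr (real (c' - c) * (real P - 1)) *
     (\<Sum>\<xi>'\<in>subclasses p c c' \<xi>. norm (expsum (residue_class A (p ^ c') \<xi>') a \<psi>) ^ P)"
proof -
  have "norm (expsum A a \<psi>) ^ P \<le> (\<Sum>\<xi>'\<in>subclasses p c c' \<xi>. norm (expsum (residue_class A (p ^ c') \<xi>') a \<psi>)) ^ P"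
    by (subst expsum_subclasses[OF assms(1-4)]) (auto intro: power_mono norm_sum)
  also have "\<dots> \<le> real (card (subclasses p c c' \<xi>)) ^ (P - 1) * (\<Sum>\<xi>'\<in>subclasses p c c' \<xi>. norm (expsum (residue_class A (p ^ c') \<xi>') a \<psi>) ^ P)"
    by (rule power_mean) (use assms in auto)
  also have "real (card (subclasses p c c' \<xi>)) ^ (P - 1) = real_of_int p powr (real (c' - c) * (real P - 1))"
  proof -
    have "real (card (subclasses p c c' \<xi>)) = real_of_int p ^ (c' - c)"
      using assms(1,2,5) by (subst card_subclasses) auto
    then have "real (card (subclasses p c c' \<xi>)) ^ (P - 1) = real_of_int p ^ ((c' - c) * (P - 1))"
      by (simp add: power_mult)
    also have "\<dots> = real_of_int p powr (real ((c' - c) * (P - 1)))"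
      using assms(1) by (subst powr_realpow) auto
    also have "real ((c' - c) * (P - 1)) = real (c' - c) * (real P - 1)"
      using assms(6) by (simp add: of_nat_diff)
    finally show ?thesis .
  qed
  finally show ?thesis .
qed

lemma subclasses_trans:
  assumes "p > 1" "c \<le> c'" "c' \<le> c''"
  shows "(\<Sum>\<xi>'\<in>subclasses p c c' \<xi>. \<Sum>\<xi>''\<in>subclasses p c' c'' \<xi>'. g \<xi>'') = (\<Sum>\<xi>''\<in>subclasses p c c'' \<xi>. g \<xi>'')"
proof -
  have m: "n mod p ^ c' mod p ^ c = n mod p ^ c" for n
    using assms(2) by (simp add: mod_mod_cancel le_imp_power_dvd)
  have "(\<Sum>\<xi>'\<in>subclasses p c c' \<xi>. \<Sum>\<xi>''\<in>subclasses p c' c'' \<xi>'. g \<xi>'') =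
    (\<Sum>\<xi>'\<in>subclasses p c c' \<xi>. \<Sum>\<xi>'' | \<xi>'' \<in> subclasses p c c'' \<xi> \<and> \<xi>'' mod p ^ c' = \<xi>'. g \<xi>'')"
  proof (intro sum.cong refl)
    fix \<xi>' assume "\<xi>' \<in> subclasses p c c' \<xi>"
    then have \<xi>: "\<xi> = \<xi>' mod p ^ c" by (simp add: subclasses_def)
    show "subclasses p c' c'' \<xi>' = {\<xi>'' \<in> subclasses p c c'' \<xi>. \<xi>'' mod p ^ c' = \<xi>'}"
      unfolding \<xi> by (auto simp: subclasses_def m)
  qed
  also have "\<dots> = (\<Sum>\<xi>''\<in>subclasses p c c'' \<xi>. g \<xi>'')"
    by (rule sum.group[OF finite_subclasses finite_subclasses]) (use assms in \<open>auto simp: subclasses_def m\<close>)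
  finally show ?thesis .
qed

lemma residue_class_residue_class:
  assumes "c \<le> c'" "\<xi>' \<in> subclasses p c c' \<xi>"
  shows "residue_class (residue_class A (p ^ c) \<xi>) (p ^ c') \<xi>' = residue_class A (p ^ c') \<xi>'"
proof -
  have "n mod p ^ c' mod p ^ c = n mod p ^ c" for n
    using assms(1) by (simp add: mod_mod_cancel le_imp_power_dvd)
  then show ?thesis using assms(2) by (auto simp: residue_class_def subclasses_def)
qed

text \<open>The sum over \<open>A'\<close> is a weight carried along unchanged, to any power
  \<open>e\<close>. The condition on \<open>l * c'\<close> marks the finest scale that polynomials
  vanishing to order \<open>k - l + 1\<close> at the class of \<open>A'\<close> can resolve. The
  excess is \<open>2 * \<kappa>\<close> rather than \<open>\<kappa>\<close> to leave room for the
  constant of each application of the key step.\<close>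

definition partially_decouples :: "int \<Rightarrow> nat \<Rightarrow> nat \<Rightarrow> real \<Rightarrow> real \<Rightarrow> bool" where
  "partially_decouples p k l \<kappa> D \<longleftrightarrow> (\<forall>B b e a A A' \<xi>' c' c \<xi>. b \<le> B \<longrightarrow> finite A \<longrightarrow>
     1 \<le> c \<longrightarrow> c \<le> c' \<longrightarrow> l * c' \<le> (k - l + 1) * b \<longrightarrow> \<xi> \<in> {0..<p ^ c} \<longrightarrow>
     (\<forall>n\<in>A. n mod p ^ c = \<xi>) \<longrightarrow> (\<forall>n\<in>A'. n mod p ^ b = \<xi>') \<longrightarrow> \<not> p dvd \<xi> - \<xi>' \<longrightarrow>
     (\<Sum>\<gamma>\<in>pfreqs p k B. amp p k B A' a \<gamma> ^ e *
        amp p k B A a \<gamma> ^ vexp l)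
     \<le> D * real_of_int p powr (real (c' - c) * (eexp l + 2 * \<kappa>)) *
      (\<Sum>\<xi>\<^sub>1\<in>subclasses p c c' \<xi>. \<Sum>\<gamma>\<in>pfreqs p k B.
        amp p k B A' a \<gamma> ^ e *
        amp p k B (residue_class A (p ^ c') \<xi>\<^sub>1) a \<gamma> ^ vexp l))"

text \<open>One application of the key step passes from the scale \<open>c\<close> only to \<open>c (l + 1) / l\<close>, hence the induction on \<open>c'\<close>.\<close>

lemma partial_decoupling:
  assumes dec: "\<And>B'. decouples p l B' (C * real_of_int p powr (B' * (eexp l + \<kappa>)))"
    and p: "prime p" "int k < p" and l: "1 \<le> l" "l < k" and C: "C \<ge> 1" and \<kappa>: "\<kappa> > 0"
  shows "\<exists>D\<ge>1. partially_decouples p k l \<kappa> D"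
proof -
  have p1: "p > 1" using p(1) prime_gt_1_int by blast
  define rp where "rp = real_of_int p"
  have rp: "rp > 1" using p1 by (simp add: rp_def)
  have el: "eexp l \<ge> 0" using l(1) by (rule eexp_nonneg)
  have v1: "vexp l \<ge> 1" using vexp_ge_2[OF l(1)] by simp
  \<comment> \<open>From \<open>m0\<close> levels on, the constant \<open>C\<close> of one
    application is absorbed by the second \<open>\<kappa>\<close>.\<close>
  obtain m0 :: nat where m0: "log rp C / \<kappa> \<le> real m0" using real_arch_simple by blast
  \<comment> \<open>Chosen so that \<open>c' \<ge> L\<close> forces
    \<open>c' div (l + 1) > m0\<close>; below \<open>L\<close> the trivial inequality is paid for by
    \<open>D\<close>.\<close>
  define L where "L = (l + 1) * (m0 + 1)"
  have CL: "C \<le> rp powr (\<kappa> * m)" if "m \<ge> m0" for m :: nat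
  proof -
    have "log rp C \<le> \<kappa> * m0" using m0 \<kappa> by (simp add: field_simps)
    also have "\<dots> \<le> \<kappa> * m" using that \<kappa> by simp
    finally show ?thesis using C rp by (simp add: log_le_iff)
  qed
  define D where "D = max C (rp powr (L * real (vexp l)))"
  have D1: "D \<ge> 1" using C by (simp add: D_def)
  have main: "(\<Sum>\<gamma>\<in>pfreqs p k B. amp p k B A' a \<gamma> ^ e *
        amp p k B A a \<gamma> ^ vexp l)
     \<le> D * rp powr (real (c' - c) * (eexp l + 2 * \<kappa>)) *
      (\<Sum>\<xi>\<^sub>1\<in>subclasses p c c' \<xi>. \<Sum>\<gamma>\<in>pfreqs p k B.
        amp p k B A' a \<gamma> ^ e *
        amp p k B (residue_class A (p ^ c') \<xi>\<^sub>1) a \<gamma> ^ vexp l)"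
    if bB: "b \<le> B" and fA: "finite A" and A': "\<forall>n\<in>A'. n mod p ^ b = \<xi>'"
      and cprems: "1 \<le> c" "c \<le> c'" "l * c' \<le> (k - l + 1) * b" "\<xi> \<in> {0..<p ^ c}" "\<forall>n\<in>A. n mod p ^ c = \<xi>" "\<not> p dvd \<xi> - \<xi>'"
    for B b e a A A' \<xi>' c' c \<xi>
    using cprems
  proof (induction c' rule: less_induct)
    case (less c')
    define g where "g X = (\<Sum>\<gamma>\<in>pfreqs p k B. amp p k B A' a \<gamma> ^ e *
        amp p k B X a \<gamma> ^ vexp l)" for X
    have g0: "g X \<ge> 0" for X unfolding g_def by (intro sum_nonneg mult_nonneg_nonneg) auto
    have kB: "l * c' \<le> k * B"
    proof -
      have "(k - l + 1) * b \<le> k * B" using l bB by (intro mult_le_mono) auto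
      then show ?thesis using less.prems(3) by linarith
    qed
    have step: "g (residue_class A (p ^ c1) \<xi>1) \<le> (C * rp powr (real (c' - c1) * (eexp l + \<kappa>))) * (\<Sum>\<xi>\<^sub>1\<in>subclasses p c1 c' \<xi>1. g (residue_class A (p ^ c') \<xi>\<^sub>1))"
      if c1: "c \<le> c1" "c1 \<le> c'" "l * c' \<le> (l + 1) * c1" "\<xi>1 \<in> subclasses p c c1 \<xi>" for c1 \<xi>1
    proof -
      have x1: "\<xi>1 \<in> {0..<p ^ c1}" using c1 by (simp add: subclasses_def)
      have "p ^ 1 dvd p ^ c" by (rule le_imp_power_dvd) (use less.prems in simp)
      moreover have "p ^ c dvd \<xi>1 - \<xi>" using c1(4) by (auto simp: subclasses_def)
      ultimately have "p dvd \<xi>1 - \<xi>" by (metis dvd_trans power_one_right)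
      then have nd: "\<not> p dvd \<xi>1 - \<xi>'" using less.prems(6) dvd_diff[of p "\<xi>1 - \<xi>'" "\<xi>1 - \<xi>"] by auto
      \<comment> \<open>\<open>E = l * c'\<close> is the least exponent that reaches scale
        \<open>c'\<close>; the requirement \<open>E \<le> (l + 1) * c1\<close> is the third
        assumption in \<open>c1\<close>.\<close>
      have "g (residue_class A (p ^ c1) \<xi>1) \<le> (C * rp powr (real (c' - c1) * (eexp l + \<kappa>))) *
          (\<Sum>\<xi>\<^sub>1\<in>subclasses p c1 (c1 + (c' - c1)) \<xi>1. g (residue_class (residue_class A (p ^ c1) \<xi>1) (p ^ (c1 + (c' - c1))) \<xi>\<^sub>1))"
        unfolding g_def
        by (rule key_step[where E = "l * c'" and b = b and \<xi>' = \<xi>'])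
          (use dec[of "c' - c1"] p l less.prems c1 kB x1 nd fA A' in \<open>auto simp: rp_def residue_class_def\<close>)
      also have "(\<Sum>\<xi>\<^sub>1\<in>subclasses p c1 (c1 + (c' - c1)) \<xi>1. g (residue_class (residue_class A (p ^ c1) \<xi>1) (p ^ (c1 + (c' - c1))) \<xi>\<^sub>1)) =
         (\<Sum>\<xi>\<^sub>1\<in>subclasses p c1 c' \<xi>1. g (residue_class A (p ^ c') \<xi>\<^sub>1))"
        using c1(2) by (intro sum.cong) (auto simp: residue_class_residue_class)
      finally show ?thesis .
    qed
    have Acl: "residue_class A (p ^ c) \<xi> = A" using less.prems by (auto simp: residue_class_def)
    have \<xi>kid: "\<xi> \<in> subclasses p c c \<xi>" using less.prems by (auto simp: subclasses_def)
    have "g A \<le> D * rp powr (real (c' - c) * (eexp l + 2 * \<kappa>)) * (\<Sum>\<xi>\<^sub>1\<in>subclasses p c c' \<xi>. g (residue_class A (p ^ c') \<xi>\<^sub>1))"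
    proof -
      consider "c' < L" | "l * c' \<le> (l + 1) * c" | "c' \<ge> L" "l * c' > (l + 1) * c" by linarith
      then show ?thesis
      proof cases
        case 1
        have "g A \<le> (\<Sum>\<gamma>\<in>pfreqs p k B. amp p k B A' a \<gamma> ^ e *
           (rp powr (real (c' - c) * (real (vexp l) - 1)) * (\<Sum>\<xi>\<^sub>1\<in>subclasses p c c' \<xi>. amp p k B (residue_class A (p ^ c') \<xi>\<^sub>1) a \<gamma> ^ vexp l)))"
          unfolding g_def rp_def
          by (intro sum_mono mult_left_mono norm_expsum_subclasses) (use p1 less.prems fA v1 in auto)
        also have "\<dots> = rp powr (real (c' - c) * (real (vexp l) - 1)) * (\<Sum>\<xi>\<^sub>1\<in>subclasses p c c' \<xi>. g (residue_class A (p ^ c') \<xi>\<^sub>1))"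
        proof -
          have "(\<Sum>\<xi>\<^sub>1\<in>subclasses p c c' \<xi>. g (residue_class A (p ^ c') \<xi>\<^sub>1)) = (\<Sum>\<gamma>\<in>pfreqs p k B.
            amp p k B A' a \<gamma> ^ e *
            (\<Sum>\<xi>\<^sub>1\<in>subclasses p c c' \<xi>. amp p k B (residue_class A (p ^ c') \<xi>\<^sub>1) a \<gamma> ^ vexp l))"
            unfolding g_def by (subst sum.swap) (simp only: sum_distrib_left)
          then show ?thesis by (simp only: sum_distrib_left mult_ac)
        qed
        also have "\<dots> \<le> D * rp powr (real (c' - c) * (eexp l + 2 * \<kappa>)) * (\<Sum>\<xi>\<^sub>1\<in>subclasses p c c' \<xi>. g (residue_class A (p ^ c') \<xi>\<^sub>1))"
        proof (rule mult_right_mono)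
          have "rp powr (real (c' - c) * (real (vexp l) - 1)) \<le> rp powr (L * real (vexp l))"
            using 1 rp less.prems v1 by (intro powr_mono mult_mono) auto
          also have "\<dots> \<le> D * 1" by (simp add: D_def)
          also have "\<dots> \<le> D * rp powr (real (c' - c) * (eexp l + 2 * \<kappa>))"
            using D1 rp el \<kappa> less.prems by (intro mult_left_mono ge_one_powr_ge_zero mult_nonneg_nonneg) auto
          finally show "rp powr (real (c' - c) * (real (vexp l) - 1)) \<le> D * rp powr (real (c' - c) * (eexp l + 2 * \<kappa>))" .
        qed (intro sum_nonneg g0)
        finally show ?thesis .
      next
        case 2
        have "g A \<le> (C * rp powr (real (c' - c) * (eexp l + \<kappa>))) * (\<Sum>\<xi>\<^sub>1\<in>subclasses p c c' \<xi>. g (residue_class A (p ^ c') \<xi>\<^sub>1))"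
          using step[of c \<xi>] 2 less.prems \<xi>kid Acl by simp
        also have "\<dots> \<le> D * rp powr (real (c' - c) * (eexp l + 2 * \<kappa>)) * (\<Sum>\<xi>\<^sub>1\<in>subclasses p c c' \<xi>. g (residue_class A (p ^ c') \<xi>\<^sub>1))"
          using C rp \<kappa> less.prems
          by (intro mult_right_mono mult_mono powr_mono mult_left_mono sum_nonneg g0) (auto simp: D_def)
        finally show ?thesis .
      next
        case 3
        \<comment> \<open>The last step covers \<open>h\<close> levels, the largest number
          compatible with \<open>l * c' \<le> (l + 1) * c1\<close>; the induction hypothesis covers
          the levels before it.\<close>
        define h where "h = c' div (l + 1)"
        define c1 where "c1 = c' - h"
        have "c' \<ge> (l + 1) * (m0 + 1)" using 3 by (simp add: L_def)
        then have "(l + 1) * (m0 + 1) div (l + 1) \<le> h" unfolding h_def by (rule div_le_mono)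
        moreover have "(l + 1) * (m0 + 1) div (l + 1) = m0 + 1" by (rule nonzero_mult_div_cancel_left) simp
        ultimately have hm: "h \<ge> m0 + 1" by simp
        have hle: "(l + 1) * h \<le> c'" unfolding h_def by (rule times_div_less_eq_dividend)
        have hc: "h \<le> c'" by (simp add: h_def)
        have lc1: "l * c' \<le> (l + 1) * c1"
        proof -
          have "(l + 1) * c1 + (l + 1) * h = (l + 1) * c'"
            unfolding c1_def distrib_left[symmetric] using hc by simp
          then show ?thesis using hle by simp
        qed
        have cc1: "c < c1"
        proof (rule ccontr)
          assume "\<not> c < c1"
          then have "(l + 1) * c1 \<le> (l + 1) * c" by (intro mult_le_mono2) simp
          then show False using lc1 3(2) by linarith
        qed
        have c1c': "c1 < c'" using hm hc by (simp add: c1_def)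
        have "g A \<le> D * rp powr (real (c1 - c) * (eexp l + 2 * \<kappa>)) * (\<Sum>\<xi>\<^sub>1\<in>subclasses p c c1 \<xi>. g (residue_class A (p ^ c1) \<xi>\<^sub>1))"
          unfolding g_def
        proof (rule less.IH)
          show "l * c1 \<le> (k - l + 1) * b" using less.prems(3) c1c' mult_le_mono2[of c1 c' l] by linarith
        qed (use c1c' cc1 less.prems in auto)
        also have "\<dots> \<le> D * rp powr (real (c1 - c) * (eexp l + 2 * \<kappa>)) * (\<Sum>\<xi>\<^sub>1\<in>subclasses p c c1 \<xi>.
            (C * rp powr (real (c' - c1) * (eexp l + \<kappa>))) * (\<Sum>\<xi>\<^sub>2\<in>subclasses p c1 c' \<xi>\<^sub>1. g (residue_class A (p ^ c') \<xi>\<^sub>2)))"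
          by (intro mult_left_mono sum_mono step) (use cc1 c1c' lc1 D1 in auto)
        also have "\<dots> = (D * rp powr (real (c1 - c) * (eexp l + 2 * \<kappa>)) * (C * rp powr (real (c' - c1) * (eexp l + \<kappa>)))) *
            (\<Sum>\<xi>\<^sub>1\<in>subclasses p c c' \<xi>. g (residue_class A (p ^ c') \<xi>\<^sub>1))"
          using subclasses_trans[OF p1, of c c1 c' "\<lambda>x. g (residue_class A (p ^ c') x)" \<xi>] cc1 c1c'
          by (simp add: sum_distrib_left[symmetric] mult_ac)
        also have "\<dots> \<le> (D * rp powr (real (c' - c) * (eexp l + 2 * \<kappa>))) * (\<Sum>\<xi>\<^sub>1\<in>subclasses p c c' \<xi>. g (residue_class A (p ^ c') \<xi>\<^sub>1))"
        proof (rule mult_right_mono)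
          have ch: "c' - c1 = h" using hc by (simp add: c1_def)
          have "C * rp powr (real (c' - c1) * (eexp l + \<kappa>)) \<le> rp powr (\<kappa> * h) * rp powr (real (c' - c1) * (eexp l + \<kappa>))"
            using CL[of h] hm by (intro mult_right_mono) auto
          also have "\<dots> = rp powr (real (c' - c1) * (eexp l + 2 * \<kappa>))"
            unfolding ch by (simp add: powr_add[symmetric] algebra_simps)
          finally have "D * rp powr (real (c1 - c) * (eexp l + 2 * \<kappa>)) * (C * rp powr (real (c' - c1) * (eexp l + \<kappa>))) \<le>
            D * rp powr (real (c1 - c) * (eexp l + 2 * \<kappa>)) * rp powr (real (c' - c1) * (eexp l + 2 * \<kappa>))"
            using D1 by (intro mult_left_mono) auto
          also have "\<dots> = D * rp powr (real (c' - c) * (eexp l + 2 * \<kappa>))"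
            using cc1 c1c' by (simp add: powr_add[symmetric] mult.assoc distrib_right[symmetric] of_nat_diff)
          finally show "D * rp powr (real (c1 - c) * (eexp l + 2 * \<kappa>)) * (C * rp powr (real (c' - c1) * (eexp l + \<kappa>))) \<le>
            D * rp powr (real (c' - c) * (eexp l + 2 * \<kappa>))" .
        qed (intro sum_nonneg g0)
        finally show ?thesis .
      qed
    qed
    then show ?case by (simp add: g_def)
  qed
  show ?thesis unfolding partially_decouples_def
    by (intro exI[of _ D] conjI D1 allI impI) (rule main[unfolded rp_def])
qed

section \<open>Bilinear estimates\<close>

lemma vexp_mono: "l \<le> k \<Longrightarrow> vexp l \<le> vexp k"
  unfolding vexp_def by (intro mult_le_mono) auto

lemma subclasses_0: "subclasses p 0 c 0 = {0..<p ^ c}"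
  by (auto simp: subclasses_def)

text \<open>The majorants \<open>N\<close> are strictly positive because the exponent \<open>t 0 = 0\<close> occurs below and \<open>0 powr 0 = 0\<close>.\<close>

locale bilinear =
  fixes p :: int and k B :: nat and A :: "int set" and a :: "int \<Rightarrow> complex" and N :: "int \<Rightarrow> real"
  assumes prime: "prime p" and k2: "k \<ge> 2" and kp: "int k < p" and finA: "finite A"
    and Npos: "\<And>\<xi>. N \<xi> > 0"
    and Nmaj: "\<And>\<xi>. (\<Sum>\<gamma>\<in>pfreqs p k B. amp p k B (residue_class A (p ^ B) \<xi>) a \<gamma> ^ vexp k) \<le> N \<xi>"
begin

definition rp where "rp = real_of_int p"
definition \<Gamma> where "\<Gamma> = pfreqs p k B"
definition F where "F c \<xi> \<gamma> = amp p k B (residue_class A (p ^ c) \<xi>) a \<gamma>"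
text \<open>The bound that decoupling without excess would give for the moment of
  \<open>F c \<xi>\<close>, starting from \<open>N\<close> at the finest scale. All bilinear
  estimates are measured against it.\<close>

definition S where "S c \<xi> = rp powr (eexp k * real (B - c)) * (\<Sum>\<xi>'\<in>subclasses p c B \<xi>. N \<xi>')"
definition t where "t l = real (vexp l) / real (vexp k)"
definition T where "T l c c' \<xi> \<xi>' = (\<Sum>\<gamma>\<in>\<Gamma>. F c \<xi> \<gamma> ^ vexp l * F c' \<xi>' \<gamma> ^ (vexp k - vexp l))"
text \<open>The powers of \<open>S\<close> interpolate the two linear bounds in the proportion in
  which \<open>F c\<close> and \<open>F c'\<close> enter \<open>T\<close>, so \<open>Y\<close>
  measures only the excess. Being distinct modulo \<open>p\<close> is the transversality
  condition.\<close>

definition bil_bound where "bil_bound l c c' Y \<longleftrightarrow> (\<forall>\<xi>\<in>{0..<p ^ c}. \<forall>\<xi>'\<in>{0..<p ^ c'}. \<not> p dvd \<xi> - \<xi>' \<longrightarrow>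
   T l c c' \<xi> \<xi>' \<le> Y * (S c \<xi> powr t l * S c' \<xi>' powr (1 - t l)))"

lemma p1: "p > 1" using prime prime_gt_1_int by blast
lemma rp1: "rp > 1" using p1 by (simp add: rp_def)
lemma F0 [simp]: "F c \<xi> \<gamma> \<ge> 0" by (simp add: F_def)
lemma vk: "vexp k \<ge> 2" using k2 vexp_ge_2[of k] by simp
lemma finG [simp]: "finite \<Gamma>" by (simp add: \<Gamma>_def)
lemma ek: "eexp k \<ge> 0" using k2 by (intro eexp_nonneg) simp

lemma t0 [simp]: "t l \<ge> 0" by (simp add: t_def)
lemma t1: "l \<le> k \<Longrightarrow> t l \<le> 1" using vexp_mono[of l k] vk by (simp add: t_def)

lemma subclasses_nonempty: "c \<le> c' \<Longrightarrow> \<xi> \<in> {0..<p ^ c} \<Longrightarrow> subclasses p c c' \<xi> \<noteq> {}"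
proof -
  assume *: "c \<le> c'" "\<xi> \<in> {0..<p ^ c}"
  have "p ^ c \<le> p ^ c'" using * p1 by (intro power_increasing) auto
  then have "\<xi> \<in> subclasses p c c' \<xi>" using * by (auto simp: subclasses_def)
  then show ?thesis by blast
qed

lemma S_pos: "c \<le> B \<Longrightarrow> \<xi> \<in> {0..<p ^ c} \<Longrightarrow> S c \<xi> > 0"
  unfolding S_def using rp1 Npos subclasses_nonempty[of c B \<xi>]
  by (intro mult_pos_pos sum_pos) auto

lemma S_sum:
  assumes "c \<le> c'" "c' \<le> B"
  shows "(\<Sum>\<xi>'\<in>subclasses p c c' \<xi>. S c' \<xi>') = rp powr (- (eexp k * real (c' - c))) * S c \<xi>"
proof -
  have "(\<Sum>\<xi>'\<in>subclasses p c c' \<xi>. S c' \<xi>') = rp powr (eexp k * real (B - c')) * (\<Sum>\<xi>''\<in>subclasses p c B \<xi>. N \<xi>'')"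
    unfolding S_def sum_distrib_left[symmetric] subclasses_trans[OF p1 assms] ..
  moreover have "eexp k * real (B - c') = - (eexp k * real (c' - c)) + eexp k * real (B - c)"
    using assms by (simp add: of_nat_diff algebra_simps)
  ultimately show ?thesis by (simp only: S_def powr_add mult.assoc)
qed

lemma S_mono:
  assumes "c \<le> c'" "c' \<le> B" "\<xi>' \<in> subclasses p c c' \<xi>"
  shows "S c' \<xi>' \<le> S c \<xi>"
proof -
  have nn: "S c'' \<xi>'' \<ge> 0" for c'' \<xi>'' unfolding S_def using Npos by (intro mult_nonneg_nonneg sum_nonneg) (auto intro: less_imp_le)
  have "S c' \<xi>' \<le> (\<Sum>\<xi>'\<in>subclasses p c c' \<xi>. S c' \<xi>')"
    using assms(3) by (intro member_le_sum nn) auto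
  also have "\<dots> \<le> 1 * S c \<xi>"
    unfolding S_sum[OF assms(1,2)] using rp1 ek powr_mono[of "- (eexp k * real (c' - c))" 0 rp] by (intro mult_right_mono nn) auto
  finally show ?thesis by simp
qed

lemma class_bound:
  assumes dec: "decouples p k (B - c) K" and c: "c \<le> B" "\<xi> \<in> {0..<p ^ c}" and "K \<ge> 0"
  shows "(\<Sum>\<gamma>\<in>\<Gamma>. F c \<xi> \<gamma> ^ vexp k) \<le> K * (\<Sum>\<xi>'\<in>subclasses p c B \<xi>. N \<xi>')"
proof -
  have "(\<Sum>\<gamma>\<in>\<Gamma>. F c \<xi> \<gamma> ^ vexp k) \<le> K * (\<Sum>\<xi>'\<in>subclasses p c B \<xi>. \<Sum>\<gamma>\<in>\<Gamma>.
      amp p k B (residue_class (residue_class A (p ^ c) \<xi>) (p ^ B) \<xi>') a \<gamma> ^ vexp k)"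
    unfolding \<Gamma>_def F_def by (rule rescaled_decoupling[OF dec p1 c]) (use finA in \<open>auto simp: residue_class_def\<close>)
  also have "\<dots> \<le> K * (\<Sum>\<xi>'\<in>subclasses p c B \<xi>. N \<xi>')"
    using assms(4) c by (intro mult_left_mono sum_mono) (auto simp: residue_class_residue_class \<Gamma>_def intro: Nmaj)
  finally show ?thesis .
qed

lemma class_bound_powr:
  assumes dec: "\<And>B. decouples p k B (C * rp powr (real B * (eexp k + e)))" and c: "c \<le> B" "\<xi> \<in> {0..<p ^ c}" and "C > 0"
  shows "(\<Sum>\<gamma>\<in>\<Gamma>. F c \<xi> \<gamma> ^ vexp k) \<le> C * rp powr (real (B - c) * e) * S c \<xi>"
proof -
  have "(\<Sum>\<gamma>\<in>\<Gamma>. F c \<xi> \<gamma> ^ vexp k) \<le> C * rp powr (real (B - c) * (eexp k + e)) * (\<Sum>\<xi>'\<in>subclasses p c B \<xi>. N \<xi>')"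
    using class_bound[OF dec c] assms(4) by simp
  also have "rp powr (real (B - c) * (eexp k + e)) = rp powr (real (B - c) * e) * rp powr (eexp k * real (B - c))"
    by (simp add: powr_add[symmetric] algebra_simps)
  finally show ?thesis by (simp add: S_def mult_ac)
qed

lemma bil_bound_mono: "bil_bound l c c' Y \<Longrightarrow> Y \<le> Y' \<Longrightarrow> bil_bound l c c' Y'"
  unfolding bil_bound_def by (meson mult_right_mono order_trans mult_nonneg_nonneg powr_ge_zero)

text \<open>At \<open>l = 0\<close> the form is a pure moment of a class at scale \<open>c'\<close>,
  for which only \<open>B - c'\<close> levels remain. This saving feeds every later gain.\<close>

lemma bil_bound_0:
  assumes dec: "\<And>B. decouples p k B (C * rp powr (real B * (eexp k + e)))" and c: "c \<le> B" "c' \<le> B" and "C > 0"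
  shows "bil_bound 0 c c' (C * rp powr (real (B - c') * e))"
  unfolding bil_bound_def
proof (intro ballI impI)
  fix \<xi> \<xi>' assume \<xi>: "\<xi> \<in> {0..<p ^ c}" "\<xi>' \<in> {0..<p ^ c'}"
  have "S c \<xi> powr t 0 = 1" using S_pos[OF c(1) \<xi>(1)] by (simp add: t_def vexp_def)
  moreover have "S c' \<xi>' powr (1 - t 0) = S c' \<xi>'" using S_pos[OF c(2) \<xi>(2)] by (simp add: t_def vexp_def)
  ultimately show "T 0 c c' \<xi> \<xi>' \<le> C * rp powr (real (B - c') * e) * (S c \<xi> powr t 0 * S c' \<xi>' powr (1 - t 0))"
    using class_bound_powr[OF dec c(2) \<xi>(2) assms(4)] by (simp add: T_def vexp_def)
qed

text \<open>\<open>eq\<close> is required only where both factors are positive: elsewhere the left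
  side vanishes, since both exponents are positive for \<open>1 \<le> l < k\<close>. This keeps
  identities between real powers away from \<open>0 powr 0\<close>.\<close>

lemma T_holder:
  assumes l: "1 \<le> l" "l < k"
    and lm: "0 \<le> s" "s \<le> 1"
    and uv: "\<And>\<gamma>. u \<gamma> \<ge> 0" "\<And>\<gamma>. v \<gamma> \<ge> 0"
    and eq: "\<And>\<gamma>. F c \<xi> \<gamma> > 0 \<Longrightarrow> F c' \<xi>' \<gamma> > 0 \<Longrightarrow>
      F c \<xi> \<gamma> ^ vexp l * F c' \<xi>' \<gamma> ^ (vexp k - vexp l) = u \<gamma> powr s * v \<gamma> powr (1 - s)"
  shows "T l c c' \<xi> \<xi>' \<le> (\<Sum>\<gamma>\<in>\<Gamma>. u \<gamma>) powr s * (\<Sum>\<gamma>\<in>\<Gamma>. v \<gamma>) powr (1 - s)"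
proof -
  have vl: "vexp l > 0" using vexp_ge_2[OF l(1)] by simp
  have vlk: "vexp k - vexp l > 0" using l mult_strict_mono[of l k "l + 1" "k + 1"] by (simp add: vexp_def del: mult_Suc_right)
  have "T l c c' \<xi> \<xi>' \<le> (\<Sum>\<gamma>\<in>\<Gamma>. u \<gamma> powr s * v \<gamma> powr (1 - s))"
    unfolding T_def
  proof (rule sum_mono)
    fix \<gamma>
    show "F c \<xi> \<gamma> ^ vexp l * F c' \<xi>' \<gamma> ^ (vexp k - vexp l) \<le> u \<gamma> powr s * v \<gamma> powr (1 - s)"
    proof (cases "F c \<xi> \<gamma> = 0 \<or> F c' \<xi>' \<gamma> = 0")
      case True
      then have "F c \<xi> \<gamma> ^ vexp l * F c' \<xi>' \<gamma> ^ (vexp k - vexp l) = 0" using vl vlk by (auto simp: power_0_left)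
      then show ?thesis by (subst \<open>_ = 0\<close>) simp
    next
      case False
      then show ?thesis using eq[of \<gamma>] F0[of c \<xi> \<gamma>] F0[of c' \<xi>' \<gamma>] by simp
    qed
  qed
  also have "\<dots> \<le> (\<Sum>\<gamma>\<in>\<Gamma>. u \<gamma>) powr s * (\<Sum>\<gamma>\<in>\<Gamma>. v \<gamma>) powr (1 - s)"
    by (rule holder_sum) (use uv lm in auto)
  finally show ?thesis .
qed

lemma T_nonneg: "T l c c' \<xi> \<xi>' \<ge> 0"
  unfolding T_def by (intro sum_nonneg mult_nonneg_nonneg) auto

lemma bil_bound_trivial:
  assumes dec: "\<And>B. decouples p k B (C * rp powr (real B * (eexp k + e)))" and c: "c \<le> B" "c' \<le> B" and "C > 0" "e \<ge> 0"
    and l: "1 \<le> l" "l < k"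
  shows "bil_bound l c c' (C * rp powr (real B * e))"
  unfolding bil_bound_def
proof (intro ballI impI)
  fix \<xi> \<xi>' assume \<xi>: "\<xi> \<in> {0..<p ^ c}" "\<xi>' \<in> {0..<p ^ c'}"
  define M where "M = C * rp powr (real B * e)"
  have M: "M > 0" using assms(4) rp1 by (simp add: M_def)
  have t: "0 \<le> t l" "t l \<le> 1" using t1 l by auto
  have b: "(\<Sum>\<gamma>\<in>\<Gamma>. F c \<xi> \<gamma> ^ vexp k) \<le> M * S c \<xi>" if "c \<le> B" "\<xi> \<in> {0..<p ^ c}" for c \<xi>
  proof -
    have "(\<Sum>\<gamma>\<in>\<Gamma>. F c \<xi> \<gamma> ^ vexp k) \<le> C * rp powr (real (B - c) * e) * S c \<xi>"
      by (rule class_bound_powr[OF dec that assms(4)])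
    also have "\<dots> \<le> M * S c \<xi>" unfolding M_def
      using assms(4,5) rp1 S_pos[OF that] by (intro mult_right_mono mult_left_mono powr_mono mult_right_mono) auto
    finally show ?thesis .
  qed
  have "T l c c' \<xi> \<xi>' \<le> (\<Sum>\<gamma>\<in>\<Gamma>. F c \<xi> \<gamma> ^ vexp k) powr t l * (\<Sum>\<gamma>\<in>\<Gamma>. F c' \<xi>' \<gamma> ^ vexp k) powr (1 - t l)"
  proof (rule T_holder[OF l t])
    fix \<gamma> assume pos: "F c \<xi> \<gamma> > 0" "F c' \<xi>' \<gamma> > 0"
    have e: "real (vexp k) * t l = real (vexp l)" "real (vexp k) * (1 - t l) = real (vexp k - vexp l)"
      using vk vexp_mono[of l k] l by (auto simp: t_def of_nat_diff field_simps)
    show "F c \<xi> \<gamma> ^ vexp l * F c' \<xi>' \<gamma> ^ (vexp k - vexp l) = (F c \<xi> \<gamma> ^ vexp k) powr t l * (F c' \<xi>' \<gamma> ^ vexp k) powr (1 - t l)"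
      using pos by (simp add: powr_realpow[symmetric] powr_powr e)
  qed auto
  also have "\<dots> \<le> (M * S c \<xi>) powr t l * (M * S c' \<xi>') powr (1 - t l)"
    using b[OF c(1) \<xi>(1)] b[OF c(2) \<xi>(2)] t by (intro mult_mono powr_mono2 sum_nonneg) auto
  also have "\<dots> = (M powr t l * M powr (1 - t l)) * (S c \<xi> powr t l * S c' \<xi>' powr (1 - t l))"
    using M S_pos[OF c(1) \<xi>(1)] S_pos[OF c(2) \<xi>(2)] by (simp add: powr_mult)
  also have "M powr t l * M powr (1 - t l) = M" using M by (simp add: powr_add[symmetric])
  finally show "T l c c' \<xi> \<xi>' \<le> C * rp powr (real B * e) * (S c \<xi> powr t l * S c' \<xi>' powr (1 - t l))"
    by (simp add: M_def)
qed

text \<open>Hoelder between the form with interchanged roles and the form of index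
  \<open>l - 1\<close>. The weight is forced by the exponent of \<open>F c\<close>:
  \<open>vexp l\<close> is the mean of \<open>vexp k - vexp (k - l)\<close> and
  \<open>vexp (l - 1)\<close> with weights \<open>1 / (k - l + 1)\<close> and its complement. The
  exponent of \<open>F c'\<close> then fits because the total degree is always
  \<open>vexp k\<close>.\<close>

lemma bil_bound_holder:
  assumes l: "1 \<le> l" "l < k" and c: "c \<le> B" "c' \<le> B" and Y: "Y1 > 0" "Y2 > 0"
    and 1: "bil_bound (k - l) c' c Y1" and 2: "bil_bound (l - 1) c c' Y2"
  shows "bil_bound l c c' (Y1 powr (1 / real (k - l + 1)) * Y2 powr (1 - 1 / real (k - l + 1)))"
  unfolding bil_bound_def
proof (intro ballI impI)
  fix \<xi> \<xi>' assume \<xi>: "\<xi> \<in> {0..<p ^ c}" "\<xi>' \<in> {0..<p ^ c'}" "\<not> p dvd \<xi> - \<xi>'"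
  define s where "s = 1 / real (k - l + 1)"
  have s: "0 \<le> s" "s \<le> 1" by (auto simp: s_def)
  have S: "S c \<xi> > 0" "S c' \<xi>' > 0" using S_pos c \<xi> by auto
  have kl: "real (k - l) = real k - real l" using l by (simp add: of_nat_diff)
  have vr: "real (vexp j) = real j * (real j + 1)" for j by (simp add: vexp_def distrib_left)
  have l1: "real (l - 1) = real l - 1" using l by (simp add: of_nat_diff)
  have ex: "real (vexp l) = (real (vexp k) - real (vexp (k - l))) * s + real (vexp (l - 1)) * (1 - s)"
  proof -
    have "s * (real k - real l + 1) = 1" unfolding s_def using kl by simp
    then have "s * real k = 1 - s + s * real l" by (simp add: algebra_simps)
    moreover have "(real (vexp k) - real (vexp (k - l))) * s + real (vexp (l - 1)) * (1 - s) =
       2 * real l * (s * real k) - s * real l ^ 2 + s * real l + (real l ^ 2 - real l) * (1 - s)"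
      unfolding vr kl l1 by (simp add: algebra_simps power2_eq_square)
    ultimately have "(real (vexp k) - real (vexp (k - l))) * s + real (vexp (l - 1)) * (1 - s) =
       2 * real l * (1 - s + s * real l) - s * real l ^ 2 + s * real l + (real l ^ 2 - real l) * (1 - s)"
      by (simp only:)
    also have "\<dots> = real (vexp l)" unfolding vr by (simp add: algebra_simps power2_eq_square)
    finally show ?thesis ..
  qed
  have ex2: "real (vexp k) - real (vexp l) = real (vexp (k - l)) * s + (real (vexp k) - real (vexp (l - 1))) * (1 - s)"
    using ex by (simp add: algebra_simps)
  have m: "vexp (k - l) \<le> vexp k" "vexp (l - 1) \<le> vexp k" "vexp l \<le> vexp k" using l by (auto intro: vexp_mono)
  have "T l c c' \<xi> \<xi>' \<le> (\<Sum>\<gamma>\<in>\<Gamma>. F c' \<xi>' \<gamma> ^ vexp (k - l) * F c \<xi> \<gamma> ^ (vexp k - vexp (k - l))) powr s *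
      (\<Sum>\<gamma>\<in>\<Gamma>. F c \<xi> \<gamma> ^ vexp (l - 1) * F c' \<xi>' \<gamma> ^ (vexp k - vexp (l - 1))) powr (1 - s)"
  proof (rule T_holder[OF l s])
    fix \<gamma> assume pos: "F c \<xi> \<gamma> > 0" "F c' \<xi>' \<gamma> > 0"
    define x y where "x = F c \<xi> \<gamma>" and "y = F c' \<xi>' \<gamma>"
    have xy: "x > 0" "y > 0" using pos by (auto simp: x_def y_def)
    have "x ^ vexp l * y ^ (vexp k - vexp l) = x powr real (vexp l) * y powr (real (vexp k) - real (vexp l))"
      using xy m by (simp add: powr_realpow[symmetric] of_nat_diff)
    also have "\<dots> = (y powr (real (vexp (k - l)) * s) * x powr ((real (vexp k) - real (vexp (k - l))) * s)) *
        (x powr (real (vexp (l - 1)) * (1 - s)) * y powr ((real (vexp k) - real (vexp (l - 1))) * (1 - s)))"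
      unfolding ex2 by (subst ex) (simp add: powr_add)
    also have "\<dots> = (y ^ vexp (k - l) * x ^ (vexp k - vexp (k - l))) powr s *
        (x ^ vexp (l - 1) * y ^ (vexp k - vexp (l - 1))) powr (1 - s)"
      using xy m by (simp add: powr_realpow[symmetric] of_nat_diff powr_mult powr_powr)
    finally show "F c \<xi> \<gamma> ^ vexp l * F c' \<xi>' \<gamma> ^ (vexp k - vexp l) =
        (F c' \<xi>' \<gamma> ^ vexp (k - l) * F c \<xi> \<gamma> ^ (vexp k - vexp (k - l))) powr s *
        (F c \<xi> \<gamma> ^ vexp (l - 1) * F c' \<xi>' \<gamma> ^ (vexp k - vexp (l - 1))) powr (1 - s)"
      by (simp add: x_def y_def)
  qed auto
  also have "\<dots> = T (k - l) c' c \<xi>' \<xi> powr s * T (l - 1) c c' \<xi> \<xi>' powr (1 - s)"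
    by (simp add: T_def)
  also have "\<dots> \<le> (Y1 * (S c' \<xi>' powr t (k - l) * S c \<xi> powr (1 - t (k - l)))) powr s *
      (Y2 * (S c \<xi> powr t (l - 1) * S c' \<xi>' powr (1 - t (l - 1)))) powr (1 - s)"
  proof (intro mult_mono powr_mono2 s T_nonneg)
    have "\<not> p dvd \<xi>' - \<xi>" using \<xi>(3) by (simp add: dvd_diff_commute)
    then show "T (k - l) c' c \<xi>' \<xi> \<le> Y1 * (S c' \<xi>' powr t (k - l) * S c \<xi> powr (1 - t (k - l)))"
      using 1 \<xi> by (simp add: bil_bound_def)
    show "T (l - 1) c c' \<xi> \<xi>' \<le> Y2 * (S c \<xi> powr t (l - 1) * S c' \<xi>' powr (1 - t (l - 1)))"
      using 2 \<xi> by (simp add: bil_bound_def)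
  qed (use s in auto)
  also have "\<dots> = (Y1 powr s * Y2 powr (1 - s)) * (S c \<xi> powr ((1 - t (k - l)) * s + t (l - 1) * (1 - s)) *
      S c' \<xi>' powr (t (k - l) * s + (1 - t (l - 1)) * (1 - s)))"
    using Y S by (simp add: powr_mult powr_powr powr_add)
  also have "(1 - t (k - l)) * s + t (l - 1) * (1 - s) = t l"
  proof -
    have "real (vexp k) * ((1 - t (k - l)) * s + t (l - 1) * (1 - s)) = real (vexp l)"
      unfolding ex t_def using vk by (simp add: field_simps)
    then show ?thesis using vk by (simp add: t_def field_simps)
  qed
  moreover have "t (k - l) * s + (1 - t (l - 1)) * (1 - s) = 1 - ((1 - t (k - l)) * s + t (l - 1) * (1 - s))"
    by (simp add: algebra_simps)
  ultimately show "T l c c' \<xi> \<xi>' \<le> (Y1 powr (1 / real (k - l + 1)) * Y2 powr (1 - 1 / real (k - l + 1))) * (S c \<xi> powr t l * S c' \<xi>' powr (1 - t l))"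
    by (simp add: s_def)
qed

text \<open>Hoelder over the \<open>p ^ (c' - c)\<close> subclasses. The resulting exponent
  \<open>- eexp k * t l + (1 - t l)\<close> equals \<open>- eexp l\<close>, which is exactly what
  cancels the sharp loss of decoupling in dimension \<open>l\<close>.\<close>

lemma S_powr_sum:
  assumes "c \<le> c'" "c' \<le> B" "\<xi> \<in> {0..<p ^ c}" "l \<le> k"
  shows "(\<Sum>\<xi>'\<in>subclasses p c c' \<xi>. S c' \<xi>' powr t l) \<le> rp powr (- (real (c' - c) * eexp l)) * S c \<xi> powr t l"
proof -
  have Snn: "S c' \<xi>' \<ge> 0" if "\<xi>' \<in> subclasses p c c' \<xi>" for \<xi>'
    using S_pos[of c' \<xi>'] that assms(2) by (auto simp: subclasses_def)
  have "(\<Sum>\<xi>'\<in>subclasses p c c' \<xi>. S c' \<xi>' powr t l * 1 powr (1 - t l)) \<le>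
      (\<Sum>\<xi>'\<in>subclasses p c c' \<xi>. S c' \<xi>') powr t l * (\<Sum>\<xi>'\<in>subclasses p c c' \<xi>. 1) powr (1 - t l)"
    by (rule holder_sum) (use Snn t1 assms in auto)
  also have "(\<Sum>\<xi>'\<in>subclasses p c c' \<xi>. 1 :: real) = rp powr real (c' - c)"
    using card_subclasses[OF p1 assms(3,1)] p1 by (simp add: rp_def powr_realpow)
  also have "(\<Sum>\<xi>'\<in>subclasses p c c' \<xi>. S c' \<xi>') powr t l * (rp powr real (c' - c)) powr (1 - t l) =
     rp powr (- (real (c' - c) * eexp l)) * S c \<xi> powr t l"
  proof -
    have "S c \<xi> > 0" using S_pos[of c \<xi>] assms by simp
    moreover have "- (eexp k * real (c' - c)) * t l + real (c' - c) * (1 - t l) = - (real (c' - c) * eexp l)"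
    proof -
      have "eexp k * t l = real (vexp l) / 2 - t l" using vk by (simp add: eexp_def t_def field_simps)
      then have "- (eexp k * t l) + (1 - t l) = - eexp l" by (simp add: eexp_def)
      then show ?thesis by (metis (no_types, opaque_lifting) distrib_left mult.assoc mult.commute mult_minus_left mult_minus_right)
    qed
    ultimately show ?thesis using rp1
      by (simp add: S_sum[OF assms(1,2)] powr_mult powr_powr powr_add[symmetric] mult_ac)
  qed
  finally show ?thesis by simp
qed

text \<open>The hypothesis \<open>dec\<close> is \<open>partially_decouples\<close> at fixed scales.
  Its sharp loss cancels against \<open>S_powr_sum\<close>, so refining \<open>c\<close> to
  \<open>c1\<close> costs only \<open>2 * \<kappa>\<close> per level.\<close>

lemma bil_bound_key:
  assumes D: "D \<ge> 1" and l: "1 \<le> l" "l < k" and c: "1 \<le> c" "c \<le> c1" "c1 \<le> B" "c' \<le> B" "l * c1 \<le> (k - l + 1) * c'"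
    and dec: "\<And>A A' e \<xi> \<xi>'. finite A \<Longrightarrow> \<xi> \<in> {0..<p ^ c} \<Longrightarrow>
     (\<forall>n\<in>A. n mod p ^ c = \<xi>) \<Longrightarrow> (\<forall>n\<in>A'. n mod p ^ c' = \<xi>') \<Longrightarrow> \<not> p dvd \<xi> - \<xi>' \<Longrightarrow>
     (\<Sum>\<gamma>\<in>pfreqs p k B. amp p k B A' a \<gamma> ^ e *
        amp p k B A a \<gamma> ^ vexp l)
     \<le> D * real_of_int p powr (real (c1 - c) * (eexp l + 2 * \<kappa>)) *
      (\<Sum>\<xi>\<^sub>1\<in>subclasses p c c1 \<xi>. \<Sum>\<gamma>\<in>pfreqs p k B.
        amp p k B A' a \<gamma> ^ e *
        amp p k B (residue_class A (p ^ c1) \<xi>\<^sub>1) a \<gamma> ^ vexp l)"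
    and Y: "bil_bound l c1 c' Y" "Y > 0"
  shows "bil_bound l c c' (D * rp powr (real (c1 - c) * (2 * \<kappa>)) * Y)"
  unfolding bil_bound_def
proof (intro ballI impI)
  fix \<xi> \<xi>' assume \<xi>: "\<xi> \<in> {0..<p ^ c}" "\<xi>' \<in> {0..<p ^ c'}" "\<not> p dvd \<xi> - \<xi>'"
  define E where "E = D * rp powr (real (c1 - c) * (eexp l + 2 * \<kappa>))"
  have E: "E > 0" using D rp1 by (simp add: E_def)
  have "T l c c' \<xi> \<xi>' \<le> E * (\<Sum>\<xi>\<^sub>1\<in>subclasses p c c1 \<xi>. T l c1 c' \<xi>\<^sub>1 \<xi>')"
  proof -
    have "T l c c' \<xi> \<xi>' \<le> E * (\<Sum>\<xi>\<^sub>1\<in>subclasses p c c1 \<xi>. \<Sum>\<gamma>\<in>\<Gamma>.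
        amp p k B (residue_class A (p ^ c') \<xi>') a \<gamma> ^ (vexp k - vexp l) *
        amp p k B (residue_class (residue_class A (p ^ c) \<xi>) (p ^ c1) \<xi>\<^sub>1) a \<gamma> ^ vexp l)"
      unfolding T_def E_def rp_def F_def \<Gamma>_def
      by (subst mult.commute, rule dec[where \<xi>' = \<xi>']) (use finA \<xi> in \<open>auto simp: residue_class_def\<close>)
    also have "\<dots> = E * (\<Sum>\<xi>\<^sub>1\<in>subclasses p c c1 \<xi>. T l c1 c' \<xi>\<^sub>1 \<xi>')"
      unfolding T_def F_def using c by (intro arg_cong[where f = "(*) E"] sum.cong refl) (simp add: residue_class_residue_class mult.commute)
    finally show ?thesis .
  qed
  also have "\<dots> \<le> E * (\<Sum>\<xi>\<^sub>1\<in>subclasses p c c1 \<xi>. Y * (S c1 \<xi>\<^sub>1 powr t l * S c' \<xi>' powr (1 - t l)))"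
  proof (intro mult_left_mono sum_mono)
    fix \<xi>1 assume k1: "\<xi>1 \<in> subclasses p c c1 \<xi>"
    have "p ^ 1 dvd p ^ c" by (rule le_imp_power_dvd) (use c in simp)
    moreover have "p ^ c dvd \<xi>1 - \<xi>" using k1 by (auto simp: subclasses_def)
    ultimately have "p dvd \<xi>1 - \<xi>" by (metis dvd_trans power_one_right)
    then have nd: "\<not> p dvd \<xi>1 - \<xi>'" using \<xi>(3) dvd_diff[of p "\<xi>1 - \<xi>'" "\<xi>1 - \<xi>"] by auto
    show "T l c1 c' \<xi>1 \<xi>' \<le> Y * (S c1 \<xi>1 powr t l * S c' \<xi>' powr (1 - t l))"
      using Y(1) nd k1 \<xi>(2) by (auto simp: bil_bound_def subclasses_def)
  qed (use E in auto)
  also have "\<dots> = E * Y * S c' \<xi>' powr (1 - t l) * (\<Sum>\<xi>\<^sub>1\<in>subclasses p c c1 \<xi>. S c1 \<xi>\<^sub>1 powr t l)"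
    by (simp add: sum_distrib_left mult_ac)
  also have "\<dots> \<le> E * Y * S c' \<xi>' powr (1 - t l) * (rp powr (- (real (c1 - c) * eexp l)) * S c \<xi> powr t l)"
    by (intro mult_left_mono S_powr_sum) (use c l \<xi> E Y in auto)
  also have "\<dots> = D * (rp powr (real (c1 - c) * (eexp l + 2 * \<kappa>)) * rp powr (- (real (c1 - c) * eexp l))) * Y * (S c \<xi> powr t l * S c' \<xi>' powr (1 - t l))"
    by (simp add: E_def mult_ac)
  also have "rp powr (real (c1 - c) * (eexp l + 2 * \<kappa>)) * rp powr (- (real (c1 - c) * eexp l)) = rp powr (real (c1 - c) * (2 * \<kappa>))"
    by (simp add: powr_add[symmetric] algebra_simps)
  finally show "T l c c' \<xi> \<xi>' \<le> D * rp powr (real (c1 - c) * (2 * \<kappa>)) * Y * (S c \<xi> powr t l * S c' \<xi>' powr (1 - t l))" .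
qed

lemma F_subclasses:
  assumes "c \<le> c'" "\<xi> \<in> {0..<p ^ c}" "P \<ge> 1"
  shows "F c \<xi> \<gamma> ^ P \<le> rp powr (real (c' - c) * (real P - 1)) * (\<Sum>\<xi>'\<in>subclasses p c c' \<xi>. F c' \<xi>' \<gamma> ^ P)"
proof -
  have "F c \<xi> \<gamma> ^ P \<le> rp powr (real (c' - c) * (real P - 1)) *
     (\<Sum>\<xi>'\<in>subclasses p c c' \<xi>. amp p k B (residue_class (residue_class A (p ^ c) \<xi>) (p ^ c') \<xi>') a \<gamma> ^ P)"
    unfolding F_def rp_def by (rule norm_expsum_subclasses) (use p1 assms finA in \<open>auto simp: residue_class_def\<close>)
  also have "(\<Sum>\<xi>'\<in>subclasses p c c' \<xi>. amp p k B (residue_class (residue_class A (p ^ c) \<xi>) (p ^ c') \<xi>') a \<gamma> ^ P)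
      = (\<Sum>\<xi>'\<in>subclasses p c c' \<xi>. F c' \<xi>' \<gamma> ^ P)"
    unfolding F_def using assms by (intro sum.cong refl) (simp add: residue_class_residue_class)
  finally show ?thesis .
qed

text \<open>A trivial passage from scale 1 to scale \<open>c\<close>, at a cost of
  \<open>vexp k\<close> per level. It is affordable once a slope exceeds
  \<open>vexp k\<close>.\<close>

lemma bil_bound_split:
  assumes l: "1 \<le> l" "l < k" and c: "1 \<le> c" "c \<le> B" and Y: "bil_bound l c c Y" "Y > 0"
  shows "bil_bound l 1 1 (rp powr (real c * real (vexp k)) * Y)"
  unfolding bil_bound_def
proof (intro ballI impI)
  fix \<xi> \<xi>' assume \<xi>: "\<xi> \<in> {0..<p ^ 1}" "\<xi>' \<in> {0..<p ^ 1}" "\<not> p dvd \<xi> - \<xi>'"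
  define e where "e = vexp k - vexp l"
  have vl: "vexp l \<ge> 1" using vexp_ge_2[OF l(1)] by simp
  have e1: "e \<ge> 1" using l mult_strict_mono[of l k "l + 1" "k + 1"] by (simp add: e_def vexp_def del: mult_Suc_right)
  have ee: "real e = real (vexp k) - real (vexp l)" using vexp_mono[of l k] l by (simp add: e_def of_nat_diff)
  define X where "X = S 1 \<xi> powr t l * S 1 \<xi>' powr (1 - t l)"
  have X0: "X \<ge> 0" by (simp add: X_def)
  define P where "P = rp powr (real (c - 1) * (real (vexp l) - 1)) * rp powr (real (c - 1) * (real e - 1))"
  have P: "P = rp powr (real (c - 1) * (real (vexp k) - 2))"
    unfolding P_def ee by (simp add: powr_add[symmetric] algebra_simps)
  have "T l 1 1 \<xi> \<xi>' \<le> (\<Sum>\<gamma>\<in>\<Gamma>. (rp powr (real (c - 1) * (real (vexp l) - 1)) * (\<Sum>\<xi>\<^sub>1\<in>subclasses p 1 c \<xi>. F c \<xi>\<^sub>1 \<gamma> ^ vexp l)) *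
      (rp powr (real (c - 1) * (real e - 1)) * (\<Sum>\<xi>\<^sub>2\<in>subclasses p 1 c \<xi>'. F c \<xi>\<^sub>2 \<gamma> ^ e)))"
    unfolding T_def e_def[symmetric]
    by (intro sum_mono mult_mono F_subclasses mult_nonneg_nonneg sum_nonneg) (use c \<xi> vl e1 in auto)
  also have "\<dots> = P * (\<Sum>\<gamma>\<in>\<Gamma>. (\<Sum>\<xi>\<^sub>1\<in>subclasses p 1 c \<xi>. F c \<xi>\<^sub>1 \<gamma> ^ vexp l) * (\<Sum>\<xi>\<^sub>2\<in>subclasses p 1 c \<xi>'. F c \<xi>\<^sub>2 \<gamma> ^ e))"
    unfolding sum_distrib_left[of P] by (intro sum.cong refl) (simp only: P_def mult_ac)
  also have "(\<Sum>\<gamma>\<in>\<Gamma>. (\<Sum>\<xi>\<^sub>1\<in>subclasses p 1 c \<xi>. F c \<xi>\<^sub>1 \<gamma> ^ vexp l) * (\<Sum>\<xi>\<^sub>2\<in>subclasses p 1 c \<xi>'. F c \<xi>\<^sub>2 \<gamma> ^ e)) =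
      (\<Sum>\<xi>\<^sub>1\<in>subclasses p 1 c \<xi>. \<Sum>\<xi>\<^sub>2\<in>subclasses p 1 c \<xi>'. T l c c \<xi>\<^sub>1 \<xi>\<^sub>2)"
    unfolding sum_product T_def e_def[symmetric]
    by (subst sum.swap, rule sum.cong[OF refl], rule sum.swap)
  also have "P * \<dots> \<le> P * (\<Sum>\<xi>\<^sub>1\<in>subclasses p 1 c \<xi>. \<Sum>\<xi>\<^sub>2\<in>subclasses p 1 c \<xi>'. Y * X)"
  proof (intro mult_left_mono sum_mono)
    fix \<xi>1 \<xi>2 assume k12: "\<xi>1 \<in> subclasses p 1 c \<xi>" "\<xi>2 \<in> subclasses p 1 c \<xi>'"
    have "p dvd \<xi>1 - \<xi>" "p dvd \<xi>2 - \<xi>'" using k12 by (auto simp: subclasses_def)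
    then have "p dvd (\<xi>1 - \<xi>) - (\<xi>2 - \<xi>')" by (rule dvd_diff)
    then have nd: "\<not> p dvd \<xi>1 - \<xi>2" using \<xi>(3) dvd_diff[of p "\<xi>1 - \<xi>2" "(\<xi>1 - \<xi>) - (\<xi>2 - \<xi>')"] by auto
    have r: "\<xi>1 \<in> {0..<p ^ c}" "\<xi>2 \<in> {0..<p ^ c}" using k12 by (auto simp: subclasses_def)
    have "T l c c \<xi>1 \<xi>2 \<le> Y * (S c \<xi>1 powr t l * S c \<xi>2 powr (1 - t l))"
      using Y(1) nd r unfolding bil_bound_def by blast
    also have "\<dots> \<le> Y * X" unfolding X_def
      using Y(2) S_mono[OF c k12(1)] S_mono[OF c k12(2)] S_pos[OF c(2) r(1)] S_pos[OF c(2) r(2)] t1[of l] l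
      by (intro mult_left_mono mult_mono powr_mono2) auto
    finally show "T l c c \<xi>1 \<xi>2 \<le> Y * X" .
  qed (simp add: P)
  also have "\<dots> = (P * (rp powr (real (c - 1)) * rp powr (real (c - 1)))) * (Y * X)"
  proof -
    have "real (card (subclasses p 1 c \<xi>)) = rp powr (real (c - 1))" if "\<xi> \<in> {0..<p ^ 1}" for \<xi>
      using card_subclasses[OF p1 that c(1)] p1 by (simp add: rp_def powr_realpow)
    then show ?thesis using \<xi> by simp
  qed
  also have "P * (rp powr (real (c - 1)) * rp powr (real (c - 1))) = rp powr (real (c - 1) * real (vexp k))"
    unfolding P by (simp add: powr_add[symmetric] algebra_simps)
  also have "rp powr (real (c - 1) * real (vexp k)) * (Y * X) \<le> rp powr (real c * real (vexp k)) * (Y * X)"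
    using rp1 Y X0 by (intro mult_right_mono powr_mono mult_nonneg_nonneg) auto
  finally show "T l 1 1 \<xi> \<xi>' \<le> rp powr (real c * real (vexp k)) * Y * (S 1 \<xi> powr t l * S 1 \<xi>' powr (1 - t l))"
    by (simp add: X_def mult_ac)
qed

end

text \<open>Either one term dominates the sum, or two different terms are within a factor \<open>n\<close> of the largest.\<close>

lemma broad_narrow:
  fixes z :: "'a \<Rightarrow> complex"
  assumes S: "finite S" and n: "card S \<le> n" "n \<ge> 1" and P: "P \<ge> 1" "x \<le> P"
  shows "norm (\<Sum>i\<in>S. z i) ^ P \<le> 2 ^ P * (\<Sum>i\<in>S. norm (z i) ^ P) +
     real n ^ (2 * P) * (\<Sum>i\<in>S. \<Sum>j\<in>S - {i}. norm (z i) ^ x * norm (z j) ^ (P - x))"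
proof (cases "S = {}")
  case True
  then show ?thesis using P by (simp add: power_0_left)
next
  case False
  define M where "M = Max ((\<lambda>i. norm (z i)) ` S)"
  have "M \<in> (\<lambda>i. norm (z i)) ` S" unfolding M_def using S False by (intro Max_in) auto
  then obtain i where i: "i \<in> S" "norm (z i) = M" by auto
  have M: "norm (z j) \<le> M" if "j \<in> S" for j
    unfolding M_def using S that by (intro Max_ge) auto
  have M0: "M \<ge> 0" using i by (metis norm_ge_zero)
  have nn: "(\<Sum>i\<in>S. \<Sum>j\<in>S - {i}. norm (z i) ^ x * norm (z j) ^ (P - x)) \<ge> 0"
    by (intro sum_nonneg mult_nonneg_nonneg) auto
  have nn2: "(\<Sum>i\<in>S. norm (z i) ^ P) \<ge> 0" by (intro sum_nonneg) auto
  show ?thesis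
  \<comment> \<open>With threshold \<open>M / n\<close> the small terms together contribute at most
    \<open>M\<close>, whence the factor 2. Otherwise two terms are at least \<open>M / n\<close>,
    and \<open>n ^ (2 * P)\<close> pays both for the number of terms and for the ratio
    \<open>n\<close>.\<close>
  proof (cases "\<forall>j\<in>S - {i}. norm (z j) \<le> M / n")
    case True
    have "norm (\<Sum>i\<in>S. z i) \<le> norm (z i) + (\<Sum>j\<in>S - {i}. norm (z j))"
      by (metis S i(1) norm_sum order_refl sum.remove)
    also have "(\<Sum>j\<in>S - {i}. norm (z j)) \<le> real (card (S - {i})) * (M / n)"
      using True by (intro sum_bounded_above) auto
    also have "\<dots> \<le> real n * (M / n)"
      using n M0 S i(1) by (intro mult_right_mono) auto
    also have "\<dots> = M" using n by simp
    finally have "norm (\<Sum>i\<in>S. z i) \<le> 2 * norm (z i)" using i by simp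
    then have "norm (\<Sum>i\<in>S. z i) ^ P \<le> (2 * norm (z i)) ^ P" by (intro power_mono) auto
    also have "\<dots> = 2 ^ P * norm (z i) ^ P" by (simp add: power_mult_distrib)
    also have "\<dots> \<le> 2 ^ P * (\<Sum>i\<in>S. norm (z i) ^ P)"
      using S i(1) by (intro mult_left_mono member_le_sum[where f = "\<lambda>i. norm (z i) ^ P"]) auto
    finally show ?thesis using nn by (simp add: add_increasing2)
  next
    case False
    then obtain j where j: "j \<in> S - {i}" "norm (z j) > M / n" by force
    have "norm (\<Sum>i\<in>S. z i) \<le> (\<Sum>i\<in>S. norm (z i))" by (rule norm_sum)
    also have "\<dots> \<le> real (card S) * M" using M by (intro sum_bounded_above) auto
    also have "\<dots> \<le> n * M" using n M0 by (intro mult_right_mono) auto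
    finally have "norm (\<Sum>i\<in>S. z i) ^ P \<le> (n * M) ^ P" by (intro power_mono) auto
    also have "\<dots> = real n ^ (2 * P) * (M / n) ^ P"
      using n by (simp add: power_mult_distrib power_divide mult_2 power_add)
    finally have 1: "norm (\<Sum>i\<in>S. z i) ^ P \<le> real n ^ (2 * P) * (M / n) ^ P" .
    have "(M / n) ^ P = (M / n) ^ x * (M / n) ^ (P - x)"
      using P by (simp add: power_add[symmetric])
    also have "\<dots> \<le> norm (z i) ^ x * norm (z j) ^ (P - x)"
    proof (intro mult_mono power_mono)
      have "M / n \<le> M / 1" using M0 n by (intro divide_left_mono) auto
      then show "M / n \<le> norm (z i)" using i by simp
    qed (use j M0 n in auto)
    also have "\<dots> \<le> (\<Sum>j\<in>S - {i}. norm (z i) ^ x * norm (z j) ^ (P - x))"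
      using S j by (intro member_le_sum[where f = "\<lambda>j. norm (z i) ^ x * norm (z j) ^ (P - x)"]) auto
    also have "\<dots> \<le> (\<Sum>i\<in>S. \<Sum>j\<in>S - {i}. norm (z i) ^ x * norm (z j) ^ (P - x))"
      using S i by (intro member_le_sum[where f = "\<lambda>i. \<Sum>j\<in>S - {i}. norm (z i) ^ x * norm (z j) ^ (P - x)"] sum_nonneg) auto
    finally have "real n ^ (2 * P) * (M / n) ^ P \<le> real n ^ (2 * P) * (\<Sum>i\<in>S. \<Sum>j\<in>S - {i}. norm (z i) ^ x * norm (z j) ^ (P - x))"
      by (intro mult_left_mono) auto
    moreover have "0 \<le> 2 ^ P * (\<Sum>i\<in>S. norm (z i) ^ P)" using nn2 by simp
    ultimately show ?thesis using 1 by linarith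
  qed
qed

context bilinear
begin

text \<open>Distinct classes modulo \<open>p\<close> are transversal, so the broad part consists of
  at most \<open>rp ^ 2\<close> bilinear forms at scale 1. The narrow part is decoupled from level 1
  on, whence \<open>K\<close> belongs to \<open>B - 1\<close>.\<close>

lemma broad_narrow_step:
  assumes l: "1 \<le> l" "l < k" and B: "B \<ge> 1" and Y: "bil_bound l 1 1 Y" "Y > 0"
    and dec: "decouples p k (B - 1) K" "K \<ge> 0"
  shows "(\<Sum>\<gamma>\<in>\<Gamma>. amp p k B A a \<gamma> ^ vexp k) \<le>
    (2 ^ vexp k * K + rp ^ (2 * vexp k + 2) * Y * rp powr (real B * eexp k)) * (\<Sum>\<xi>\<in>{0..<p ^ B}. N \<xi>)"
proof -
  define Ns where "Ns = (\<Sum>\<xi>\<in>{0..<p ^ B}. N \<xi>)"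
  have Ns0: "Ns \<ge> 0" unfolding Ns_def using Npos by (intro sum_nonneg less_imp_le)
  have cp: "card {0..<p ^ 1} = nat p" by simp
  have np: "real (nat p) = rp" using p1 by (simp add: rp_def)
  define I where "I = {0..<p ^ 1}"
  have fI: "finite I" by (simp add: I_def)
  have "(\<Sum>\<gamma>\<in>\<Gamma>. amp p k B A a \<gamma> ^ vexp k) \<le>
    (\<Sum>\<gamma>\<in>\<Gamma>. 2 ^ vexp k * (\<Sum>\<xi>\<in>I. F 1 \<xi> \<gamma> ^ vexp k) +
       rp ^ (2 * vexp k) * (\<Sum>\<xi>\<in>I. \<Sum>\<xi>'\<in>I - {\<xi>}. F 1 \<xi> \<gamma> ^ vexp l * F 1 \<xi>' \<gamma> ^ (vexp k - vexp l)))"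
  proof (rule sum_mono)
    fix \<gamma>
    have "expsum A a (poly_char k (p ^ (k * B)) \<gamma>) = (\<Sum>\<xi>\<in>I. expsum (residue_class A (p ^ 1) \<xi>) a (poly_char k (p ^ (k * B)) \<gamma>))"
      unfolding I_def using p1 by (intro expsum_classes finA) auto
    then show "amp p k B A a \<gamma> ^ vexp k \<le> 2 ^ vexp k * (\<Sum>\<xi>\<in>I. F 1 \<xi> \<gamma> ^ vexp k) +
       rp ^ (2 * vexp k) * (\<Sum>\<xi>\<in>I. \<Sum>\<xi>'\<in>I - {\<xi>}. F 1 \<xi> \<gamma> ^ vexp l * F 1 \<xi>' \<gamma> ^ (vexp k - vexp l))"
      using broad_narrow[OF fI, of "nat p" "vexp k" "vexp l" "\<lambda>\<xi>. expsum (residue_class A (p ^ 1) \<xi>) a (poly_char k (p ^ (k * B)) \<gamma>)"]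
        p1 vk vexp_mono[of l k] l unfolding np F_def by (simp add: I_def)
  qed
  also have "\<dots> = 2 ^ vexp k * (\<Sum>\<xi>\<in>I. \<Sum>\<gamma>\<in>\<Gamma>. F 1 \<xi> \<gamma> ^ vexp k) + rp ^ (2 * vexp k) * (\<Sum>\<xi>\<in>I. \<Sum>\<xi>'\<in>I - {\<xi>}. T l 1 1 \<xi> \<xi>')"
  proof -
    have "(\<Sum>\<gamma>\<in>\<Gamma>. \<Sum>\<xi>\<in>I. F 1 \<xi> \<gamma> ^ vexp k) = (\<Sum>\<xi>\<in>I. \<Sum>\<gamma>\<in>\<Gamma>. F 1 \<xi> \<gamma> ^ vexp k)" by (rule sum.swap)
    moreover have "(\<Sum>\<gamma>\<in>\<Gamma>. \<Sum>\<xi>\<in>I. \<Sum>\<xi>'\<in>I - {\<xi>}. F 1 \<xi> \<gamma> ^ vexp l * F 1 \<xi>' \<gamma> ^ (vexp k - vexp l)) =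
        (\<Sum>\<xi>\<in>I. \<Sum>\<xi>'\<in>I - {\<xi>}. T l 1 1 \<xi> \<xi>')"
      unfolding T_def by (subst sum.swap, rule sum.cong[OF refl], rule sum.swap)
    ultimately show ?thesis by (simp only: sum.distrib sum_distrib_left[symmetric])
  qed
  also have "(\<Sum>\<xi>\<in>I. \<Sum>\<gamma>\<in>\<Gamma>. F 1 \<xi> \<gamma> ^ vexp k) \<le> K * Ns"
  proof -
    have "(\<Sum>\<xi>\<in>I. \<Sum>\<gamma>\<in>\<Gamma>. F 1 \<xi> \<gamma> ^ vexp k) \<le> (\<Sum>\<xi>\<in>I. K * (\<Sum>\<xi>'\<in>subclasses p 1 B \<xi>. N \<xi>'))"
      by (intro sum_mono class_bound dec B) (auto simp: I_def)
    also have "\<dots> = K * (\<Sum>\<xi>\<in>subclasses p 0 1 0. \<Sum>\<xi>'\<in>subclasses p 1 B \<xi>. N \<xi>')"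
      by (simp add: sum_distrib_left subclasses_0 I_def)
    also have "\<dots> = K * Ns"
      using B by (subst subclasses_trans[OF p1]) (auto simp: subclasses_0 Ns_def)
    finally show ?thesis .
  qed
  also have "(\<Sum>\<xi>\<in>I. \<Sum>\<xi>'\<in>I - {\<xi>}. T l 1 1 \<xi> \<xi>') \<le> rp ^ 2 * (Y * S 0 0)"
  proof -
    have S00: "S 0 0 > 0" by (rule S_pos) auto
    have "(\<Sum>\<xi>\<in>I. \<Sum>\<xi>'\<in>I - {\<xi>}. T l 1 1 \<xi> \<xi>') \<le> (\<Sum>\<xi>\<in>I. \<Sum>\<xi>'\<in>I - {\<xi>}. Y * S 0 0)"
    proof (intro sum_mono)
      fix \<xi> \<xi>' assume x: "\<xi> \<in> I" "\<xi>' \<in> I - {\<xi>}"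
      have nd: "\<not> p dvd \<xi> - \<xi>'" using x by (auto simp: I_def mod_eq_dvd_iff[symmetric])
      have sm: "S 1 \<xi> \<le> S 0 0" "S 1 \<xi>' \<le> S 0 0" using x B by (auto intro!: S_mono simp: subclasses_0 I_def)
      have sp: "S 1 \<xi> > 0" "S 1 \<xi>' > 0" using x B by (auto intro!: S_pos simp: I_def)
      have "T l 1 1 \<xi> \<xi>' \<le> Y * (S 1 \<xi> powr t l * S 1 \<xi>' powr (1 - t l))"
        using Y(1) nd x unfolding bil_bound_def I_def by blast
      also have "\<dots> \<le> Y * (S 0 0 powr t l * S 0 0 powr (1 - t l))"
        using sm sp Y(2) t1[of l] l by (intro mult_left_mono mult_mono powr_mono2) auto
      also have "\<dots> = Y * S 0 0" using S00 by (simp add: powr_add[symmetric])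
      finally show "T l 1 1 \<xi> \<xi>' \<le> Y * S 0 0" .
    qed
    also have "\<dots> \<le> (\<Sum>\<xi>\<in>I. \<Sum>\<xi>'\<in>I. Y * S 0 0)"
      using S00 Y(2) fI by (intro sum_mono sum_mono2) auto
    also have "\<dots> = rp ^ 2 * (Y * S 0 0)" using np by (simp add: I_def power2_eq_square)
    finally show ?thesis .
  qed
  also have "S 0 0 = rp powr (real B * eexp k) * Ns" by (simp add: S_def subclasses_0 Ns_def mult.commute)
  finally have "(\<Sum>\<gamma>\<in>\<Gamma>. amp p k B A a \<gamma> ^ vexp k) \<le>
     2 ^ vexp k * (K * Ns) + rp ^ (2 * vexp k) * (rp\<^sup>2 * (Y * (rp powr (real B * eexp k) * Ns)))"
    using rp1 by simp
  then show ?thesis by (simp add: Ns_def algebra_simps power_add power2_eq_square)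
qed

end

section \<open>The decoupling theorem\<close>

definition decouples_upto :: "int \<Rightarrow> nat \<Rightarrow> real \<Rightarrow> bool" where
  "decouples_upto p k e \<longleftrightarrow> (\<exists>C\<ge>1. \<forall>B. decouples p k B (C * real_of_int p powr (real B * (eexp k + e))))"

text \<open>\<open>e\<close> is an admissible exponent loss for linear decoupling, \<open>x\<close> the gain of the bilinear form per unit of the scale \<open>c'\<close>.\<close>

definition slope :: "int \<Rightarrow> nat \<Rightarrow> real \<Rightarrow> nat \<Rightarrow> nat \<Rightarrow> real \<Rightarrow> bool" where
  "slope p k e n l x \<longleftrightarrow> (\<exists>C>0. \<forall>B A a N c c'. bilinear p k B A a N \<longrightarrow> 1 \<le> c \<longrightarrow> 1 \<le> c' \<longrightarrow>
     (k + 1) ^ n * max c c' \<le> B \<longrightarrow>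
     bilinear.bil_bound p k B A a N l c c' (C * real_of_int p powr (e * real B - x * real c')))"

lemma decouples_mono:
  assumes "decouples p k B K" "K \<le> K'"
  shows "decouples p k B K'"
  unfolding decouples_def
proof (intro allI impI)
  fix A :: "int set" and a :: "int \<Rightarrow> complex" assume "finite A"
  then have "(\<Sum>c\<in>pfreqs p k B. amp p k B A a c ^ vexp k)
     \<le> K * (\<Sum>\<xi>\<in>{0..<p ^ B}. \<Sum>c\<in>pfreqs p k B.
            amp p k B (residue_class A (p ^ B) \<xi>) a c ^ vexp k)"
    using assms(1) unfolding decouples_def by blast
  also have "\<dots> \<le> K' * (\<Sum>\<xi>\<in>{0..<p ^ B}. \<Sum>c\<in>pfreqs p k B.
            amp p k B (residue_class A (p ^ B) \<xi>) a c ^ vexp k)"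
    by (intro mult_right_mono assms sum_nonneg) auto
  finally show "(\<Sum>c\<in>pfreqs p k B. amp p k B A a c ^ vexp k)
     \<le> K' * (\<Sum>\<xi>\<in>{0..<p ^ B}. \<Sum>c\<in>pfreqs p k B.
            amp p k B (residue_class A (p ^ B) \<xi>) a c ^ vexp k)" .
qed

lemma decouples_upto_mono:
  assumes "decouples_upto p k e" "e \<le> e'" "p > 1"
  shows "decouples_upto p k e'"
proof -
  obtain C where C: "C \<ge> 1" "\<And>B. decouples p k B (C * real_of_int p powr (real B * (eexp k + e)))"
    using assms(1) unfolding decouples_upto_def by blast
  have "decouples p k B (C * real_of_int p powr (real B * (eexp k + e')))" for B
    by (rule decouples_mono[OF C(2)]) (use C assms in \<open>auto intro!: mult_left_mono powr_mono\<close>)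
  then show ?thesis using C(1) unfolding decouples_upto_def by blast
qed

lemma decouples_upto_trivial:
  assumes "p > 1" "k \<ge> 1"
  shows "decouples_upto p k (real (vexp k))"
proof -
  have "decouples p k B (1 * real_of_int p powr (real B * (eexp k + real (vexp k))))" for B
    unfolding decouples_def
  proof (intro allI impI)
    fix A :: "int set" and a :: "int \<Rightarrow> complex" assume A: "finite A"
    define w where "w \<xi> c = amp p k B (residue_class A (p ^ B) \<xi>) a c ^ vexp k" for \<xi> c
    have v: "vexp k \<ge> 1" using vexp_ge_2[OF assms(2)] by simp
    have "(\<Sum>c\<in>pfreqs p k B. amp p k B A a c ^ vexp k) \<le>
      (\<Sum>c\<in>pfreqs p k B. real_of_int p powr (real (B - 0) * (real (vexp k) - 1)) * (\<Sum>\<xi>\<in>subclasses p 0 B 0. w \<xi> c))"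
      unfolding w_def by (intro sum_mono norm_expsum_subclasses) (use assms A v in auto)
    also have "\<dots> = real_of_int p powr (real B * (real (vexp k) - 1)) * (\<Sum>\<xi>\<in>{0..<p ^ B}. \<Sum>c\<in>pfreqs p k B. w \<xi> c)"
      by (simp only: sum_distrib_left[symmetric] subclasses_0 sum.swap[of _ "freqs _ _"] diff_zero)
    also have "\<dots> \<le> 1 * real_of_int p powr (real B * (eexp k + real (vexp k))) * (\<Sum>\<xi>\<in>{0..<p ^ B}. \<Sum>c\<in>pfreqs p k B. w \<xi> c)"
    proof (rule mult_right_mono)
      show "real_of_int p powr (real B * (real (vexp k) - 1)) \<le> 1 * real_of_int p powr (real B * (eexp k + real (vexp k)))"
        using assms by (auto intro!: powr_mono mult_left_mono simp: eexp_def)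
    qed (auto simp: w_def intro!: sum_nonneg)
    finally show "(\<Sum>c\<in>pfreqs p k B. amp p k B A a c ^ vexp k) \<le>
       1 * real_of_int p powr (real B * (eexp k + real (vexp k))) * (\<Sum>\<xi>\<in>{0..<p ^ B}. \<Sum>c\<in>pfreqs p k B.
            amp p k B (residue_class A (p ^ B) \<xi>) a c ^ vexp k)"
      by (simp add: w_def)
  qed
  then show ?thesis unfolding decouples_upto_def by (intro exI[of _ 1]) simp
qed

lemma max_le_scale: "(k + 1) ^ n * max c c' \<le> B \<Longrightarrow> c \<le> B \<and> c' \<le> B" for k n c c' B :: nat
proof -
  assume *: "(k + 1) ^ n * max c c' \<le> B"
  have "1 * max c c' \<le> (k + 1) ^ n * max c c'" by (intro mult_le_mono) auto
  then show ?thesis using * by auto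
qed

lemma slope_0:
  assumes "decouples_upto p k e"
  shows "slope p k e n 0 e"
proof -
  obtain C where C: "C \<ge> 1" "\<And>B. decouples p k B (C * real_of_int p powr (real B * (eexp k + e)))"
    using assms(1) unfolding decouples_upto_def by blast
  show ?thesis unfolding slope_def
  proof (intro exI[of _ C] conjI allI impI)
    fix B A a N c c' assume b: "bilinear p k B A a N" and c: "(k + 1) ^ n * max c c' \<le> B"
    interpret bilinear p k B A a N by (rule b)
    have cB: "c \<le> B" "c' \<le> B" using max_le_scale[OF c] by auto
    have "bil_bound 0 c c' (C * rp powr (real (B - c') * e))"
      by (rule bil_bound_0) (use C cB in \<open>auto simp: rp_def\<close>)
    moreover have "real (B - c') * e = e * real B - e * real c'" using cB by (simp add: of_nat_diff algebra_simps)
    ultimately show "bil_bound 0 c c' (C * real_of_int p powr (e * real B - e * real c'))" by (simp add: rp_def)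
  qed (use C in auto)
qed

lemma slope_trivial:
  assumes "decouples_upto p k e" "e \<ge> 0" "1 \<le> l" "l < k"
  shows "slope p k e n l 0"
proof -
  obtain C where C: "C \<ge> 1" "\<And>B. decouples p k B (C * real_of_int p powr (real B * (eexp k + e)))"
    using assms(1) unfolding decouples_upto_def by blast
  show ?thesis unfolding slope_def
  proof (intro exI[of _ C] conjI allI impI)
    fix B A a N c c' assume b: "bilinear p k B A a N" and c: "(k + 1) ^ n * max c c' \<le> B"
    interpret bilinear p k B A a N by (rule b)
    have cB: "c \<le> B" "c' \<le> B" using max_le_scale[OF c] by auto
    have "bil_bound l c c' (C * rp powr (real B * e))"
      by (rule bil_bound_trivial) (use C cB assms in \<open>auto simp: rp_def\<close>)
    then show "bil_bound l c c' (C * real_of_int p powr (e * real B - 0 * real c'))" by (simp add: rp_def mult.commute)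
  qed (use C in auto)
qed

text \<open>Partial decoupling refines \<open>c\<close> to \<open>m\<close>, about
  \<open>(k - l + 1) * c' / l\<close>. After the interchange of roles \<open>m\<close> is the second
  scale of the form of index \<open>k - l\<close>, so that slope counts
  \<open>(k - l + 1) / l\<close> times, with Hoelder weight \<open>1 / (k - l + 1)\<close>: this
  gives \<open>x1 / l\<close>. Scales grow by a factor at most \<open>k + 1\<close>, hence
  \<open>Suc n\<close>.\<close>

lemma slope_step:
  assumes p: "prime p" "int k < p" and l: "1 \<le> l" "l < k"
    and low: "\<And>\<kappa>. \<kappa> > 0 \<Longrightarrow> decouples_upto p l \<kappa>"
    and s1: "slope p k e n (k - l) x1" and s2: "slope p k e n (l - 1) x2" and x1: "x1 \<ge> 0" and \<kappa>: "\<kappa> > 0"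
  shows "slope p k e (Suc n) l (x1 / l + (1 - 1 / real (k - l + 1)) * x2 - \<kappa>)"
proof -
  \<comment> \<open>At most \<open>k * c'\<close> levels are refined, each at a cost of
    \<open>2 * \<kappa>1\<close>.\<close>
  define \<kappa>1 where "\<kappa>1 = \<kappa> / (2 * real k)"
  have k0: "real k > 0" using l by simp
  have \<kappa>1: "\<kappa>1 > 0" using \<kappa> k0 by (simp add: \<kappa>1_def)
  have p1: "p > 1" using p(1) prime_gt_1_int by blast
  define r where "r = real_of_int p"
  have r: "r > 1" using p1 by (simp add: r_def)
  define s where "s = 1 / real (k - l + 1)"
  have s: "s > 0" "s \<le> 1" by (auto simp: s_def)
  obtain C where C: "C \<ge> 1" "\<And>B. decouples p l B (C * real_of_int p powr (real B * (eexp l + \<kappa>1)))"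
    using low[OF \<kappa>1] unfolding decouples_upto_def by blast
  obtain D where D: "D \<ge> 1" and Dd: "partially_decouples p k l \<kappa>1 D"
    using partial_decoupling[OF C(2) p l C(1) \<kappa>1] by blast
  obtain C1 where C1: "C1 > 0" "\<And>B A a N c c'. bilinear p k B A a N \<Longrightarrow> 1 \<le> c \<Longrightarrow> 1 \<le> c' \<Longrightarrow>
     (k + 1) ^ n * max c c' \<le> B \<Longrightarrow>
     bilinear.bil_bound p k B A a N (k - l) c c' (C1 * real_of_int p powr (e * real B - x1 * real c'))"
    using s1 unfolding slope_def by blast
  obtain C2 where C2: "C2 > 0" "\<And>B A a N c c'. bilinear p k B A a N \<Longrightarrow> 1 \<le> c \<Longrightarrow> 1 \<le> c' \<Longrightarrow>
     (k + 1) ^ n * max c c' \<le> B \<Longrightarrow>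
     bilinear.bil_bound p k B A a N (l - 1) c c' (C2 * real_of_int p powr (e * real B - x2 * real c'))"
    using s2 unfolding slope_def by blast
  \<comment> \<open>The factor \<open>r powr (s * x1)\<close> pays for rounding down in
    \<open>a'\<close>.\<close>
  define C3 where "C3 = D * (C1 powr s * C2 powr (1 - s)) * r powr (s * x1)"
  have C3: "C3 > 0" using D C1 C2 r by (simp add: C3_def)
  show ?thesis unfolding slope_def
  proof (intro exI[of _ C3] conjI C3 allI impI)
    fix B A a N c c' assume b: "bilinear p k B A a N" and c1: "1 \<le> c" "1 \<le> c'" and cB: "(k + 1) ^ Suc n * max c c' \<le> B"
    interpret bilinear p k B A a N by (rule b)
    have rpr: "rp = r" by (simp add: rp_def r_def)
    define a' where "a' = (k - l + 1) * c' div l"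
    \<comment> \<open>If \<open>c\<close> is already at least \<open>a'\<close>, nothing is refined,
      and the larger \<open>m\<close> only helps because \<open>x1 \<ge> 0\<close>.\<close>
    define m where "m = max c a'"
    have mc: "m \<ge> 1" "c \<le> m" using c1 by (auto simp: m_def)
    have a'le: "a' \<le> k * c'"
    proof -
      have "a' \<le> (k - l + 1) * c'" unfolding a'_def by (rule div_le_dividend)
      also have "\<dots> \<le> k * c'" using l by (intro mult_le_mono) auto
      finally show ?thesis .
    qed
    have "max m c' \<le> (k + 1) * max c c'"
    proof -
      have "k * c' \<le> (k + 1) * max c c'" by (intro mult_le_mono) auto
      moreover have "1 * max c c' \<le> (k + 1) * max c c'" by (intro mult_le_mono) auto
      ultimately show ?thesis using a'le unfolding m_def by linarith
    qed
    then have "(k + 1) ^ n * max m c' \<le> (k + 1) ^ n * ((k + 1) * max c c')" by (rule mult_le_mono2)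
    moreover have "(k + 1) ^ n * ((k + 1) * max c c') = (k + 1) ^ Suc n * max c c'"
      by (simp only: power_Suc2 mult.assoc)
    ultimately have mB: "(k + 1) ^ n * max m c' \<le> B" using cB by linarith
    have mB': "m \<le> B" "c' \<le> B" using max_le_scale[OF mB] by auto
    define Y1 where "Y1 = C1 * r powr (e * real B - x1 * real m)"
    define Y2 where "Y2 = C2 * r powr (e * real B - x2 * real c')"
    have Y: "Y1 > 0" "Y2 > 0" using C1 C2 r by (auto simp: Y1_def Y2_def)
    have B1: "bil_bound (k - l) c' m Y1" unfolding Y1_def r_def by (rule C1(2)[OF b]) (use c1 mc mB in \<open>auto simp: max.commute\<close>)
    have B2: "bil_bound (l - 1) m c' Y2" unfolding Y2_def r_def by (rule C2(2)[OF b]) (use c1 mc mB in auto)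
    define Y where "Y = Y1 powr s * Y2 powr (1 - s)"
    have Ypos: "Y > 0" using \<open>Y1 > 0\<close> \<open>Y2 > 0\<close> by (simp add: Y_def)
    have B3: "bil_bound l m c' Y" unfolding Y_def s_def using bil_bound_holder[OF l mB' Y B1 B2] .
    have B4: "bil_bound l c c' (D * r powr (\<kappa> * real c') * Y)"
    proof (cases "c \<ge> a'")
      case True
      then have "m = c" by (simp add: m_def)
      have "Y \<le> D * r powr (\<kappa> * real c') * Y"
      proof -
        have "1 * 1 \<le> D * r powr (\<kappa> * real c')" using D r \<kappa> by (intro mult_mono ge_one_powr_ge_zero) auto
        then have "1 * Y \<le> D * r powr (\<kappa> * real c') * Y" using Ypos by (intro mult_right_mono) auto
        then show ?thesis by simp
      qed
      then show ?thesis using B3 \<open>m = c\<close> bil_bound_mono by blast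
    next
      case False
      then have ma: "m = a'" by (simp add: m_def)
      have lm: "l * m \<le> (k - l + 1) * c'" unfolding ma a'_def by (rule times_div_less_eq_dividend)
      have "bil_bound l c c' (D * rp powr (real (m - c) * (2 * \<kappa>1)) * Y)"
        by (rule bil_bound_key[OF D l c1(1) mc(2) mB' lm _ B3 Ypos], rule Dd[unfolded partially_decouples_def, rule_format])
          (use c1 mc mB' lm in auto)
      moreover have "D * rp powr (real (m - c) * (2 * \<kappa>1)) * Y \<le> D * r powr (\<kappa> * real c') * Y"
      proof (intro mult_right_mono mult_left_mono)
        have "real (m - c) \<le> real k * real c'" using a'le ma
          by (metis diff_le_self le_trans of_nat_le_iff of_nat_mult)
        then have "real (m - c) * (2 * \<kappa>1) \<le> (real k * real c') * (2 * \<kappa>1)" using \<kappa>1 by (intro mult_right_mono) auto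
        also have "\<dots> = \<kappa> * real c'" using k0 by (simp add: \<kappa>1_def)
        finally show "rp powr (real (m - c) * (2 * \<kappa>1)) \<le> r powr (\<kappa> * real c')" unfolding rpr using r by (intro powr_mono) auto
      qed (use D Ypos in auto)
      ultimately show ?thesis using bil_bound_mono by blast
    qed
    have Yle: "Y \<le> (C1 powr s * C2 powr (1 - s)) * r powr (s * x1) * r powr (e * real B - (x1 / l + (1 - s) * x2) * real c')"
    proof -
      have "Y = (C1 powr s * C2 powr (1 - s)) * r powr ((e * real B - x1 * real m) * s + (e * real B - x2 * real c') * (1 - s))"
        unfolding Y_def Y1_def Y2_def using C1 C2 r by (simp add: powr_mult powr_powr powr_add mult_ac)
      also have "\<dots> \<le> (C1 powr s * C2 powr (1 - s)) * r powr (s * x1 + (e * real B - (x1 / l + (1 - s) * x2) * real c'))"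
      proof (intro mult_left_mono powr_mono)
        have "real ((k - l + 1) * c') / real l < real a' + 1"
        proof -
          have "(k - l + 1) * c' < (a' + 1) * l" unfolding a'_def using l
            by (metis One_nat_def Suc_eq_plus1 dividend_less_div_times mult_Suc add.commute le_eq_less_or_eq less_Suc_eq_0_disj not_less0 zero_less_one)
          then have "real ((k - l + 1) * c') < real ((a' + 1) * l)" by (simp only: of_nat_less_iff)
          then show ?thesis using l by (simp add: field_simps)
        qed
        then have "real (k - l + 1) * real c' / real l < real a' + 1" by (simp only: of_nat_mult)
        moreover have "real a' \<le> real m" by (simp add: m_def)
        ultimately have "real (k - l + 1) * real c' / real l \<le> real m + 1" by linarith
        then have "s * x1 * (real (k - l + 1) * real c' / real l) \<le> s * x1 * (real m + 1)"
          using s x1 by (intro mult_left_mono) auto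
        moreover have "s * x1 * (real (k - l + 1) * real c' / real l) = x1 / l * real c'"
          by (simp add: s_def)
        ultimately have "x1 / l * real c' \<le> s * x1 * (real m + 1)" by (simp only:)
        then show "(e * real B - x1 * real m) * s + (e * real B - x2 * real c') * (1 - s) \<le>
           s * x1 + (e * real B - (x1 / l + (1 - s) * x2) * real c')"
          by (simp add: algebra_simps)
      qed (use r in auto)
      finally show ?thesis by (simp add: powr_add mult_ac)
    qed
    have "D * r powr (\<kappa> * real c') * Y \<le> D * r powr (\<kappa> * real c') * ((C1 powr s * C2 powr (1 - s)) * r powr (s * x1) * r powr (e * real B - (x1 / l + (1 - s) * x2) * real c'))"
      using D by (intro mult_left_mono Yle) auto
    also have "\<dots> = C3 * (r powr (\<kappa> * real c') * r powr (e * real B - (x1 / l + (1 - s) * x2) * real c'))"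
      by (simp add: C3_def mult_ac)
    also have "r powr (\<kappa> * real c') * r powr (e * real B - (x1 / l + (1 - s) * x2) * real c') =
       r powr (e * real B - (x1 / l + (1 - s) * x2 - \<kappa>) * real c')"
      by (simp add: powr_add[symmetric] algebra_simps)
    finally show "bil_bound l c c' (C3 * real_of_int p powr (e * real B - (x1 / l + (1 - 1 / real (k - l + 1)) * x2 - \<kappa>) * real c'))"
      using B4 bil_bound_mono unfolding s_def r_def by blast
  qed
qed

text \<open>Index 0 is a source that stays at \<open>e\<close>, by the linear bound. Truncation at 0
  stands for the trivial bilinear bound and provides the nonnegativity that
  \<open>slope_step\<close> requires.\<close>

fun slopes :: "nat \<Rightarrow> real \<Rightarrow> real \<Rightarrow> nat \<Rightarrow> nat \<Rightarrow> real" where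
  "slopes k e \<kappa> 0 l = (if l = 0 then e else 0)"
| "slopes k e \<kappa> (Suc n) l = (if l = 0 then e else
     max 0 (slopes k e \<kappa> n (k - l) / l + (1 - 1 / real (k - l + 1)) * slopes k e \<kappa> n (l - 1) - \<kappa>))"

lemma slopes_nonneg: "e \<ge> 0 \<Longrightarrow> slopes k e \<kappa> n l \<ge> 0"
  by (cases n) auto

lemma slopes_0: "slopes k e \<kappa> n 0 = e"
  by (cases n) auto

text \<open>The transition matrix of the slopes has unit column sums, so each step raises the total by a fixed amount.\<close>

lemma slopes_sum:
  assumes k: "k \<ge> 2"
  shows "(\<Sum>l\<in>{1..<k}. slopes k e \<kappa> n l) \<ge> real n * (real (k - 1) * (e / k - \<kappa>))"
proof (induction n)
  case (Suc n)
  define X where "X = slopes k e \<kappa> n"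
  have X0: "X 0 = e" by (simp add: X_def slopes_0)
  have "(\<Sum>l\<in>{1..<k}. slopes k e \<kappa> (Suc n) l) \<ge> (\<Sum>l\<in>{1..<k}. X (k - l) / l + (1 - 1 / real (k - l + 1)) * X (l - 1) - \<kappa>)"
    by (intro sum_mono) (auto simp: X_def)
  moreover have "(\<Sum>l\<in>{1..<k}. X (k - l) / l + (1 - 1 / real (k - l + 1)) * X (l - 1) - \<kappa>) =
      (\<Sum>l\<in>{1..<k}. X (k - l) / l) + (\<Sum>l\<in>{1..<k}. (1 - 1 / real (k - l + 1)) * X (l - 1)) - real (k - 1) * \<kappa>"
    by (simp add: sum.distrib sum_subtractf)
  moreover have "(\<Sum>l\<in>{1..<k}. X (k - l) / l) = (\<Sum>j\<in>{1..<k}. X j / (k - j))"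
    by (rule sum.reindex_bij_witness[of _ "\<lambda>j. k - j" "\<lambda>j. k - j"]) (auto simp: of_nat_diff)
  moreover have "(\<Sum>l\<in>{1..<k}. (1 - 1 / real (k - l + 1)) * X (l - 1)) = (\<Sum>j\<in>{0..<k - 1}. (1 - 1 / real (k - j)) * X j)"
    by (rule sum.reindex_bij_witness[of _ "\<lambda>j. j + 1" "\<lambda>j. j - 1"]) (auto simp: of_nat_diff)
  \<comment> \<open>The coefficient vanishes at \<open>j = k - 1\<close>, so the range can be
    completed.\<close>
  moreover have "(\<Sum>j\<in>{0..<k - 1}. (1 - 1 / real (k - j)) * X j) = (\<Sum>j\<in>{0..<k}. (1 - 1 / real (k - j)) * X j)"
  proof -
    have "{0..<k} = insert (k - 1) {0..<k - 1}" using k by auto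
    then show ?thesis using k by (simp add: of_nat_diff)
  qed
  \<comment> \<open>Index 0 splits off as the constant input \<open>(1 - 1 / k) * e\<close> of every
    step.\<close>
  moreover have "(\<Sum>j\<in>{0..<k}. (1 - 1 / real (k - j)) * X j) = (1 - 1 / real k) * e + (\<Sum>j\<in>{1..<k}. (1 - 1 / real (k - j)) * X j)"
  proof -
    have "{0..<k} = insert 0 {1..<k}" using k by auto
    then show ?thesis by (simp add: X0)
  qed
  moreover have "(\<Sum>j\<in>{1..<k}. X j / real (k - j)) + (\<Sum>j\<in>{1..<k}. (1 - 1 / real (k - j)) * X j) = (\<Sum>j\<in>{1..<k}. X j)"
    by (simp add: sum.distrib[symmetric] algebra_simps)
  moreover have "(1 - 1 / real k) * e = real (k - 1) * (e / k)" using k by (simp add: of_nat_diff field_simps)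
  moreover have "(\<Sum>j\<in>{1..<k}. X j) \<ge> real n * (real (k - 1) * (e / k - \<kappa>))" using Suc by (simp add: X_def)
  moreover have "real (k - 1) * (e / k - \<kappa>) = real (k - 1) * (e / k) - real (k - 1) * \<kappa>"
    by (rule right_diff_distrib)
  moreover have "real (Suc n) * (real (k - 1) * (e / k - \<kappa>)) = real n * (real (k - 1) * (e / k - \<kappa>)) + real (k - 1) * (e / k - \<kappa>)"
    by (simp add: distrib_right)
  ultimately show ?case by linarith
qed (auto intro!: sum_nonneg)

lemma slope_slopes:
  assumes p: "prime p" "int k < p" and k: "k \<ge> 2"
    and low: "\<And>l \<kappa>. 1 \<le> l \<Longrightarrow> l < k \<Longrightarrow> \<kappa> > 0 \<Longrightarrow> decouples_upto p l \<kappa>"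
    and e: "decouples_upto p k e" "e \<ge> 0" and \<kappa>: "\<kappa> > 0"
  shows "l < k \<Longrightarrow> slope p k e n l (slopes k e \<kappa> n l)"
proof (induction n arbitrary: l)
  case 0
  then show ?case using slope_0[OF e(1)] slope_trivial[OF e] by (cases "l = 0") auto
next
  case (Suc n)
  show ?case
  proof (cases "l = 0")
    case True
    then show ?thesis using slope_0[OF e(1)] by simp
  next
    case False
    then have l: "1 \<le> l" "l < k" using Suc.prems by auto
    have 1: "slope p k e (Suc n) l (slopes k e \<kappa> n (k - l) / l + (1 - 1 / real (k - l + 1)) * slopes k e \<kappa> n (l - 1) - \<kappa>)"
      by (rule slope_step[OF p l low[OF l]]) (use Suc.IH[of "k - l"] Suc.IH[of "l - 1"] l slopes_nonneg[OF e(2)] \<kappa> in auto)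
    have 2: "slope p k e (Suc n) l 0" by (rule slope_trivial[OF e l])
    show ?thesis using 1 2 False by (simp add: max_def)
  qed
qed

text \<open>Enough iterations push some slope to at least \<open>vexp k + 1\<close>:
  \<open>vexp k\<close> pays for splitting from scale 1 to scale \<open>b\<close>, and the remaining
  unit gains a factor \<open>p\<close> per level of \<open>b\<close>, where \<open>b\<close> is
  about \<open>B / R\<close>. The number of iterations depends only on \<open>k\<close> and
  \<open>e0\<close>, so one \<open>\<tau>\<close> serves every \<open>e \<ge> e0\<close>.\<close>

lemma decoupling_gain:
  assumes p: "prime p" "int k < p" "p \<ge> 16" and k: "k \<ge> 2"
    and low: "\<And>l \<kappa>. 1 \<le> l \<Longrightarrow> l < k \<Longrightarrow> \<kappa> > 0 \<Longrightarrow> decouples_upto p l \<kappa>"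
    and e0: "e0 > 0"
  shows "\<exists>\<tau>>0. \<forall>e\<ge>e0. decouples_upto p k e \<longrightarrow> decouples_upto p k (e - \<tau>)"
proof -
  \<comment> \<open>Half of the input \<open>e0 / k\<close>, so that every iteration still raises
    the total of the slopes by at least \<open>e0 / 4\<close>.\<close>
  define \<kappa> where "\<kappa> = e0 / (2 * real k)"
  have \<kappa>: "\<kappa> > 0" using e0 k by (simp add: \<kappa>_def)
  define r where "r = real_of_int p"
  have r: "r \<ge> 16" using p by (simp add: r_def)
  have p1: "p > 1" using p by simp
  obtain n :: nat where n: "4 * (real k * (real (vexp k) + 1)) / e0 \<le> real n" using real_arch_simple by blast
  define R where "R = (k + 1) ^ n"
  have R: "R \<ge> 1" by (simp add: R_def)
  \<comment> \<open>\<open>1 / R\<close> is the gain per level of \<open>B\<close>; the cap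
    \<open>e0\<close> keeps \<open>e - \<tau>\<close> nonnegative, as needed for
    \<open>gk\<close>.\<close>
  define \<tau> where "\<tau> = min (1 / real R) e0"
  have \<tau>: "\<tau> > 0" "\<tau> \<le> 1 / real R" "\<tau> \<le> e0" using R e0 by (auto simp: \<tau>_def)
  have "decouples_upto p k (e - \<tau>)" if e: "e \<ge> e0" "decouples_upto p k e" for e
  proof -
    have "\<exists>l\<in>{1..<k}. slopes k e \<kappa> n l \<ge> real (vexp k) + 1"
    proof (rule ccontr)
      assume "\<not> ?thesis"
      then have "(\<Sum>l\<in>{1..<k}. slopes k e \<kappa> n l) \<le> (\<Sum>l\<in>{1..<k}. real (vexp k) + 1)"
        by (intro sum_mono) (simp add: not_le less_imp_le)
      also have "\<dots> = real (k - 1) * (real (vexp k) + 1)" by simp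
      also have "\<dots> < real k * (real (vexp k) + 1)" using k by (intro mult_strict_right_mono) auto
      also have "\<dots> \<le> real n * (e0 / 4)" using n e0 by (simp add: field_simps)
      also have "\<dots> \<le> real n * (real (k - 1) * (e / k - \<kappa>))"
      proof (intro mult_left_mono)
        have "e0 / k \<le> e / k" using e by (intro divide_right_mono) auto
        then have "e0 / (2 * real k) \<le> e / k - \<kappa>" using k by (simp add: \<kappa>_def field_simps)
        then have "real (k - 1) * (e0 / (2 * real k)) \<le> real (k - 1) * (e / k - \<kappa>)" by (intro mult_left_mono) auto
        moreover have "e0 / 4 \<le> real (k - 1) * (e0 / (2 * real k))"
        proof -
          have "real (k - 1) = real k - 1" using k by (simp add: of_nat_diff)
          then have "1 / 2 \<le> real (k - 1) / real k" using k by (simp add: field_simps)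
          then have "1 / 2 * (e0 / 2) \<le> real (k - 1) / real k * (e0 / 2)" by (rule mult_right_mono) (use e0 in simp)
          then show ?thesis by (simp add: mult_ac)
        qed
        ultimately show "e0 / 4 \<le> real (k - 1) * (e / k - \<kappa>)" by linarith
      qed auto
      also have "\<dots> \<le> (\<Sum>l\<in>{1..<k}. slopes k e \<kappa> n l)" by (rule slopes_sum[OF k])
      finally show False by simp
    qed
    then obtain l where l: "1 \<le> l" "l < k" and x: "slopes k e \<kappa> n l \<ge> real (vexp k) + 1" by auto
    define x where "x = slopes k e \<kappa> n l"
    have sl: "slope p k e n l x" unfolding x_def
      by (rule slope_slopes[OF p(1,2) k low]) (use e e0 \<kappa> l in auto)
    obtain C1 where C1: "C1 > 0" "\<And>B A a N c c'. bilinear p k B A a N \<Longrightarrow> 1 \<le> c \<Longrightarrow> 1 \<le> c' \<Longrightarrow>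
       R * max c c' \<le> B \<Longrightarrow>
       bilinear.bil_bound p k B A a N l c c' (C1 * real_of_int p powr (e * real B - x * real c'))"
      using sl unfolding slope_def R_def by blast
    obtain C0 where C0: "C0 \<ge> 1" "\<And>B. decouples p k B (C0 * r powr (real B * (eexp k + e)))"
      using e(2) unfolding decouples_upto_def r_def by blast
    \<comment> \<open>The first entry covers \<open>B < R\<close>; the second makes the broad part
      at most half of the target.\<close>
    define C where "C = max (C0 * r powr (real R * \<tau>)) (2 * (r ^ (2 * vexp k + 2) * (C1 * r)))"
    have C: "C \<ge> 1"
    proof -
      have "1 * 1 \<le> C0 * r powr (real R * \<tau>)" using C0 r \<tau> by (intro mult_mono ge_one_powr_ge_zero) auto
      then show ?thesis by (simp add: C_def)
    qed
    define g where "g = eexp k + (e - \<tau>)"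
    have vk: "vexp k \<ge> 6" unfolding vexp_def using k mult_le_mono[of 2 k 3 "k + 1"] by simp
    have gk: "g \<ge> eexp k" using e \<tau> by (simp add: g_def)
    \<comment> \<open>The narrow part costs \<open>2 ^ vexp k\<close>, while one level is worth
      \<open>r powr g\<close>. Since \<open>16 = 2 ^ 4\<close> and
      \<open>4 * eexp k \<ge> vexp k + 1\<close>, the narrow part is at most half of the
      target.\<close>
    have rg: "2 * 2 ^ vexp k \<le> r powr g"
    proof -
      have "2 * 2 ^ vexp k = (2::real) powr (1 + real (vexp k))" by (simp add: powr_add powr_realpow)
      also have "\<dots> \<le> 2 powr (4 * eexp k)" using vk by (intro powr_mono) (auto simp: eexp_def)
      also have "\<dots> = 16 powr eexp k" by (simp add: powr_powr[symmetric])
      also have "\<dots> \<le> r powr eexp k" using r vk by (intro powr_mono2) (auto simp: eexp_def)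
      also have "\<dots> \<le> r powr g" using r gk by (intro powr_mono) auto
      finally show ?thesis .
    qed
    have "decouples p k B (C * r powr (real B * g))" for B
    proof (induction B rule: less_induct)
      case (less B)
      show ?case
      proof (cases "B < R")
        case True
        show ?thesis
        proof (rule decouples_mono[OF C0(2)])
          have "real B * (eexp k + e) = real B * \<tau> + real B * g" by (simp add: g_def algebra_simps)
          then have "C0 * r powr (real B * (eexp k + e)) = C0 * r powr (real B * \<tau>) * r powr (real B * g)"
            by (simp add: powr_add)
          also have "\<dots> \<le> C0 * r powr (real R * \<tau>) * r powr (real B * g)"
            using C0 r \<tau> True by (intro mult_right_mono mult_left_mono powr_mono) auto
          also have "\<dots> \<le> C * r powr (real B * g)" by (intro mult_right_mono) (auto simp: C_def)
          finally show "C0 * r powr (real B * (eexp k + e)) \<le> C * r powr (real B * g)" .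
        qed
      next
        case False
        then have B1: "B \<ge> 1" using R by simp
        define b where "b = B div R"
        have b1: "b \<ge> 1" using False R by (simp add: b_def div_greater_zero_iff Suc_le_eq)
        have bB: "R * b \<le> B" by (simp add: b_def)
        have bB': "b \<le> B" by (simp add: b_def)
        have bR: "real B / real R \<le> real b + 1"
        proof -
          have "B < R * (b + 1)" unfolding b_def using R
            by (metis Suc_eq_plus1 dividend_less_times_div mult.commute mult_Suc_right add.commute less_le_trans zero_less_one)
          then have "real B < real (R * (b + 1))" by (simp only: of_nat_less_iff)
          then show ?thesis using R by (simp add: field_simps)
        qed
        define K where "K = C * r powr (real (B - 1) * g)"
        define Y where "Y = C1 * r powr (e * real B - real b)"
        define G where "G = r powr (real B * g)"
        have main: "2 ^ vexp k * K + r ^ (2 * vexp k + 2) * Y * r powr (real B * eexp k) \<le> C * G"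
        proof -
          have "real B * g = g + real (B - 1) * g" using B1 by (simp add: of_nat_diff algebra_simps)
          then have "G = r powr g * r powr (real (B - 1) * g)" by (simp add: G_def powr_add)
          moreover have "(2 * 2 ^ vexp k) * r powr (real (B - 1) * g) \<le> r powr g * r powr (real (B - 1) * g)"
            using rg by (intro mult_right_mono) auto
          ultimately have "C * ((2 * 2 ^ vexp k) * r powr (real (B - 1) * g)) \<le> C * G" using C by (intro mult_left_mono) auto
          then have 1: "2 ^ vexp k * K \<le> C * G / 2" by (simp add: K_def mult_ac)
          have "Y * r powr (real B * eexp k) = C1 * r powr (e * real B - real b + real B * eexp k)"
            by (simp add: Y_def powr_add)
          also have "\<dots> \<le> C1 * r powr (1 + real B * g)"
          proof (intro mult_left_mono powr_mono)
            have "real B * \<tau> \<le> real B * (1 / real R)" using \<tau> by (intro mult_left_mono) auto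
            then have "real B * \<tau> \<le> real b + 1" using bR by simp
            then show "e * real B - real b + real B * eexp k \<le> 1 + real B * g" by (simp add: g_def algebra_simps)
          qed (use C1 r in auto)
          also have "\<dots> = (C1 * r) * G" using r by (simp add: G_def powr_add)
          finally have "r ^ (2 * vexp k + 2) * (Y * r powr (real B * eexp k)) \<le> r ^ (2 * vexp k + 2) * ((C1 * r) * G)"
            using r by (intro mult_left_mono) auto
          also have "\<dots> = (r ^ (2 * vexp k + 2) * (C1 * r)) * G" by (simp only: mult.assoc)
          also have "\<dots> \<le> (C / 2) * G" by (intro mult_right_mono) (auto simp: C_def G_def)
          finally show ?thesis using 1 by (simp add: mult.assoc)
        qed
        show ?thesis unfolding decouples_def
        proof (intro allI impI)
          fix A :: "int set" and a :: "int \<Rightarrow> complex" assume A: "finite A"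
          define N0 where "N0 \<xi> = (\<Sum>\<gamma>\<in>pfreqs p k B. amp p k B (residue_class A (p ^ B) \<xi>) a \<gamma> ^ vexp k)" for \<xi>
          have N0: "N0 \<xi> \<ge> 0" for \<xi> unfolding N0_def by (intro sum_nonneg) auto
          define Z where "Z = (\<Sum>\<gamma>\<in>pfreqs p k B. amp p k B A a \<gamma> ^ vexp k)"
          \<comment> \<open>The locale demands positive majorants, so \<open>\<delta>\<close> is
            added here and made arbitrarily small afterwards.\<close>
          have bound: "Z \<le> C * G * (\<Sum>\<xi>\<in>{0..<p ^ B}. N0 \<xi>) + \<delta> * (C * G * real_of_int p ^ B)" if \<delta>: "\<delta> > 0" for \<delta>
          proof -
            have bil: "bilinear p k B A a (\<lambda>\<xi>. N0 \<xi> + \<delta>)"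
              by unfold_locales (use p k A N0 \<delta> in \<open>auto simp: N0_def add_nonneg_pos\<close>)
            interpret bilinear p k B A a "\<lambda>\<xi>. N0 \<xi> + \<delta>" by (rule bil)
            have rpr: "rp = r" by (simp add: rp_def r_def)
            have Bb: "bil_bound l b b (C1 * r powr (e * real B - x * real b))"
              unfolding r_def by (rule C1(2)[OF bil b1 b1]) (use bB in simp)
            have B11: "bil_bound l 1 1 (rp powr (real b * real (vexp k)) * (C1 * r powr (e * real B - x * real b)))"
              by (rule bil_bound_split[OF l b1 bB' Bb]) (use C1 r in auto)
            have "rp powr (real b * real (vexp k)) * (C1 * r powr (e * real B - x * real b)) \<le> Y"
            proof -
              have "real b * (real (vexp k) + 1) \<le> real b * x" using x by (intro mult_left_mono) (auto simp: x_def)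
              then have "real b * real (vexp k) + (e * real B - x * real b) \<le> e * real B - real b" by (simp add: algebra_simps)
              then have "C1 * r powr (real b * real (vexp k) + (e * real B - x * real b)) \<le> Y"
                unfolding Y_def using C1 r by (intro mult_left_mono powr_mono) auto
              then show ?thesis by (simp add: rpr powr_add mult_ac)
            qed
            then have BY: "bil_bound l 1 1 Y" using B11 bil_bound_mono by blast
            have "Z \<le> (2 ^ vexp k * K + rp ^ (2 * vexp k + 2) * Y * rp powr (real B * eexp k)) * (\<Sum>\<xi>\<in>{0..<p ^ B}. N0 \<xi> + \<delta>)"
              unfolding Z_def \<Gamma>_def[symmetric]
              by (rule broad_narrow_step[OF l B1 BY]) (use less.IH[of "B - 1"] B1 C C1 r in \<open>auto simp: K_def Y_def\<close>)
            also have "\<dots> \<le> C * G * (\<Sum>\<xi>\<in>{0..<p ^ B}. N0 \<xi> + \<delta>)"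
              unfolding rpr using N0 \<delta> by (intro mult_right_mono main sum_nonneg) (auto intro: add_nonneg_nonneg less_imp_le)
            also have "\<dots> = C * G * (\<Sum>\<xi>\<in>{0..<p ^ B}. N0 \<xi>) + \<delta> * (C * G * real_of_int p ^ B)"
              using p1 by (simp add: sum.distrib algebra_simps)
            finally show ?thesis .
          qed
          have "Z \<le> C * G * (\<Sum>\<xi>\<in>{0..<p ^ B}. N0 \<xi>) + d" if d: "d > 0" for d
          proof -
            define M where "M = C * G * real_of_int p ^ B"
            have M: "M > 0" using C r p1 by (simp add: M_def G_def)
            then show ?thesis using bound[of "d / M"] d by (simp add: M_def[symmetric])
          qed
          then have "Z \<le> C * G * (\<Sum>\<xi>\<in>{0..<p ^ B}. N0 \<xi>)" by (rule field_le_epsilon)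
          then show "(\<Sum>\<gamma>\<in>pfreqs p k B. amp p k B A a \<gamma> ^ vexp k) \<le> C * r powr (real B * g) *
             (\<Sum>\<xi>\<in>{0..<p ^ B}. \<Sum>\<gamma>\<in>pfreqs p k B. amp p k B (residue_class A (p ^ B) \<xi>) a \<gamma> ^ vexp k)"
            by (simp add: Z_def N0_def G_def)
        qed
      qed
    qed
    then show ?thesis using C unfolding decouples_upto_def g_def r_def by blast
  qed
  then show ?thesis using \<tau>(1) by blast
qed

text \<open>The trivial excess \<open>vexp k\<close> drops by a fixed \<open>\<tau>\<close> as long
  as it is at least \<open>\<kappa>\<close>, so finitely many drops suffice. Each drop uses all
  lower dimensions with arbitrarily small excess.\<close>

theorem moment_curve_decoupling:
  assumes p: "prime p" "p \<ge> 16" and "1 \<le> k" "int k < p" "\<kappa> > 0"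
  shows "decouples_upto p k \<kappa>"
  using assms(3-)
proof (induction k arbitrary: \<kappa> rule: less_induct)
  case (less k)
  have p1: "p > 1" using p by simp
  show ?case
  proof (cases "k = 1")
    case True
    have "decouples_upto p 1 0" unfolding decouples_upto_def
      using decouples_1[OF p1] p1 by (intro exI[of _ 1]) (simp add: eexp_def vexp_def)
    then show ?thesis using decouples_upto_mono[of p 1 0 \<kappa>] less.prems p1 True by simp
  next
    case False
    then have k: "k \<ge> 2" using less.prems by simp
    obtain \<tau> where \<tau>: "\<tau> > 0" "\<And>e. e \<ge> \<kappa> \<Longrightarrow> decouples_upto p k e \<Longrightarrow> decouples_upto p k (e - \<tau>)"
      using decoupling_gain[OF p(1) _ p(2) k _ \<open>\<kappa> > 0\<close>] less.IH less.prems by auto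
    have "\<exists>e. decouples_upto p k e \<and> (e \<le> \<kappa> \<or> e \<le> real (vexp k) - real n * \<tau>)" for n :: nat
    proof (induction n)
      case 0
      then show ?case using decouples_upto_trivial[OF p1 less.prems(1)] by (intro exI[of _ "real (vexp k)"]) simp
    next
      case (Suc n)
      then obtain e where e: "decouples_upto p k e" "e \<le> \<kappa> \<or> e \<le> real (vexp k) - real n * \<tau>" by blast
      show ?case
      proof (cases "e \<le> \<kappa>")
        case True
        then show ?thesis using e by blast
      next
        case False
        then have "decouples_upto p k (e - \<tau>)" using \<tau>(2)[of e] e by simp
        moreover have "e - \<tau> \<le> real (vexp k) - real (Suc n) * \<tau>" using e False by (simp add: algebra_simps)
        ultimately show ?thesis by blast
      qed
    qed
    moreover obtain n :: nat where "(real (vexp k) - \<kappa>) / \<tau> \<le> real n" using real_arch_simple by blast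
    then have "real (vexp k) - real n * \<tau> \<le> \<kappa>" using \<tau>(1) by (simp add: field_simps)
    ultimately obtain e where "decouples_upto p k e" "e \<le> \<kappa>" by (meson order_trans)
    then show ?thesis using decouples_upto_mono p1 by blast
  qed
qed

section \<open>Mean values along well-spaced frequencies\<close>

text \<open>Each class modulo \<open>p ^ B\<close> contains at most one point, so its moment is at
  most the number of frequencies. Summation over \<open>p ^ B\<close> classes turns
  \<open>eexp k\<close> into \<open>vexp k / 2\<close>, that is, square-root cancellation.\<close>

lemma mean_value:
  assumes k: "k \<ge> 1" and dec: "decouples_upto p k \<kappa>" and p: "p > 1"
  shows "\<exists>C\<ge>1. \<forall>B A a. finite A \<longrightarrow> inj_on (\<lambda>n. n mod p ^ B) A \<longrightarrow> (\<forall>n\<in>A. norm (a n) \<le> 1) \<longrightarrow>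
    (\<Sum>c\<in>pfreqs p k B. amp p k B A a c ^ vexp k)
      \<le> C * real_of_int p powr (real B * (real (vexp k) / 2 + \<kappa>)) * real (card (pfreqs p k B))"
proof -
  obtain C where C: "C \<ge> 1" "\<And>B. decouples p k B (C * real_of_int p powr (real B * (eexp k + \<kappa>)))"
    using dec unfolding decouples_upto_def by blast
  have main: "(\<Sum>c\<in>pfreqs p k B. amp p k B A a c ^ vexp k)
      \<le> C * real_of_int p powr (real B * (real (vexp k) / 2 + \<kappa>)) * real (card (pfreqs p k B))"
    if A: "finite A" "inj_on (\<lambda>n. n mod p ^ B) A" and a: "\<forall>n\<in>A. norm (a n) \<le> 1" for B A a
  proof -
    define \<Omega> where "\<Omega> = pfreqs p k B"
    have one: "amp p k B (residue_class A (p ^ B) \<xi>) a c ^ vexp k \<le> 1" for \<xi> c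
    proof (rule power_le_one)
      have card1: "card (residue_class A (p ^ B) \<xi>) \<le> 1"
      proof -
        have "card (residue_class A (p ^ B) \<xi>) = card ((\<lambda>n. n mod p ^ B) ` residue_class A (p ^ B) \<xi>)"
          using A(2) by (intro card_image[symmetric] inj_on_subset[OF A(2)]) (auto simp: residue_class_def)
        also have "\<dots> \<le> card {\<xi>}" by (intro card_mono) (auto simp: residue_class_def)
        finally show ?thesis by simp
      qed
      have "amp p k B (residue_class A (p ^ B) \<xi>) a c \<le> (\<Sum>n\<in>residue_class A (p ^ B) \<xi>. 1)"
        unfolding expsum_def by (intro order_trans[OF norm_sum] sum_mono) (use a in \<open>auto simp: norm_mult poly_char_def residue_class_def\<close>)
      then show "amp p k B (residue_class A (p ^ B) \<xi>) a c \<le> 1" using card1 by simp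
    qed auto
    have "(\<Sum>c\<in>\<Omega>. amp p k B A a c ^ vexp k) \<le>
      C * real_of_int p powr (real B * (eexp k + \<kappa>)) * (\<Sum>\<xi>\<in>{0..<p ^ B}. \<Sum>c\<in>\<Omega>.
            amp p k B (residue_class A (p ^ B) \<xi>) a c ^ vexp k)"
      using C(2)[of B] A unfolding decouples_def \<Omega>_def by blast
    also have "\<dots> \<le> C * real_of_int p powr (real B * (eexp k + \<kappa>)) * (\<Sum>\<xi>\<in>{0..<p ^ B}. \<Sum>c\<in>\<Omega>. 1)"
      using C by (intro mult_left_mono sum_mono one) auto
    also have "\<dots> = C * (real_of_int p powr (real B * (eexp k + \<kappa>)) * real_of_int p powr real B) * real (card \<Omega>)"
      using p by (simp add: powr_realpow)
    also have "real_of_int p powr (real B * (eexp k + \<kappa>)) * real_of_int p powr real B = real_of_int p powr (real B * (real (vexp k) / 2 + \<kappa>))"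
      by (simp add: powr_add[symmetric] eexp_def algebra_simps)
    finally show ?thesis by (simp add: \<Omega>_def)
  qed
  then show ?thesis using C(1) by blast
qed

text \<open>Taylor expansion turns a slowly varying factor into bounded weights that do not depend on \<open>z\<close>.\<close>

lemma taylor_weights:
  fixes \<psi> :: "'z \<Rightarrow> int \<Rightarrow> complex" and \<rho> :: "'z \<Rightarrow> real" and N :: real
  assumes Z: "finite Z" and A: "finite A" "\<And>y. y \<in> A \<Longrightarrow> \<bar>real_of_int y\<bar> \<le> N" and N: "N > 0" and P: "P \<ge> 1"
    and \<rho>: "\<And>z. z \<in> Z \<Longrightarrow> \<bar>\<rho> z\<bar> * N ^ j \<le> 1"
    and bound: "\<And>b. (\<forall>y\<in>A. norm (b y) \<le> 1) \<Longrightarrow> (\<Sum>z\<in>Z. norm (expsum A b (\<psi> z)) ^ P) \<le> \<Phi>"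
    and a: "\<forall>y\<in>A. norm (a y) \<le> 1"
  shows "(\<Sum>z\<in>Z. norm (expsum A a (\<lambda>y. \<psi> z y * ee (\<rho> z * real_of_int y ^ j))) ^ P) \<le> exp (2 * pi) ^ P * \<Phi>"
proof -
  \<comment> \<open>Since \<open>\<rho> z * N ^ j\<close> and \<open>y / N\<close> have absolute
    value at most 1, the Taylor coefficients of \<open>exp (2 * pi)\<close> dominate the expansion
    of the slowly varying factor.\<close>
  define w where "w t = (2 * pi) ^ t / fact t" for t :: nat
  have w0: "w t \<ge> 0" for t by (simp add: w_def)
  have wsum: "w sums exp (2 * pi)" using exp_converges[of "2 * pi"] by (simp add: w_def[abs_def] divide_inverse mult.commute)
  define b where "b t y = a y * of_real ((real_of_int y / N) ^ (j * t))" for t y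
  have b1: "\<forall>y\<in>A. norm (b t y) \<le> 1" for t
  proof
    fix y assume y: "y \<in> A"
    have "\<bar>real_of_int y / N\<bar> \<le> 1" using A(2)[OF y] N by simp
    then have "\<bar>real_of_int y / N\<bar> ^ (j * t) \<le> 1" by (intro power_le_one) auto
    then have "norm (a y) * \<bar>real_of_int y / N\<bar> ^ (j * t) \<le> 1 * 1" using a y by (intro mult_mono) auto
    then show "norm (b t y) \<le> 1" by (simp add: b_def norm_mult norm_power power_abs norm_divide)
  qed
  have \<Phi>0: "\<Phi> \<ge> 0" using bound[OF a] by (rule order_trans[rotated]) (intro sum_nonneg, simp)
  define V where "V t z = expsum A (b t) (\<psi> z)" for t z
  define U where "U T z = (\<Sum>t<T. of_real (w t) * (\<i> * of_real (\<rho> z * N ^ j)) ^ t * V t z)" for T z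
  have U_bound: "(\<Sum>z\<in>Z. norm (U T z) ^ P) \<le> exp (2 * pi) ^ P * \<Phi>" for T
  proof -
    define W where "W = (\<Sum>t<T. w t)"
    have W: "0 \<le> W" "W \<le> exp (2 * pi)"
      using sum_le_suminf[OF sums_summable[OF wsum], of "{..<T}"] w0 wsum by (auto simp: W_def sum_nonneg sums_iff)
    have "(\<Sum>z\<in>Z. norm (U T z) ^ P) \<le> (\<Sum>z\<in>Z. (\<Sum>t<T. w t * norm (V t z)) ^ P)"
    proof (intro sum_mono power_mono)
      fix z assume z: "z \<in> Z"
      have "norm (U T z) \<le> (\<Sum>t<T. norm (of_real (w t) * (\<i> * of_real (\<rho> z * N ^ j)) ^ t * V t z))"
        unfolding U_def by (rule norm_sum)
      also have "\<dots> \<le> (\<Sum>t<T. w t * norm (V t z))"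
      proof (rule sum_mono)
        fix t
        have "\<bar>\<rho> z * N ^ j\<bar> \<le> 1" using \<rho>[OF z] N by (simp add: abs_mult)
        then have "\<bar>\<rho> z * N ^ j\<bar> ^ t \<le> 1" by (intro power_le_one) auto
        then have "w t * (\<bar>\<rho> z * N ^ j\<bar> ^ t * norm (V t z)) \<le> w t * (1 * norm (V t z))"
          by (intro mult_left_mono mult_right_mono w0) auto
        moreover have "norm (of_real (w t) * (\<i> * of_real (\<rho> z * N ^ j)) ^ t * V t z) = w t * (\<bar>\<rho> z * N ^ j\<bar> ^ t * norm (V t z))"
          using w0[of t] by (simp add: norm_mult norm_power del: of_real_mult)
        ultimately show "norm (of_real (w t) * (\<i> * of_real (\<rho> z * N ^ j)) ^ t * V t z) \<le> w t * norm (V t z)" by simp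
      qed
      finally show "norm (U T z) \<le> (\<Sum>t<T. w t * norm (V t z))" .
    qed auto
    \<comment> \<open>Jensen with the summable weights \<open>w\<close>; an unweighted power mean
      would lose the number \<open>T\<close> of terms.\<close>
    also have "\<dots> \<le> (\<Sum>z\<in>Z. W ^ (P - 1) * (\<Sum>t<T. w t * norm (V t z) ^ P))"
      unfolding W_def by (intro sum_mono weighted_power_mean) (use w0 P in auto)
    also have "\<dots> = W ^ (P - 1) * (\<Sum>t<T. w t * (\<Sum>z\<in>Z. norm (V t z) ^ P))"
      unfolding sum_distrib_left by (subst sum.swap) (rule refl)
    also have "\<dots> \<le> W ^ (P - 1) * (\<Sum>t<T. w t * \<Phi>)"
      unfolding V_def by (intro mult_left_mono sum_mono bound b1 w0) (use W in auto)
    also have "\<dots> = W ^ P * \<Phi>"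
    proof -
      have "W ^ P = W ^ (P - 1) * W" using P by (metis One_nat_def Suc_pred less_eq_Suc_le power_Suc2)
      then show ?thesis by (simp add: W_def sum_distrib_right[symmetric])
    qed
    also have "\<dots> \<le> exp (2 * pi) ^ P * \<Phi>" using W \<Phi>0 by (intro mult_right_mono power_mono) auto
    finally show ?thesis .
  qed
  have lim: "(\<lambda>T. U T z) \<longlonglongrightarrow> expsum A a (\<lambda>y. \<psi> z y * ee (\<rho> z * real_of_int y ^ j))" for z
  proof -
    have "(\<lambda>t. of_real (w t) * (\<i> * of_real (\<rho> z * N ^ j)) ^ t * V t z) sums expsum A a (\<lambda>y. \<psi> z y * ee (\<rho> z * real_of_int y ^ j))"
      unfolding V_def expsum_def sum_distrib_left
    proof (rule sums_sum)
      fix y assume "y \<in> A"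
      define u where "u = \<i> * of_real (2 * pi * (\<rho> z * real_of_int y ^ j))"
      have "(\<lambda>t. u ^ t /\<^sub>R fact t) sums exp u" by (rule exp_converges)
      also have "exp u = ee (\<rho> z * real_of_int y ^ j)"
        unfolding u_def ee_def cis_conv_exp by simp
      finally have "(\<lambda>t. (a y * \<psi> z y) * (u ^ t /\<^sub>R fact t)) sums ((a y * \<psi> z y) * ee (\<rho> z * real_of_int y ^ j))"
        by (rule sums_mult)
      moreover have "(a y * \<psi> z y) * (u ^ t /\<^sub>R fact t) = of_real (w t) * (\<i> * of_real (\<rho> z * N ^ j)) ^ t * (b t y * \<psi> z y)" for t
      proof -
        have "u = of_real (2 * pi) * (\<i> * of_real (\<rho> z * N ^ j)) * of_real ((real_of_int y / N) ^ j)"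
          using N by (simp add: u_def power_divide mult_ac)
        then show ?thesis
          by (simp add: b_def w_def power_mult_distrib power_mult scaleR_conv_of_real divide_inverse mult_ac)
      qed
      ultimately show "(\<lambda>t. of_real (w t) * (\<i> * of_real (\<rho> z * N ^ j)) ^ t * (b t y * \<psi> z y)) sums (a y * (\<psi> z y * ee (\<rho> z * real_of_int y ^ j)))"
        by (simp add: mult.assoc)
    qed
    then show ?thesis unfolding sums_def U_def .
  qed
  have "(\<lambda>T. \<Sum>z\<in>Z. norm (U T z) ^ P) \<longlonglongrightarrow> (\<Sum>z\<in>Z. norm (expsum A a (\<lambda>y. \<psi> z y * ee (\<rho> z * real_of_int y ^ j))) ^ P)"
    by (intro tendsto_intros lim)
  then show ?thesis by (rule LIMSEQ_le_const2) (use U_bound in auto)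
qed

lemma taylor_weights_multi:
  fixes \<psi> :: "'z \<Rightarrow> int \<Rightarrow> complex" and \<rho> :: "'z \<Rightarrow> nat \<Rightarrow> real" and N :: real
  assumes Z: "finite Z" and A: "finite A" "\<And>y. y \<in> A \<Longrightarrow> \<bar>real_of_int y\<bar> \<le> N" and N: "N > 0" and P: "P \<ge> 1"
    and \<rho>: "\<And>z j. z \<in> Z \<Longrightarrow> j < J \<Longrightarrow> \<bar>\<rho> z j\<bar> * N ^ j \<le> 1"
    and bound: "\<And>b. (\<forall>y\<in>A. norm (b y) \<le> 1) \<Longrightarrow> (\<Sum>z\<in>Z. norm (expsum A b (\<psi> z)) ^ P) \<le> \<Phi>"
    and a: "\<forall>y\<in>A. norm (a y) \<le> 1"
  shows "(\<Sum>z\<in>Z. norm (expsum A a (\<lambda>y. \<psi> z y * ee (\<Sum>j<J. \<rho> z j * real_of_int y ^ j))) ^ P) \<le> (exp (2 * pi) ^ P) ^ J * \<Phi>"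
  using \<rho> a
proof (induction J arbitrary: a)
  case 0
  then show ?case using bound by simp
next
  case (Suc J)
  have "(\<Sum>z\<in>Z. norm (expsum A a (\<lambda>y. (\<psi> z y * ee (\<Sum>j<J. \<rho> z j * real_of_int y ^ j)) * ee (\<rho> z J * real_of_int y ^ J))) ^ P)
     \<le> exp (2 * pi) ^ P * ((exp (2 * pi) ^ P) ^ J * \<Phi>)"
    by (rule taylor_weights[OF Z A N P]) (use Suc in auto)
  then show ?case by (simp add: ee_add mult.assoc)
qed

definition near_int :: "real \<Rightarrow> real \<Rightarrow> bool" where
  "near_int \<delta> x \<longleftrightarrow> (\<exists>m::int. \<bar>x - of_int m\<bar> \<le> \<delta>)"

lemma card_mod_interval:
  fixes q Q s :: int
  assumes "q > 0" "0 \<le> Q" "Q \<le> q"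
  shows "card {v \<in> {0..<q}. (v - s) mod q < Q} = nat Q"
proof -
  have "bij_betw (\<lambda>x. (x + s) mod q) {0..<Q} {v \<in> {0..<q}. (v - s) mod q < Q}"
  proof (rule bij_betwI[where g = "\<lambda>v. (v - s) mod q"])
    show "(\<lambda>x. (x + s) mod q) \<in> {0..<Q} \<rightarrow> {v \<in> {0..<q}. (v - s) mod q < Q}"
      using assms by (auto simp: mod_simps)
    show "(\<lambda>v. (v - s) mod q) \<in> {v \<in> {0..<q}. (v - s) mod q < Q} \<rightarrow> {0..<Q}"
      using assms by auto
  qed (use assms in \<open>auto simp: mod_simps\<close>)
  then show ?thesis using bij_betw_same_card by fastforce
qed

text \<open>Each real frequency vector is thickened to a box of vectors modulo \<open>q\<close>, of
  side about \<open>q / N ^ j\<close> in coordinate \<open>j\<close>; across a box the phase varies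
  only by slowly varying factors on the range of \<open>y\<close>. As the top coefficients form an
  arithmetic progression of step \<open>\<mu>\<close>, a vector lies in no more boxes than there are
  counted \<open>z\<close>, and the sum is controlled by the complete moment over
  \<open>freqs k q\<close>.\<close>

theorem weyl_mean:
  assumes k: "k \<ge> 1" and \<kappa>: "\<kappa> > 0"
  shows "\<exists>C>0. \<forall>(N::nat) a (\<gamma> :: nat \<Rightarrow> nat \<Rightarrow> real) \<mu> \<nu>. N \<ge> 1 \<longrightarrow>
     (\<forall>y. norm (a y) \<le> 1) \<longrightarrow> (\<forall>x. \<gamma> x k = \<mu> * real x + \<nu>) \<longrightarrow>
     (\<Sum>x<N. norm (\<Sum>y\<in>{- int N..<int N}. a y * ee (\<Sum>j\<le>k. \<gamma> x j * real_of_int y ^ j)) ^ vexp k)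
       \<le> C * real N powr (real (vexp k) + \<kappa>) * real (card {z. z < N \<and> near_int (1 / real N ^ k) (\<mu> * real z)})"
proof -
  obtain p0 :: nat where p0: "prime p0" "p0 > max k 16" using bigger_prime by blast
  define p where "p = int p0"
  have p: "prime p" "p \<ge> 16" "int k < p" using p0 by (auto simp: p_def)
  have p1: "p > 1" using p by simp
  define r where "r = real_of_int p"
  have r: "r > 1" using p1 by (simp add: r_def)
  define P where "P = vexp k"
  have P: "P \<ge> 1" using vexp_ge_2[OF k] by (simp add: P_def)
  define k' where "k' = (\<Sum>j\<le>k. j)"
  have Pk: "real P / 2 = real k'"
  proof -
    have "2 * k' = P" unfolding k'_def P_def vexp_def using gauss_sum_nat[of k] by (simp add: atMost_atLeast0)
    then show ?thesis by (simp add: field_simps flip: of_nat_mult) 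
  qed
  obtain C where C: "C \<ge> 1" "\<And>B A a. finite A \<Longrightarrow> inj_on (\<lambda>n. n mod p ^ B) A \<Longrightarrow> (\<forall>n\<in>A. norm (a n) \<le> 1) \<Longrightarrow>
    (\<Sum>c\<in>pfreqs p k B. amp p k B A a c ^ P)
      \<le> C * r powr (real B * (real P / 2 + \<kappa>)) * real (card (pfreqs p k B))"
    using mean_value[OF k moment_curve_decoupling[OF p(1,2) k p(3) \<kappa>] p1] unfolding P_def r_def by blast
  define E where "E = (exp (2 * pi) ^ P) ^ (k + 1)"
  have E: "E > 0" by (simp add: E_def)
  define C' where "C' = E * C * (2 * r) powr (real P / 2 + \<kappa>) * 2 ^ (k + 1)"
  have C': "C' > 0" using E C r by (simp add: C'_def)
  have main: "(\<Sum>x<N. norm (\<Sum>y\<in>{- int N..<int N}. a y * ee (\<Sum>j\<le>k. \<gamma> x j * real_of_int y ^ j)) ^ P)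
       \<le> C' * real N powr (real P + \<kappa>) * real (card {z. z < N \<and> near_int (1 / real N ^ k) (\<mu> * real z)})"
    if N: "N \<ge> 1" and a: "\<forall>y. norm (a y) \<le> 1" and \<gamma>: "\<forall>x. \<gamma> x k = \<mu> * real x + \<nu>"
    for N :: nat and a and \<gamma> :: "nat \<Rightarrow> nat \<Rightarrow> real" and \<mu> \<nu>
  proof -
    define M where "M = card {z. z < N \<and> near_int (1 / real N ^ k) (\<mu> * real z)}"
    define A where "A = {- int N..<int N}"
    have A: "finite A" "\<And>y. y \<in> A \<Longrightarrow> \<bar>real_of_int y\<bar> \<le> real N" by (auto simp: A_def)
    \<comment> \<open>Large enough to separate the \<open>2 * N\<close> points of \<open>A\<close>
      modulo \<open>p ^ B\<close>, yet within a factor \<open>p\<close> of the minimum, so that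
      \<open>p ^ B\<close> stays comparable to \<open>N\<close>.\<close>
    obtain B where B: "2 * int N \<le> p ^ B" "p ^ B \<le> p * (2 * int N)"
    proof -
      define B where "B = (LEAST B. 2 * int N \<le> p ^ B)"
      have ex: "2 * int N \<le> p ^ (2 * N)"
      proof -
        have "int (2 * N) < 2 ^ (2 * N)" by (metis of_nat_less_two_power)
        also have "(2::int) ^ (2 * N) \<le> p ^ (2 * N)" using p1 by (intro power_mono) auto
        finally show ?thesis by simp
      qed
      have 1: "2 * int N \<le> p ^ B" unfolding B_def by (rule LeastI[of _ "2 * N"]) (rule ex)
      have "B \<noteq> 0" using 1 N by (cases B) auto
      then have "\<not> 2 * int N \<le> p ^ (B - 1)" using not_less_Least[of "B - 1" "\<lambda>B. 2 * int N \<le> p ^ B"] by (simp add: B_def)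
      then have "p * p ^ (B - 1) \<le> p * (2 * int N)" using p1 by (intro mult_left_mono) auto
      moreover have "p * p ^ (B - 1) = p ^ B" using \<open>B \<noteq> 0\<close> by (simp add: power_eq_if)
      ultimately show ?thesis using 1 that by simp
    qed
    define q where "q = p ^ (k * B)"
    have q0: "q > 0" using p1 by (simp add: q_def)
    define Q where "Q j = q div int N ^ j" for j
    have Nq: "int N ^ j \<le> q" if "j \<le> k" for j
    proof -
      have "int N ^ j \<le> int N ^ k" using N that by (intro power_increasing) auto
      also have "\<dots> \<le> (p ^ B) ^ k" using B N by (intro power_mono) auto
      finally show ?thesis by (simp add: q_def power_mult[symmetric] mult.commute)
    qed
    have Q: "1 \<le> Q j" "Q j \<le> q" "real_of_int (Q j) / q \<le> 1 / real N ^ j" "real_of_int q \<le> 2 * real N ^ j * Q j" if "j \<le> k" for j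
    proof -
      have nj: "int N ^ j \<ge> 1" using N by simp
      show q1: "1 \<le> Q j" unfolding Q_def using Nq[OF that] nj N zdiv_mono1[of "int N ^ j" q "int N ^ j"] by simp
      have Qq: "Q j * int N ^ j \<le> q"
        using div_mult_mod_eq[of q "int N ^ j"] pos_mod_sign[of "int N ^ j" q] nj unfolding Q_def by linarith
      have "Q j * 1 \<le> Q j * int N ^ j" using q1 nj by (intro mult_left_mono) auto
      then show "Q j \<le> q" using Qq by simp
      have "real_of_int (Q j) * real N ^ j \<le> q" using Qq by (metis of_int_le_iff of_int_mult of_int_of_nat_eq of_int_power)
      then show "real_of_int (Q j) / q \<le> 1 / real N ^ j" using q0 N by (simp add: field_simps)
      have "q < (Q j + 1) * int N ^ j"
        using div_mult_mod_eq[of q "int N ^ j"] pos_mod_bound[of "int N ^ j" q] nj unfolding Q_def distrib_right by linarith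
      also have "\<dots> \<le> (2 * Q j) * int N ^ j" using q1 nj by (intro mult_right_mono) auto
      finally have "real_of_int q \<le> real_of_int ((2 * Q j) * int N ^ j)" by (simp only: of_int_le_iff)
      then show "real_of_int q \<le> 2 * real N ^ j * Q j" by (simp add: mult_ac)
    qed
    define s where "s x j = \<lfloor>q * \<gamma> x j\<rfloor>" for x j
    define Bx where "Bx x = {c \<in> freqs k q. \<forall>j\<le>k. (c j - s x j) mod q < Q j}" for x
    have Bx_PiE: "Bx x = PiE {..k} (\<lambda>j. {v \<in> {0..<q}. (v - s x j) mod q < Q j})" for x
      unfolding Bx_def freqs_def by (auto simp: PiE_def Pi_def)
    have card_Bx: "real (card (Bx x)) = (\<Prod>j\<le>k. real_of_int (Q j))" for x
    proof -
      have "card (Bx x) = (\<Prod>j\<le>k. nat (Q j))"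
        unfolding Bx_PiE
      proof (subst card_PiE, simp, rule prod.cong[OF refl])
        fix j assume "j \<in> {..k}"
        then show "card {v \<in> {0..<q}. (v - s x j) mod q < Q j} = nat (Q j)"
          using Q(1,2)[of j] q0 by (intro card_mod_interval) auto
      qed
      also have "real \<dots> = (\<Prod>j\<le>k. real_of_int (Q j))"
        unfolding of_nat_prod
      proof (rule prod.cong[OF refl])
        fix j assume "j \<in> {..k}"
        then show "real (nat (Q j)) = real_of_int (Q j)" using Q(1)[of j] by simp
      qed
      finally show ?thesis .
    qed
    define Z where "Z = Sigma {..<N} Bx"
    have fB: "finite (Bx x)" for x unfolding Bx_def by simp
    have Zf: "finite Z" unfolding Z_def using fB by (intro finite_SigmaI) auto
    define \<psi> where "\<psi> z = poly_char k q (snd z)" for z :: "nat \<times> (nat \<Rightarrow> int)"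
    \<comment> \<open>The deviation of the real coefficient from the representative of
      \<open>c j\<close> modulo \<open>q\<close> among the \<open>q\<close> integers starting at
      \<open>s x j\<close>.\<close>
    define \<rho> where "\<rho> z j = \<gamma> (fst z) j - real_of_int (s (fst z) j + (snd z j - s (fst z) j) mod q) / q" for z :: "nat \<times> (nat \<Rightarrow> int)" and j
    have \<rho>: "\<bar>\<rho> z j\<bar> * real N ^ j \<le> 1" if z: "z \<in> Z" and j: "j < k + 1" for z j
    proof -
      define x c o' where "x = fst z" and "c = snd z" and "o' = (c j - s x j) mod q"
      have o': "0 \<le> o'" "o' < Q j" using z j q0 by (auto simp: Z_def Bx_def o'_def x_def c_def)
      have fl: "real_of_int (s x j) \<le> q * \<gamma> x j" "q * \<gamma> x j < real_of_int (s x j) + 1"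
        by (auto simp: s_def)
      have "q * \<rho> z j = q * \<gamma> x j - s x j - o'"
        using q0 by (simp add: \<rho>_def x_def c_def o'_def field_simps)
      moreover have "real_of_int o' \<le> real_of_int (Q j) - 1" using o' by linarith
      moreover have "real_of_int (Q j) \<ge> 1" using Q(1)[of j] j by simp
      ultimately have "\<bar>q * \<rho> z j\<bar> \<le> Q j" using fl o' by linarith
      then have "q * \<bar>\<rho> z j\<bar> \<le> Q j" using q0 by (simp add: abs_mult)
      then have "\<bar>\<rho> z j\<bar> \<le> real_of_int (Q j) / q" using q0 by (simp add: field_simps)
      also have "\<dots> \<le> 1 / real N ^ j" using Q(3)[of j] j by simp
      finally show ?thesis using N by (simp add: field_simps)
    qed
    have split: "a y * ee (\<Sum>j\<le>k. \<gamma> (fst z) j * real_of_int y ^ j) = a y * (\<psi> z y * ee (\<Sum>j<k + 1. \<rho> z j * real_of_int y ^ j))" for z y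
    proof -
      define x c where "x = fst z" and "c = snd z"
      have "\<psi> z y = ee (phase k (\<lambda>j. s x j + (c j - s x j) mod q) y / q)"
        unfolding \<psi>_def poly_char_def c_def[symmetric]
      proof (rule ee_cong[OF q0])
        have "(c j) mod q = (s x j + (c j - s x j) mod q) mod q" for j by (simp add: mod_simps)
        then have "(\<lambda>i\<in>{..k}. c i mod q) = (\<lambda>i\<in>{..k}. (s x i + (c i - s x i) mod q) mod q)" by simp
        then show "phase k c y mod q = phase k (\<lambda>j. s x j + (c j - s x j) mod q) y mod q"
          by (metis phase_mod)
      qed
      also have "real_of_int (phase k (\<lambda>j. s x j + (c j - s x j) mod q) y) / q =
          (\<Sum>j\<le>k. real_of_int (s x j + (c j - s x j) mod q) / q * real_of_int y ^ j)"
        by (simp add: phase_def sum_divide_distrib)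
      finally have "\<psi> z y * ee (\<Sum>j<k + 1. \<rho> z j * real_of_int y ^ j) =
         ee ((\<Sum>j\<le>k. real_of_int (s x j + (c j - s x j) mod q) / q * real_of_int y ^ j) + (\<Sum>j\<le>k. \<rho> z j * real_of_int y ^ j))"
        by (simp only: ee_add lessThan_Suc_atMost Suc_eq_plus1[symmetric])
      also have "(\<Sum>j\<le>k. real_of_int (s x j + (c j - s x j) mod q) / q * real_of_int y ^ j) + (\<Sum>j\<le>k. \<rho> z j * real_of_int y ^ j)
         = (\<Sum>j\<le>k. \<gamma> x j * real_of_int y ^ j)"
        unfolding sum.distrib[symmetric] by (intro sum.cong refl) (simp add: \<rho>_def x_def c_def algebra_simps)
      finally show ?thesis by (simp add: x_def)
    qed
    define K where "K = C * r powr (real B * (real P / 2 + \<kappa>)) * real (card (freqs k q))"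
    \<comment> \<open>Subtracting the least index \<open>x0\<close> maps the indices sharing
      \<open>c\<close> injectively into the counted set: top coefficients with a common box differ
      by at most \<open>1 / N ^ k\<close> modulo 1.\<close>
    have M_bound: "card {x. x < N \<and> c \<in> Bx x} \<le> M" for c
    proof (cases "{x. x < N \<and> c \<in> Bx x} = {}")
      case False
      define X where "X = {x. x < N \<and> c \<in> Bx x}"
      define x0 where "x0 = Min X"
      have fX: "finite X" unfolding X_def by simp
      have x0: "x0 \<in> X" unfolding x0_def using False fX by (intro Min_in) (auto simp: X_def)
      have le: "x0 \<le> x" if "x \<in> X" for x unfolding x0_def using fX that by (rule Min_le)
      have "card X = card ((\<lambda>x. x - x0) ` X)"
        by (intro card_image[symmetric] inj_onI) (use le in \<open>metis le_add_diff_inverse2\<close>)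
      also have "\<dots> \<le> M" unfolding M_def
      proof (rule card_mono)
        show "(\<lambda>x. x - x0) ` X \<subseteq> {z. z < N \<and> near_int (1 / real N ^ k) (\<mu> * real z)}"
        proof (rule image_subsetI)
          fix x assume x: "x \<in> X"
          have *: "\<exists>m o'. s x k = c k - o' + q * m \<and> 0 \<le> o' \<and> o' < Q k" if "x \<in> X" for x
          proof (intro exI conjI)
            show "s x k = c k - (c k - s x k) mod q + q * (- ((c k - s x k) div q))"
              by (simp add: algebra_simps)
          qed (use that q0 in \<open>auto simp: X_def Bx_def\<close>)
          obtain m o1 where 1: "s x k = c k - o1 + q * m" "0 \<le> o1" "o1 < Q k" using *[OF x] by blast
          obtain m' o2 where 2: "s x0 k = c k - o2 + q * m'" "0 \<le> o2" "o2 < Q k" using *[OF x0] by blast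
          have f1: "real_of_int (s x k) \<le> q * \<gamma> x k" "q * \<gamma> x k < real_of_int (s x k) + 1" by (auto simp: s_def)
          have f2: "real_of_int (s x0 k) \<le> q * \<gamma> x0 k" "q * \<gamma> x0 k < real_of_int (s x0 k) + 1" by (auto simp: s_def)
          have g: "\<gamma> x k - \<gamma> x0 k = \<mu> * real (x - x0)" using \<gamma> le[OF x] by (simp add: of_nat_diff algebra_simps)
          have e1: "real_of_int (s x k) = real_of_int (c k) - real_of_int o1 + real_of_int q * real_of_int m" using 1(1) by simp
          have e2: "real_of_int (s x0 k) = real_of_int (c k) - real_of_int o2 + real_of_int q * real_of_int m'" using 2(1) by simp
          have "q * (\<mu> * real (x - x0) - of_int (m - m')) = (q * \<gamma> x k - q * \<gamma> x0 k) - (real_of_int q * m - real_of_int q * m')"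
            unfolding g[symmetric] by (simp add: algebra_simps)
          moreover have "real_of_int o1 \<le> real_of_int (Q k) - 1" "real_of_int o2 \<le> real_of_int (Q k) - 1" using 1 2 by linarith+
          moreover have "real_of_int o1 \<ge> 0" "real_of_int o2 \<ge> 0" using 1 2 by auto
          ultimately have "\<bar>q * (\<mu> * real (x - x0) - of_int (m - m'))\<bar> \<le> Q k"
            using f1 f2 e1 e2 by linarith
          then have "q * \<bar>\<mu> * real (x - x0) - of_int (m - m')\<bar> \<le> Q k" using q0 by (simp add: abs_mult)
          then have "\<bar>\<mu> * real (x - x0) - of_int (m - m')\<bar> \<le> real_of_int (Q k) / q" using q0 by (simp add: field_simps)
          also have "\<dots> \<le> 1 / real N ^ k" using Q(3)[of k] by simp
          finally have "near_int (1 / real N ^ k) (\<mu> * real (x - x0))" unfolding near_int_def by blast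
          then show "x - x0 \<in> {z. z < N \<and> near_int (1 / real N ^ k) (\<mu> * real z)}" using x by (auto simp: X_def)
        qed
      qed simp
      finally show ?thesis by (simp add: X_def)
    next
      case True
      then show ?thesis by (simp only: card.empty)
    qed
    have bound: "(\<Sum>z\<in>Z. norm (expsum A b (\<psi> z)) ^ P) \<le> M * K" if b: "\<forall>y\<in>A. norm (b y) \<le> 1" for b
    proof -
      have "(\<Sum>z\<in>Z. norm (expsum A b (\<psi> z)) ^ P) = (\<Sum>x<N. \<Sum>c\<in>Bx x. norm (expsum A b (poly_char k q c)) ^ P)"
        unfolding Z_def by (subst sum.Sigma) (auto simp: fB \<psi>_def case_prod_beta)
      also have "\<dots> = (\<Sum>x<N. \<Sum>c\<in>freqs k q. if c \<in> Bx x then norm (expsum A b (poly_char k q c)) ^ P else 0)"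
      proof (rule sum.cong[OF refl])
        fix x
        have "{c \<in> freqs k q. c \<in> Bx x} = Bx x" by (auto simp: Bx_def)
        moreover have "(\<Sum>c\<in>{c \<in> freqs k q. c \<in> Bx x}. norm (expsum A b (poly_char k q c)) ^ P) =
            (\<Sum>c\<in>freqs k q. if c \<in> Bx x then norm (expsum A b (poly_char k q c)) ^ P else 0)"
          by (rule sum.inter_filter[OF finite_freqs])
        ultimately show "(\<Sum>c\<in>Bx x. norm (expsum A b (poly_char k q c)) ^ P) = (\<Sum>c\<in>freqs k q. if c \<in> Bx x then norm (expsum A b (poly_char k q c)) ^ P else 0)"
          by (simp only:)
      qed
      also have "\<dots> = (\<Sum>c\<in>freqs k q. \<Sum>x<N. if c \<in> Bx x then norm (expsum A b (poly_char k q c)) ^ P else 0)"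
        by (rule sum.swap)
      also have "\<dots> = (\<Sum>c\<in>freqs k q. real (card {x. x < N \<and> c \<in> Bx x}) * norm (expsum A b (poly_char k q c)) ^ P)"
      proof (intro sum.cong refl)
        fix c
        have "(\<Sum>x<N. if c \<in> Bx x then norm (expsum A b (poly_char k q c)) ^ P else 0) = (\<Sum>x | x \<in> {..<N} \<and> c \<in> Bx x. norm (expsum A b (poly_char k q c)) ^ P)"
          by (rule sum.inter_filter[OF finite_lessThan, symmetric])
        then show "(\<Sum>x<N. if c \<in> Bx x then norm (expsum A b (poly_char k q c)) ^ P else 0) = real (card {x. x < N \<and> c \<in> Bx x}) * norm (expsum A b (poly_char k q c)) ^ P"
          by simp
      qed
      also have "\<dots> \<le> (\<Sum>c\<in>freqs k q. real M * norm (expsum A b (poly_char k q c)) ^ P)"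
        by (intro sum_mono mult_right_mono) (use M_bound in auto)
      also have "\<dots> = M * (\<Sum>c\<in>freqs k q. norm (expsum A b (poly_char k q c)) ^ P)"
        by (simp add: sum_distrib_left)
      also have "\<dots> \<le> M * K"
        unfolding K_def q_def
      proof (intro mult_left_mono C(2))
        show "inj_on (\<lambda>n. n mod p ^ B) A"
        proof (rule inj_onI)
          fix n n' assume n: "n \<in> A" "n' \<in> A" "n mod p ^ B = n' mod p ^ B"
          then have "p ^ B dvd n - n'" by (simp add: mod_eq_dvd_iff)
          moreover have "\<bar>n - n'\<bar> < p ^ B" using n B by (auto simp: A_def)
          ultimately show "n = n'" using zdvd_not_zless[of "\<bar>n - n'\<bar>" "p ^ B"] by (cases "n = n'") auto
        qed
      qed (use A b in auto)
      finally show ?thesis .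
    qed
    have "(\<Sum>z\<in>Z. norm (expsum A a (\<lambda>y. \<psi> z y * ee (\<Sum>j<k + 1. \<rho> z j * real_of_int y ^ j))) ^ P) \<le> E * (M * K)"
      unfolding E_def by (rule taylor_weights_multi[OF Zf A(1) A(2) _ P \<rho> bound]) (use N a in auto)
    also have "(\<Sum>z\<in>Z. norm (expsum A a (\<lambda>y. \<psi> z y * ee (\<Sum>j<k + 1. \<rho> z j * real_of_int y ^ j))) ^ P) =
       (\<Sum>z\<in>Z. norm (\<Sum>y\<in>A. a y * ee (\<Sum>j\<le>k. \<gamma> (fst z) j * real_of_int y ^ j)) ^ P)"
      unfolding expsum_def by (simp only: split)
    also have "\<dots> = (\<Sum>x<N. \<Sum>c\<in>Bx x. norm (\<Sum>y\<in>A. a y * ee (\<Sum>j\<le>k. \<gamma> x j * real_of_int y ^ j)) ^ P)"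
      unfolding Z_def by (subst sum.Sigma) (auto simp: fB case_prod_beta)
    also have "\<dots> = (\<Prod>j\<le>k. real_of_int (Q j)) * (\<Sum>x<N. norm (\<Sum>y\<in>A. a y * ee (\<Sum>j\<le>k. \<gamma> x j * real_of_int y ^ j)) ^ P)"
      by (simp add: card_Bx sum_distrib_left)
    finally have fin: "(\<Prod>j\<le>k. real_of_int (Q j)) * (\<Sum>x<N. norm (\<Sum>y\<in>A. a y * ee (\<Sum>j\<le>k. \<gamma> x j * real_of_int y ^ j)) ^ P) \<le> E * (M * K)" .
    define L where "L = (\<Sum>x<N. norm (\<Sum>y\<in>A. a y * ee (\<Sum>j\<le>k. \<gamma> x j * real_of_int y ^ j)) ^ P)"
    have L0: "L \<ge> 0" unfolding L_def by (intro sum_nonneg) auto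
    \<comment> \<open>Dividing by the volume of a box costs \<open>N\<close> to the power
      \<open>k' = P / 2\<close>; together with the exponent \<open>P / 2\<close> of the mean value
      this gives \<open>P\<close>.\<close>
    have "real_of_int q ^ (k + 1) \<le> (\<Prod>j\<le>k. 2 * real N ^ j * real_of_int (Q j))"
    proof -
      have "real_of_int q ^ (k + 1) = (\<Prod>j\<le>k. real_of_int q)" by simp
      also have "\<dots> \<le> (\<Prod>j\<le>k. 2 * real N ^ j * real_of_int (Q j))"
        by (intro prod_mono) (use Q(4) q0 in auto)
      finally show ?thesis .
    qed
    also have "\<dots> = 2 ^ (k + 1) * real N ^ k' * (\<Prod>j\<le>k. real_of_int (Q j))"
      by (simp add: prod.distrib power_sum k'_def)
    finally have "real_of_int q ^ (k + 1) * L \<le> 2 ^ (k + 1) * real N ^ k' * ((\<Prod>j\<le>k. real_of_int (Q j)) * L)"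
      using L0 by (simp add: mult_right_mono mult.assoc[symmetric])
    also have "\<dots> \<le> 2 ^ (k + 1) * real N ^ k' * (E * (M * K))"
      using fin by (intro mult_left_mono) (auto simp: L_def)
    also have "real (card (freqs k q)) = real_of_int q ^ (k + 1)"
      using q0 by (simp add: card_freqs)
    then have "K = C * r powr (real B * (real P / 2 + \<kappa>)) * real_of_int q ^ (k + 1)" by (simp add: K_def)
    finally have "real_of_int q ^ (k + 1) * L \<le> real_of_int q ^ (k + 1) * (2 ^ (k + 1) * real N ^ k' * (E * (M * (C * r powr (real B * (real P / 2 + \<kappa>))))))"
      by (simp add: mult_ac)
    then have "L \<le> 2 ^ (k + 1) * real N ^ k' * (E * (M * (C * r powr (real B * (real P / 2 + \<kappa>)))))"
      using q0 by (subst (asm) mult_le_cancel_left_pos) auto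
    also have "\<dots> = (E * C * 2 ^ (k + 1)) * (real N ^ k' * r powr (real B * (real P / 2 + \<kappa>))) * M" by (simp add: mult_ac)
    also have "\<dots> \<le> (E * C * 2 ^ (k + 1)) * ((2 * r) powr (real P / 2 + \<kappa>) * real N powr (real P + \<kappa>)) * M"
    proof (intro mult_right_mono mult_left_mono)
      have "r powr (real B * (real P / 2 + \<kappa>)) = (r ^ B) powr (real P / 2 + \<kappa>)"
        using r by (simp add: powr_realpow[symmetric] powr_powr)
      also have "\<dots> \<le> (2 * r * real N) powr (real P / 2 + \<kappa>)"
      proof (rule powr_mono2)
        have "real_of_int (p ^ B) \<le> real_of_int (p * (2 * int N))" using B(2) by (simp only: of_int_le_iff)
        then show "r ^ B \<le> 2 * r * real N" by (simp add: r_def mult_ac)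
      qed (use \<kappa> r in auto)
      also have "\<dots> = (2 * r) powr (real P / 2 + \<kappa>) * real N powr (real P / 2 + \<kappa>)"
        using r by (simp add: powr_mult)
      finally have "real N ^ k' * r powr (real B * (real P / 2 + \<kappa>)) \<le> real N ^ k' * ((2 * r) powr (real P / 2 + \<kappa>) * real N powr (real P / 2 + \<kappa>))"
        by (intro mult_left_mono) auto
      also have Nk: "real N ^ k' = real N powr (real P / 2)" using N by (simp add: Pk powr_realpow)
      also have "real N powr (real P / 2) * ((2 * r) powr (real P / 2 + \<kappa>) * real N powr (real P / 2 + \<kappa>)) =
         (2 * r) powr (real P / 2 + \<kappa>) * real N powr (real P + \<kappa>)"
        by (simp add: powr_add[symmetric] mult_ac)
      finally show "real N ^ k' * r powr (real B * (real P / 2 + \<kappa>)) \<le> (2 * r) powr (real P / 2 + \<kappa>) * real N powr (real P + \<kappa>)" unfolding Nk .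
    qed (use E C in auto)
    finally show ?thesis by (simp add: L_def A_def C'_def M_def mult_ac)
  qed
  show ?thesis using C' main unfolding P_def by blast
qed

section \<open>Counting and binary digits\<close>

lemma card_int_interval:
  fixes X :: "int set" and u v :: real
  assumes "\<And>x. x \<in> X \<Longrightarrow> u \<le> of_int x \<and> of_int x \<le> v" "u \<le> v"
  shows "finite X \<and> real (card X) \<le> v - u + 1"
proof -
  have sub: "X \<subseteq> {\<lceil>u\<rceil>..\<lfloor>v\<rfloor>}"
    using assms(1) by (auto simp: ceiling_le_iff le_floor_iff)
  have "card X \<le> card {\<lceil>u\<rceil>..\<lfloor>v\<rfloor>}" by (intro card_mono sub) auto
  also have "\<dots> = nat (\<lfloor>v\<rfloor> - \<lceil>u\<rceil> + 1)" by simp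
  finally have "real (card X) \<le> real (nat (\<lfloor>v\<rfloor> - \<lceil>u\<rceil> + 1))" by simp
  also have "\<dots> \<le> max 0 (real_of_int (\<lfloor>v\<rfloor> - \<lceil>u\<rceil> + 1))" by (simp add: of_nat_nat max_def)
  also have "\<dots> \<le> v - u + 1"
  proof -
    have "real_of_int (\<lfloor>v\<rfloor> - \<lceil>u\<rceil> + 1) \<le> v - u + 1"
      using of_int_floor_le[of v] le_of_int_ceiling[of u] by linarith
    then show ?thesis using assms(2) by simp
  qed
  finally show ?thesis using finite_subset[OF sub] by simp
qed

text \<open>The integer \<open>a * j - q * m j\<close> determines \<open>j\<close>, because
  \<open>a\<close> is invertible modulo \<open>q\<close>. It lies in an interval of length
  \<open>2 * (q * \<delta> + 1)\<close>: \<open>q * \<delta>\<close> comes from nearness, 1 from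
  replacing \<open>\<alpha>\<close> by \<open>a / q\<close> along a block of length
  \<open>q\<close>.\<close>

lemma near_int_block:
  fixes a :: int and q y0 :: nat and \<alpha> \<delta> :: real
  assumes q: "q \<ge> 1" "coprime a (int q)" and \<alpha>: "\<bar>\<alpha> - a / q\<bar> < 1 / q ^ 2" and \<delta>: "\<delta> \<ge> 0"
  shows "real (card {j. j < q \<and> near_int \<delta> (\<alpha> * real (y0 + j))}) \<le> 2 * real q * \<delta> + 3"
proof -
  define J where "J = {j. j < q \<and> near_int \<delta> (\<alpha> * real (y0 + j))}"
  define m where "m j = (SOME m::int. \<bar>\<alpha> * real (y0 + j) - of_int m\<bar> \<le> \<delta>)" for j
  have m: "\<bar>\<alpha> * real (y0 + j) - of_int (m j)\<bar> \<le> \<delta>" if "j \<in> J" for j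
    unfolding m_def by (rule someI_ex) (use that in \<open>auto simp: J_def near_int_def\<close>)
  define v where "v j = a * int j - int q * m j" for j
  have inj: "inj_on v J"
  proof (rule inj_onI)
    fix i j assume ij: "i \<in> J" "j \<in> J" "v i = v j"
    then have "a * (int i - int j) = int q * (m i - m j)" by (simp add: v_def algebra_simps)
    then have "int q dvd a * (int i - int j)" by simp
    then have "int q dvd int i - int j" using q(2) by (simp add: coprime_dvd_mult_right_iff coprime_commute)
    then have "int i mod int q = int j mod int q" by (simp add: mod_eq_dvd_iff)
    then show "i = j" using ij by (simp add: J_def)
  qed
  define c where "c = - (real q * \<alpha> * real y0)"
  have "c - (real q * \<delta> + 1) \<le> of_int x \<and> of_int x \<le> c + (real q * \<delta> + 1)" if x: "x \<in> v ` J" for x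
  proof -
    obtain j where j: "j \<in> J" "x = v j" using x by auto
    have jq: "real j \<le> real q" using j by (simp add: J_def)
    have "of_int (v j) - c = real q * (\<alpha> * real (y0 + j) - of_int (m j)) + real q * (a / q - \<alpha>) * real j"
      using q(1) by (simp add: v_def c_def field_simps)
    then have "\<bar>of_int (v j) - c\<bar> \<le> \<bar>real q * (\<alpha> * real (y0 + j) - of_int (m j))\<bar> + \<bar>real q * (a / q - \<alpha>) * real j\<bar>"
      by (simp only: abs_triangle_ineq)
    also have "\<bar>real q * (\<alpha> * real (y0 + j) - of_int (m j))\<bar> \<le> real q * \<delta>"
      using m[OF j(1)] by (simp add: abs_mult mult_left_mono)
    also have "\<bar>real q * (a / q - \<alpha>) * real j\<bar> \<le> 1"
    proof -
      have "\<bar>real q * (a / q - \<alpha>) * real j\<bar> = real q * \<bar>\<alpha> - a / q\<bar> * real j" by (simp add: abs_mult abs_minus_commute)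
      also have "\<dots> \<le> real q * (1 / q ^ 2) * real q" using \<alpha> jq by (intro mult_mono mult_left_mono) auto
      also have "\<dots> = 1" using q(1) by (simp add: power2_eq_square)
      finally show ?thesis .
    qed
    finally show ?thesis using j(2) by (simp add: abs_le_iff)
  qed
  then have "finite (v ` J) \<and> real (card (v ` J)) \<le> (c + (real q * \<delta> + 1)) - (c - (real q * \<delta> + 1)) + 1"
    by (rule card_int_interval) (use \<delta> in auto)
  then show ?thesis using card_image[OF inj] by (simp add: J_def mult_ac)
qed

lemma near_int_count:
  fixes a :: int and q Y :: nat and \<alpha> \<delta> :: real
  assumes q: "q \<ge> 1" "coprime a (int q)" and \<alpha>: "\<bar>\<alpha> - a / q\<bar> < 1 / q ^ 2" and \<delta>: "\<delta> \<ge> 0"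
  shows "real (card {y. y < Y \<and> near_int \<delta> (\<alpha> * real y)}) \<le> (real Y / q + 1) * (2 * real q * \<delta> + 3)"
proof -
  define Bk where "Bk i = (\<lambda>j. q * i + j) ` {j. j < q \<and> near_int \<delta> (\<alpha> * real (q * i + j))}" for i
  have sub: "{y. y < Y \<and> near_int \<delta> (\<alpha> * real y)} \<subseteq> (\<Union>i\<in>{..<Y div q + 1}. Bk i)"
  proof
    fix y assume y: "y \<in> {y. y < Y \<and> near_int \<delta> (\<alpha> * real y)}"
    have e: "q * (y div q) + y mod q = y" by simp
    have "y mod q < q" using q by simp
    then have "y mod q \<in> {j. j < q \<and> near_int \<delta> (\<alpha> * real (q * (y div q) + j))}"
      using y by (simp only: mem_Collect_eq e)
    then have "y \<in> Bk (y div q)" unfolding Bk_def using e[symmetric] by (rule image_eqI[rotated])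
    moreover have "y div q \<in> {..<Y div q + 1}" using y by (simp add: div_le_mono less_Suc_eq_le)
    ultimately show "y \<in> (\<Union>i\<in>{..<Y div q + 1}. Bk i)" by blast
  qed
  have "card {y. y < Y \<and> near_int \<delta> (\<alpha> * real y)} \<le> card (\<Union>i\<in>{..<Y div q + 1}. Bk i)"
    by (intro card_mono sub) (auto simp: Bk_def)
  also have "\<dots> \<le> (\<Sum>i<Y div q + 1. card (Bk i))" by (rule card_UN_le) simp
  finally have "real (card {y. y < Y \<and> near_int \<delta> (\<alpha> * real y)}) \<le> (\<Sum>i<Y div q + 1. real (card (Bk i)))"
    by (simp flip: of_nat_sum)
  also have "\<dots> \<le> (\<Sum>i<Y div q + 1. 2 * real q * \<delta> + 3)"
  proof (rule sum_mono)
    fix i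
    have "card (Bk i) \<le> card {j. j < q \<and> near_int \<delta> (\<alpha> * real (q * i + j))}" unfolding Bk_def by (rule card_image_le) simp
    then show "real (card (Bk i)) \<le> 2 * real q * \<delta> + 3" using near_int_block[OF q \<alpha> \<delta>, of "q * i"] by linarith
  qed
  also have "\<dots> = (real (Y div q) + 1) * (2 * real q * \<delta> + 3)" by (simp add: algebra_simps)
  also have "\<dots> \<le> (real Y / q + 1) * (2 * real q * \<delta> + 3)"
    using \<delta> of_nat_div_le_of_nat[of Y q] by (intro mult_right_mono) auto
  finally show ?thesis .
qed

lemma near_int_minus: "near_int \<delta> (- x) = near_int \<delta> x"
proof -
  have "near_int \<delta> (- x)" if near: "near_int \<delta> x" for x
  proof -
    obtain m :: int where "\<bar>x - of_int m\<bar> \<le> \<delta>" using near unfolding near_int_def by blast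
    then have "\<bar>- x - of_int (- m)\<bar> \<le> \<delta>" by simp
    then show ?thesis unfolding near_int_def by blast
  qed
  from this[of x] this[of "- x"] show ?thesis by auto
qed

text \<open>Counting among all integers below \<open>g * N\<close> avoids a rational approximation
  to \<open>\<alpha> * g\<close>, whose denominator may shrink by a common factor of
  \<open>g\<close> and \<open>q\<close>.\<close>

lemma near_int_count_multiples:
  fixes a :: int and q N g :: nat and \<alpha> \<delta> :: real
  assumes q: "q \<ge> 1" "coprime a (int q)" and \<alpha>: "\<bar>\<alpha> - a / q\<bar> < 1 / q ^ 2" and \<delta>: "\<delta> \<ge> 0"
    and g: "g \<ge> 1" and \<mu>: "\<mu> = \<alpha> * real g \<or> \<mu> = - (\<alpha> * real g)"
  shows "real (card {z. z < N \<and> near_int \<delta> (\<mu> * real z)}) \<le> (real (g * N) / q + 1) * (2 * real q * \<delta> + 3)"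
proof -
  have n: "near_int \<delta> (\<mu> * real z) = near_int \<delta> (\<alpha> * real (g * z))" for z
    using \<mu> near_int_minus[of \<delta> "\<alpha> * real (g * z)"] by (auto simp: mult_ac)
  have "card {z. z < N \<and> near_int \<delta> (\<mu> * real z)} = card ((\<lambda>z. g * z) ` {z. z < N \<and> near_int \<delta> (\<mu> * real z)})"
    using g by (intro card_image[symmetric] inj_onI) auto
  also have "\<dots> \<le> card {y. y < g * N \<and> near_int \<delta> (\<alpha> * real y)}"
    using g by (intro card_mono) (auto simp: n)
  finally show ?thesis using near_int_count[OF q \<alpha> \<delta>, of "g * N"] by linarith
qed

text \<open>The coefficient of \<open>y ^ j\<close> in \<open>f (x + y)\<close>; where \<open>i - j\<close> truncates, the binomial coefficient vanishes.\<close>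

definition shiftc :: "real poly \<Rightarrow> nat \<Rightarrow> real \<Rightarrow> nat \<Rightarrow> real" where
  "shiftc f D x j = (\<Sum>i\<le>D. coeff f i * real (i choose j) * x ^ (i - j))"

lemma poly_shiftc:
  assumes "degree f \<le> D"
  shows "poly f (x + y) = (\<Sum>j\<le>D. shiftc f D x j * y ^ j)"
proof -
  have "poly f (x + y) = (\<Sum>i\<le>D. coeff f i * (x + y) ^ i)"
    unfolding poly_altdef by (rule sum.mono_neutral_left) (use assms in \<open>auto simp: coeff_eq_0\<close>)
  also have "\<dots> = (\<Sum>i\<le>D. \<Sum>j\<le>D. coeff f i * real (i choose j) * x ^ (i - j) * y ^ j)"
  proof (intro sum.cong refl)
    fix i assume i: "i \<in> {..D}"
    have "coeff f i * (x + y) ^ i = (\<Sum>j\<le>i. coeff f i * real (i choose j) * x ^ (i - j) * y ^ j)"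
      using binomial_ring[of y x i] by (simp add: sum_distrib_left mult_ac add.commute)
    also have "\<dots> = (\<Sum>j\<le>D. coeff f i * real (i choose j) * x ^ (i - j) * y ^ j)"
      by (rule sum.mono_neutral_left) (use i in \<open>auto simp: binomial_eq_0\<close>)
    finally show "coeff f i * (x + y) ^ i = (\<Sum>j\<le>D. coeff f i * real (i choose j) * x ^ (i - j) * y ^ j)" .
  qed
  also have "\<dots> = (\<Sum>j\<le>D. shiftc f D x j * y ^ j)"
    unfolding shiftc_def sum_distrib_right by (rule sum.swap)
  finally show ?thesis .
qed

lemma shiftc_top: "shiftc f D x D = coeff f D"
proof -
  have "shiftc f D x D = (\<Sum>i\<in>{D}. coeff f i * real (i choose D) * x ^ (i - D))"
    unfolding shiftc_def by (rule sum.mono_neutral_right) (auto simp: binomial_eq_0)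
  then show ?thesis by simp
qed

text \<open>The coefficient below the top is affine in the shift, which is the arithmetic
  progression that \<open>weyl_mean\<close> needs.\<close>

lemma shiftc_next: "shiftc f (Suc D) x D = real (Suc D) * coeff f (Suc D) * x + coeff f D"
proof -
  have "shiftc f (Suc D) x D = (\<Sum>i\<in>{D, Suc D}. coeff f i * real (i choose D) * x ^ (i - D))"
    unfolding shiftc_def by (rule sum.mono_neutral_right) (auto simp: binomial_eq_0)
  then show ?thesis by (simp add: Suc_times_binomial algebra_simps)
qed

section \<open>Binary digit sums\<close>

lemma digit_sum_0 [simp]: "binary_digit_sum 0 = 0"
  by (subst binary_digit_sum.simps) simp

lemma digit_sum_rec: "binary_digit_sum n = n mod 2 + binary_digit_sum (n div 2)"
proof (cases "n = 0")
  case False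
  then show ?thesis by (subst binary_digit_sum.simps) simp
qed simp

lemma digit_sum_split: "u < 2 ^ w \<Longrightarrow> binary_digit_sum (u + 2 ^ w * v) = binary_digit_sum u + binary_digit_sum v"
proof (induction w arbitrary: u)
  case 0
  then show ?case by simp
next
  case (Suc w)
  have e: "u + 2 ^ Suc w * v = u + 2 * (2 ^ w * v)" by simp
  have "(u + 2 ^ Suc w * v) div 2 = u div 2 + 2 ^ w * v" "(u + 2 ^ Suc w * v) mod 2 = u mod 2"
    unfolding e by simp_all
  moreover have "u div 2 < 2 ^ w" using Suc.prems by (simp add: less_mult_imp_div_less)
  ultimately have "binary_digit_sum (u + 2 ^ Suc w * v) = u mod 2 + (binary_digit_sum (u div 2) + binary_digit_sum v)"
    using Suc.IH[of "u div 2"] by (subst digit_sum_rec) simp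
  moreover have "binary_digit_sum u = u mod 2 + binary_digit_sum (u div 2)" by (rule digit_sum_rec)
  ultimately show ?case by simp
qed

lemma digit_sum_le: "u < 2 ^ w \<Longrightarrow> binary_digit_sum u \<le> w"
proof (induction w arbitrary: u)
  case 0
  then show ?case by simp
next
  case (Suc w)
  have "u div 2 < 2 ^ w" using Suc.prems by (simp add: less_mult_imp_div_less)
  from Suc.IH[OF this] show ?case by (subst digit_sum_rec) linarith
qed

lemma finite_digit_sum_set [simp]: "finite (digit_sum_set s r)"
  by (rule finite_subset[of _ "{..<2 ^ r}"]) (auto simp: digit_sum_set_def)

lemma card_digit_sum_set: "card (digit_sum_set s r) = r choose s"
proof (induction r arbitrary: s)
  case 0
  have "digit_sum_set s 0 = (if s = 0 then {0} else {})"
    by (auto simp: digit_sum_set_def)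
  then show ?case by (cases s) auto
next
  case (Suc r)
  have b2: "binary_digit_sum (2 * v) = binary_digit_sum v" "binary_digit_sum (2 * v + 1) = Suc (binary_digit_sum v)" for v
    using digit_sum_rec[of "2 * v"] digit_sum_rec[of "2 * v + 1"] by simp_all
  have par: "(\<exists>v. n = 2 * v) \<or> (\<exists>v. n = 2 * v + 1)" for n :: nat by presburger
  have dec: "digit_sum_set s (Suc r) = (\<lambda>v. 2 * v) ` digit_sum_set s r \<union>
     (\<lambda>v. 2 * v + 1) ` {v. v < 2 ^ r \<and> Suc (binary_digit_sum v) = s}"
  proof (intro equalityI subsetI)
    fix n assume n: "n \<in> digit_sum_set s (Suc r)"
    consider v where "n = 2 * v" | v where "n = 2 * v + 1" using par[of n] by blast
    then show "n \<in> (\<lambda>v. 2 * v) ` digit_sum_set s r \<union> (\<lambda>v. 2 * v + 1) ` {v. v < 2 ^ r \<and> Suc (binary_digit_sum v) = s}"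
    proof cases
      case (1 v)
      then have "v \<in> digit_sum_set s r" using n b2(1)[of v] by (simp add: digit_sum_set_def)
      then show ?thesis using 1 by blast
    next
      case (2 v)
      then have "v < 2 ^ r \<and> Suc (binary_digit_sum v) = s"
        using n b2(2)[of v] unfolding digit_sum_set_def by (auto simp del: Suc_eq_plus1 simp: power_Suc)
      then show ?thesis using 2 by blast
    qed
  next
    fix n assume "n \<in> (\<lambda>v. 2 * v) ` digit_sum_set s r \<union> (\<lambda>v. 2 * v + 1) ` {v. v < 2 ^ r \<and> Suc (binary_digit_sum v) = s}"
    then consider v where "n = 2 * v" "v \<in> digit_sum_set s r" | v where "n = 2 * v + 1" "v < 2 ^ r" "Suc (binary_digit_sum v) = s" by blast
    then show "n \<in> digit_sum_set s (Suc r)"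
    proof cases
      case (1 v)
      then show ?thesis using b2(1)[of v] by (simp add: digit_sum_set_def)
    next
      case (2 v)
      then show ?thesis using b2(2)[of v] by (simp add: digit_sum_set_def)
    qed
  qed
  have "card (digit_sum_set s (Suc r)) = card ((\<lambda>v. 2 * v) ` digit_sum_set s r) + card ((\<lambda>v. 2 * v + 1) ` {v. v < 2 ^ r \<and> Suc (binary_digit_sum v) = s})"
    unfolding dec
  proof (rule card_Un_disjoint)
    show "(\<lambda>v. 2 * v) ` digit_sum_set s r \<inter> (\<lambda>v. 2 * v + 1) ` {v. v < 2 ^ r \<and> Suc (binary_digit_sum v) = s} = {}"
    proof (rule equals0I)
      fix n assume "n \<in> (\<lambda>v. 2 * v) ` digit_sum_set s r \<inter> (\<lambda>v. 2 * v + 1) ` {v. v < 2 ^ r \<and> Suc (binary_digit_sum v) = s}"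
      then obtain v v' where "n = 2 * v" "n = 2 * v' + 1" by blast
      then show False by presburger
    qed
  qed simp_all
  also have "\<dots> = card (digit_sum_set s r) + card {v. v < 2 ^ r \<and> Suc (binary_digit_sum v) = s}"
    by (intro arg_cong2[where f = "(+)"] card_image inj_onI) simp_all
  also have "\<dots> = Suc r choose s"
  proof (cases s)
    case 0
    then show ?thesis using Suc by simp
  next
    case (Suc s')
    then have "{v. v < 2 ^ r \<and> Suc (binary_digit_sum v) = s} = digit_sum_set s' r" by (auto simp: digit_sum_set_def)
    then show ?thesis using Suc.IH Suc by simp
  qed
  finally show ?case .
qed

section \<open>Sums over integers with a given digit sum\<close>

abbreviation diff_weyl_sum :: "real poly \<Rightarrow> nat \<Rightarrow> nat \<Rightarrow> nat \<Rightarrow> nat \<Rightarrow> nat \<Rightarrow> real" where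
  "diff_weyl_sum f l W N u1 u2 \<equiv> (\<Sum>x<N. norm (\<Sum>y\<in>{- int N..<int N}.
     ee (real l * poly f (real u1 + real W * (real x + real_of_int y)) - real l * poly f (real u2 + real W * (real x + real_of_int y)))))"

text \<open>A power mean reduces the sum over the shifts \<open>x\<close> to
  \<open>weyl_mean\<close> in dimension \<open>d - 2\<close>. Each of the four size conditions
  bounds one product in \<open>(G * N / q + 1) * (2 * q / N ^ (d - 2) + 3)\<close>, so the count is
  at most a constant times \<open>N / W ^ P\<close>, and the \<open>P\<close>-th root saves
  \<open>W\<close>.\<close>

lemma offdiagonal_bound:
  assumes d: "d \<ge> 3" and \<kappa>: "\<kappa> > 0"
  shows "\<exists>C>0. \<forall>f a (q::nat) (W::nat) (N::nat) (l::nat) u1 u2. degree f \<le> d \<longrightarrow> q \<ge> 1 \<longrightarrow> coprime a (int q) \<longrightarrow>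
     \<bar>coeff f d - real_of_int a / q\<bar> < 1 / q ^ 2 \<longrightarrow> l \<ge> 1 \<longrightarrow> N \<ge> 1 \<longrightarrow> u1 \<noteq> u2 \<longrightarrow> u1 < W \<longrightarrow> u2 < W \<longrightarrow>
     real W ^ vexp (d - 2) \<le> N \<longrightarrow> real l * real W ^ d * real W ^ vexp (d - 2) \<le> q \<longrightarrow>
     real l * real W ^ d * real W ^ vexp (d - 2) \<le> real N ^ (d - 2) \<longrightarrow>
     real q * real W ^ vexp (d - 2) \<le> real N ^ (d - 1) \<longrightarrow>
     diff_weyl_sum f l W N u1 u2
       \<le> C * real N * (real N / real W) * real N powr \<kappa>"
proof -
  define k where "k = d - 2"
  define m where "m = d - 1"
  have km: "m = Suc k" "d = Suc m" "k \<ge> 1" using d by (auto simp: k_def m_def)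
  define P where "P = vexp k"
  have P: "P \<ge> 1" using vexp_ge_2[of k] km by (simp add: P_def)
  \<comment> \<open>The \<open>P\<close>-th root at the end divides the exponent by \<open>P\<close>
    again.\<close>
  define \<kappa>' where "\<kappa>' = \<kappa> * real P"
  have \<kappa>': "\<kappa>' > 0" using \<kappa> P by (simp add: \<kappa>'_def)
  obtain C1 where C1: "C1 > 0" "\<And>(N::nat) a (\<gamma> :: nat \<Rightarrow> nat \<Rightarrow> real) \<mu> \<nu>. N \<ge> 1 \<Longrightarrow>
     (\<forall>y. norm (a y) \<le> 1) \<Longrightarrow> (\<forall>x. \<gamma> x k = \<mu> * real x + \<nu>) \<Longrightarrow>
     (\<Sum>x<N. norm (\<Sum>y\<in>{- int N..<int N}. a y * ee (\<Sum>j\<le>k. \<gamma> x j * real_of_int y ^ j)) ^ P)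
       \<le> C1 * real N powr (real P + \<kappa>') * real (card {z. z < N \<and> near_int (1 / real N ^ k) (\<mu> * real z)})"
    using weyl_mean[OF km(3) \<kappa>'] unfolding P_def by blast
  \<comment> \<open>The coefficients \<open>2 + 3\<close> of the two products containing
    \<open>G\<close>, times \<open>m * d\<close>, and \<open>2 + 3\<close> for the other
    two.\<close>
  define c0 where "c0 = 5 * real m * real d + 5"
  define C2 where "C2 = max 1 (C1 * c0)"
  have main: "diff_weyl_sum f l W N u1 u2
       \<le> C2 * real N * (real N / real W) * real N powr \<kappa>"
    if f: "degree f \<le> d" and q: "q \<ge> 1" "coprime a (int q)" "\<bar>coeff f d - real_of_int a / q\<bar> < 1 / q ^ 2"
      and l: "l \<ge> 1" and N: "N \<ge> 1" and u: "u1 \<noteq> u2" "u1 < W" "u2 < W"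
      and A: "real W ^ P \<le> N" "real l * real W ^ d * real W ^ P \<le> q"
        "real l * real W ^ d * real W ^ P \<le> real N ^ k" "real q * real W ^ P \<le> real N ^ m"
    for f a and q W N l u1 u2 :: nat
  proof -
    have W: "W \<ge> 1" using u by simp
    define g where "g j = real l * real W ^ j * (shiftc f d (real u1) j - shiftc f d (real u2) j)" for j
    define gp where "gp = (\<Sum>j\<le>m. monom (g j) j)"
    have degp: "degree gp \<le> m" unfolding gp_def
      by (intro degree_sum_le) (auto intro: order_trans[OF degree_monom_le])
    have cgp: "coeff gp j = (if j \<le> m then g j else 0)" for j
      unfolding gp_def by (simp add: coeff_sum if_distrib sum.delta)
    have pgp: "poly gp v = real l * poly f (real u1 + real W * v) - real l * poly f (real u2 + real W * v)" for v
    proof -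
      have "real l * poly f (real u1 + real W * v) - real l * poly f (real u2 + real W * v) =
         (\<Sum>j\<le>d. real l * (shiftc f d u1 j - shiftc f d u2 j) * (real W * v) ^ j)"
        unfolding poly_shiftc[OF f] by (simp add: sum_distrib_left sum_subtractf algebra_simps)
      also have "\<dots> = (\<Sum>j\<le>m. real l * (shiftc f d u1 j - shiftc f d u2 j) * (real W * v) ^ j)"
        unfolding km(2) by (simp add: shiftc_top)
      also have "\<dots> = poly gp v"
        unfolding gp_def poly_sum poly_monom g_def by (intro sum.cong refl) (simp add: power_mult_distrib)
      finally show ?thesis by simp
    qed
    define \<gamma> where "\<gamma> x j = shiftc gp m (real x) j" for x :: nat and j
    define \<mu> where "\<mu> = real m * g m"
    have \<gamma>k: "\<forall>x. \<gamma> x k = \<mu> * real x + g k"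
      unfolding \<gamma>_def km(1) shiftc_next cgp by (simp add: \<mu>_def km(1) cgp)
    \<comment> \<open>The top coefficient of a shifted polynomial does not depend on the shift, so
      the term of degree \<open>m\<close> becomes a weight and only degree \<open>k\<close> is
      left.\<close>
    define aa where "aa y = ee (g m * real_of_int y ^ m)" for y :: int
    have split: "ee (real l * poly f (real u1 + real W * (real x + real_of_int y)) - real l * poly f (real u2 + real W * (real x + real_of_int y)))
        = aa y * ee (\<Sum>j\<le>k. \<gamma> x j * real_of_int y ^ j)" for x y
    proof -
      have "poly gp (real x + real_of_int y) = (\<Sum>j\<le>k. \<gamma> x j * real_of_int y ^ j) + g m * real_of_int y ^ m"
        unfolding poly_shiftc[OF degp] \<gamma>_def using shiftc_top[of gp m "real x"] by (simp add: km(1) cgp)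
      then show ?thesis unfolding pgp[symmetric] by (simp add: aa_def ee_add mult.commute)
    qed
    define h where "h = (if u1 > u2 then u1 - u2 else u2 - u1)"
    have h: "h \<ge> 1" "h \<le> W" using u by (auto simp: h_def)
    \<comment> \<open>Up to sign \<open>\<mu>\<close> is the leading coefficient of \<open>f\<close>
      times this integer; \<open>d\<close> and \<open>m\<close> come from two applications of
      \<open>shiftc_next\<close>, the second to the difference polynomial.\<close>
    define G where "G = m * l * d * W ^ m * h"
    have G: "G \<ge> 1" using km d l W h by (simp add: G_def Suc_le_eq)
    have gm: "g m = real l * real d * real W ^ m * coeff f d * (real u1 - real u2)"
    proof -
      have s: "shiftc f d x m = real d * coeff f d * x + coeff f m" for x using shiftc_next[of f m x] km by simp
      show ?thesis unfolding g_def s by (simp add: algebra_simps)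
    qed
    have \<mu>G: "\<mu> = coeff f d * real G \<or> \<mu> = - (coeff f d * real G)"
      using u(1) by (auto simp: \<mu>_def gm G_def h_def of_nat_diff algebra_simps)
    define M where "M = real (card {z. z < N \<and> near_int (1 / real N ^ k) (\<mu> * real z)})"
    have M: "M \<le> (real (G * N) / q + 1) * (2 * real q * (1 / real N ^ k) + 3)"
      unfolding M_def by (rule near_int_count_multiples[OF q _ G \<mu>G]) simp
    define L where "L = real l * real W ^ d"
    define D where "D = real m * real d"
    have D0: "D \<ge> 0" by (simp add: D_def)
    have GL: "real G \<le> D * L"
    proof -
      have "real h \<le> real W" using h by simp
      then have "(real m * real l * real d * real W ^ m) * real h \<le> (real m * real l * real d * real W ^ m) * real W"
        by (intro mult_left_mono) auto
      moreover have "real W ^ d = real W ^ m * real W" by (simp add: km(2))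
      ultimately show ?thesis by (simp add: G_def D_def L_def mult_ac)
    qed
    have WP: "real W ^ P > 0" using W by simp
    have MW: "M * real W ^ P \<le> c0 * real N"
    proof -
      have "M * real W ^ P \<le> (real (G * N) / q + 1) * (2 * real q * (1 / real N ^ k) + 3) * real W ^ P"
        using M WP by (intro mult_right_mono) auto
      also have "\<dots> = 2 * ((real G * real W ^ P) * (real N / real N ^ k)) + 3 * ((real G * real W ^ P) * (real N / q)) +
           2 * ((real q * real W ^ P) / real N ^ k) + 3 * real W ^ P"
      proof -
        define z where "z = 1 / real N ^ k"
        have "(real (G * N) / q + 1) * (2 * real q * z + 3) * real W ^ P =
           2 * ((real G * real W ^ P) * (real N * z)) + 3 * ((real G * real W ^ P) * (real N / q)) + 2 * ((real q * real W ^ P) * z) + 3 * real W ^ P"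
          using q(1) by (simp add: field_simps)
        then show ?thesis by (simp add: z_def)
      qed
      also have "\<dots> \<le> 2 * ((D * real N ^ k) * (real N / real N ^ k)) + 3 * ((D * q) * (real N / q)) +
           2 * (real N ^ m / real N ^ k) + 3 * real N"
      proof -
        have GW: "real G * real W ^ P \<le> D * (L * real W ^ P)" using GL WP by (simp add: mult_right_mono mult.assoc[symmetric])
        have a1: "real G * real W ^ P \<le> D * real N ^ k"
          using GW A(3) D0 by (intro order_trans[OF GW] mult_left_mono) (auto simp: L_def)
        have a2: "real G * real W ^ P \<le> D * q"
          using GW A(2) D0 by (intro order_trans[OF GW] mult_left_mono) (auto simp: L_def)
        show ?thesis
          by (intro add_mono mult_left_mono mult_right_mono divide_right_mono a1 a2 A) auto
      qed
      also have "\<dots> = 2 * (D * real N) + 3 * (D * real N) + 2 * real N + 3 * real N"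
        using q(1) N by (simp add: km(1))
      also have "\<dots> = c0 * real N" by (simp add: c0_def D_def algebra_simps)
      finally show ?thesis .
    qed
    define t where "t x = norm (\<Sum>y\<in>{- int N..<int N}. aa y * ee (\<Sum>j\<le>k. \<gamma> x j * real_of_int y ^ j))" for x
    define X where "X = real N * (real N / real W) * real N powr \<kappa>"
    have X0: "X \<ge> 0" by (simp add: X_def)
    have "(\<Sum>x<N. t x) ^ P \<le> real (card {..<N}) ^ (P - 1) * (\<Sum>x<N. t x ^ P)"
      by (rule power_mean) (use P in \<open>auto simp: t_def\<close>)
    also have "\<dots> \<le> real N ^ (P - 1) * (C1 * real N powr (real P + \<kappa>') * M)"
      unfolding t_def M_def using C1(2)[where \<gamma> = \<gamma> and a = aa and \<mu> = \<mu> and \<nu> = "g k", OF N _ \<gamma>k] by (intro mult_mono) (auto simp: aa_def intro!: sum_nonneg)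
    also have "\<dots> \<le> real N ^ (P - 1) * (C1 * real N powr (real P + \<kappa>') * (c0 * real N / real W ^ P))"
      using MW WP C1(1) by (intro mult_left_mono) (auto simp: field_simps)
    also have "\<dots> = (C1 * c0) * X ^ P"
    proof -
      have "real N powr (real P + \<kappa>') = real N ^ P * (real N powr \<kappa>) ^ P"
        using N by (simp add: powr_add powr_realpow \<kappa>'_def powr_powr[symmetric])
      moreover have "real N ^ (P - 1) * real N = real N ^ P" using P by (metis One_nat_def Suc_pred less_eq_Suc_le power_Suc2)
      ultimately show ?thesis by (simp add: X_def power_mult_distrib power_divide mult_ac)
    qed
    also have "\<dots> \<le> C2 ^ P * X ^ P"
    proof (intro mult_right_mono)
      have "C1 * c0 \<le> C2 ^ 1" by (simp add: C2_def)
      also have "\<dots> \<le> C2 ^ P" using P by (intro power_increasing) (auto simp: C2_def)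
      finally show "C1 * c0 \<le> C2 ^ P" .
    qed (use X0 in auto)
    also have "\<dots> = (C2 * X) ^ P" by (simp add: power_mult_distrib)
    finally have "(\<Sum>x<N. t x) ^ Suc (P - 1) \<le> (C2 * X) ^ Suc (P - 1)" using P by simp
    then have "(\<Sum>x<N. t x) \<le> C2 * X"
      by (rule power_le_imp_le_base) (use X0 in \<open>auto simp: C2_def\<close>)
    then show ?thesis unfolding split by (simp add: t_def X_def mult_ac)
  qed
  show ?thesis
    by (intro exI[of _ C2] conjI allI impI, simp add: C2_def, rule main[unfolded P_def k_def m_def])
qed

text \<open>For each shift \<open>x < N\<close> the window \<open>x + {-N..<N}\<close> contains \<open>{0..<N}\<close>; averaging over \<open>x\<close> completes the sum over \<open>v\<close>
  without boundary terms.\<close>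

lemma block_bound:
  fixes f :: "real poly" and U :: "nat set" and l N W :: nat
  assumes U: "U \<subseteq> {..<W}" and N: "N \<ge> 1" and W: "W \<ge> 1" and X: "X \<ge> 0"
    and off: "\<And>u1 u2. u1 \<in> U \<Longrightarrow> u2 \<in> U \<Longrightarrow> u1 \<noteq> u2 \<Longrightarrow>
     diff_weyl_sum f l W N u1 u2
       \<le> real N * (real N / real W) * X"
  shows "(\<Sum>v<N. (norm (\<Sum>u\<in>U. ee (real l * poly f (real (u + W * v)))))\<^sup>2) \<le> real (card U) * (real N * (2 + X))"
proof -
  have fU: "finite U" using U finite_subset by blast
  have cU: "real (card U) \<le> real W" using card_mono[OF _ U] by simp
  define \<phi> where "\<phi> u v = real l * poly f (real u + real W * v)" for u :: nat and v :: real
  define T where "T v = (\<Sum>u\<in>U. ee (\<phi> u v))" for v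
  define I where "I = {- int N..<int N}"
  define H where "H u1 u2 = (\<Sum>x<N. norm (\<Sum>y\<in>I. ee (\<phi> u1 (real x + real_of_int y) - \<phi> u2 (real x + real_of_int y))))" for u1 u2
  have H: "H u1 u2 \<le> (if u1 = u2 then 2 * real N * real N else real N * (real N / real W) * X)" if "u1 \<in> U" "u2 \<in> U" for u1 u2
  proof (cases "u1 = u2")
    case True
    then show ?thesis by (simp add: H_def I_def)
  next
    case False
    then show ?thesis using off[OF that False] by (simp add: H_def I_def \<phi>_def)
  qed
  have "(\<Sum>v<N. (norm (T (real v)))\<^sup>2) \<le> (\<Sum>y\<in>I. (norm (T (real x + real_of_int y)))\<^sup>2)" if "x < N" for x
  proof -
    have "(\<Sum>v<N. (norm (T (real v)))\<^sup>2) = (\<Sum>y\<in>(\<lambda>v. int v - int x) ` {..<N}. (norm (T (real x + real_of_int y)))\<^sup>2)"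
      by (subst sum.reindex) (auto simp: inj_on_def)
    also have "\<dots> \<le> (\<Sum>y\<in>I. (norm (T (real x + real_of_int y)))\<^sup>2)"
      by (rule sum_mono2) (use that in \<open>auto simp: I_def\<close>)
    finally show ?thesis .
  qed
  then have "(\<Sum>x<N. \<Sum>v<N. (norm (T (real v)))\<^sup>2) \<le> (\<Sum>x<N. \<Sum>y\<in>I. (norm (T (real x + real_of_int y)))\<^sup>2)"
    by (intro sum_mono) simp
  then have 1: "real N * (\<Sum>v<N. (norm (T (real v)))\<^sup>2) \<le> (\<Sum>x<N. \<Sum>y\<in>I. (norm (T (real x + real_of_int y)))\<^sup>2)"
    by simp
  have "complex_of_real (\<Sum>x<N. \<Sum>y\<in>I. (norm (T (real x + real_of_int y)))\<^sup>2) =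
     (\<Sum>x<N. \<Sum>y\<in>I. \<Sum>u1\<in>U. \<Sum>u2\<in>U. ee (\<phi> u1 (real x + real_of_int y) - \<phi> u2 (real x + real_of_int y)))"
    unfolding of_real_sum
  proof (intro sum.cong refl)
    fix x :: nat and y :: int
    define v where "v = real x + real_of_int y"
    have "complex_of_real ((norm (T v))\<^sup>2) = T v * cnj (T v)" by (rule complex_norm_square)
    also have "\<dots> = (\<Sum>u1\<in>U. \<Sum>u2\<in>U. ee (\<phi> u1 v - \<phi> u2 v))"
      unfolding T_def cnj_sum sum_product
      by (intro sum.cong refl) (simp add: ee_minus[symmetric] ee_add[symmetric])
    finally show "complex_of_real ((norm (T (real x + real_of_int y)))\<^sup>2) =
       (\<Sum>u1\<in>U. \<Sum>u2\<in>U. ee (\<phi> u1 (real x + real_of_int y) - \<phi> u2 (real x + real_of_int y)))" by (simp add: v_def)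
  qed
  also have "\<dots> = (\<Sum>u1\<in>U. \<Sum>u2\<in>U. \<Sum>x<N. \<Sum>y\<in>I. ee (\<phi> u1 (real x + real_of_int y) - \<phi> u2 (real x + real_of_int y)))"
  proof -
    have swapy: "(\<Sum>y\<in>I. \<Sum>u1\<in>U. \<Sum>u2\<in>U. F y u1 u2) = (\<Sum>u1\<in>U. \<Sum>u2\<in>U. \<Sum>y\<in>I. F y u1 u2)" for F :: "int \<Rightarrow> nat \<Rightarrow> nat \<Rightarrow> complex"
      by (subst sum.swap, rule sum.cong[OF refl], rule sum.swap)
    have swapx: "(\<Sum>x<N. \<Sum>u1\<in>U. \<Sum>u2\<in>U. F x u1 u2) = (\<Sum>u1\<in>U. \<Sum>u2\<in>U. \<Sum>x<N. F x u1 u2)" for F :: "nat \<Rightarrow> nat \<Rightarrow> nat \<Rightarrow> complex"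
      by (subst sum.swap, rule sum.cong[OF refl], rule sum.swap)
    show ?thesis by (simp only: swapy swapx)
  qed
  finally have 2: "complex_of_real (\<Sum>x<N. \<Sum>y\<in>I. (norm (T (real x + real_of_int y)))\<^sup>2) =
     (\<Sum>u1\<in>U. \<Sum>u2\<in>U. \<Sum>x<N. \<Sum>y\<in>I. ee (\<phi> u1 (real x + real_of_int y) - \<phi> u2 (real x + real_of_int y)))" .
  have "(\<Sum>x<N. \<Sum>y\<in>I. (norm (T (real x + real_of_int y)))\<^sup>2) \<le> norm (complex_of_real (\<Sum>x<N. \<Sum>y\<in>I. (norm (T (real x + real_of_int y)))\<^sup>2))"
    by (simp only: norm_of_real abs_ge_self)
  also have "\<dots> \<le> (\<Sum>u1\<in>U. \<Sum>u2\<in>U. H u1 u2)"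
    unfolding 2 H_def by (intro order_trans[OF norm_sum] sum_mono order_refl)
  also have "\<dots> \<le> (\<Sum>u1\<in>U. \<Sum>u2\<in>U. (if u1 = u2 then 2 * real N * real N else 0) + real N * (real N / real W) * X)"
    by (intro sum_mono order_trans[OF H]) (use X in auto)
  also have "\<dots> = (\<Sum>u1\<in>U. 2 * real N * real N + real (card U) * (real N * (real N / real W) * X))"
    using fU by (simp add: sum.distrib)
  \<comment> \<open>For each \<open>u1\<close> up to \<open>W\<close> off-diagonal terms use up the
    saved factor \<open>1 / W\<close>; this balance fixes how much they have to save.\<close>
  also have "\<dots> \<le> (\<Sum>u1\<in>U. 2 * real N * real N + real W * (real N * (real N / real W) * X))"
    using cU X by (intro sum_mono add_left_mono mult_right_mono) auto
  also have "\<dots> = real N * (real (card U) * (real N * (2 + X)))"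
    using W by (simp add: algebra_simps)
  finally have "real N * (\<Sum>v<N. (norm (T (real v)))\<^sup>2) \<le> real N * (real (card U) * (real N * (2 + X)))" using 1 by linarith
  then have "(\<Sum>v<N. (norm (T (real v)))\<^sup>2) \<le> real (card U) * (real N * (2 + X))" using N by (subst (asm) mult_le_cancel_left_pos) auto
  then show ?thesis by (simp add: T_def \<phi>_def)
qed

lemma e2pi_ee: "e2pi (of_real x) = ee x"
  by (simp add: e2pi_def ee_def cis_conv_exp mult_ac)

text \<open>Digit sums add over \<open>u\<close> and \<open>v\<close>, so the index set is a
  disjoint union of rectangles \<open>U t\<close> times \<open>V t\<close>. Their cardinalities add
  up to \<open>r choose s\<close>, which is how the binomial coefficient survives Cauchy's
  inequality; \<open>w + 1\<close> counts the values of \<open>t\<close>.\<close>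

lemma S_sum_square_bound:
  assumes w: "w \<le> r" and Q: "Q \<ge> 0"
    and blk: "\<And>U. U \<subseteq> {..<2 ^ w} \<Longrightarrow>
      (\<Sum>v<2 ^ (r - w). (norm (\<Sum>u\<in>U. ee (real l * poly f (real (u + 2 ^ w * v)))))\<^sup>2) \<le> real (card U) * Q"
  shows "(norm (S_sum f r l s))\<^sup>2 \<le> real (w + 1) * real (r choose s) * Q"
proof -
  define N :: nat where "N = 2 ^ (r - w)"
  define W :: nat where "W = 2 ^ w"
  have W0: "W > 0" by (simp add: W_def)
  define D where "D = {uv \<in> {..<W} \<times> {..<N}. binary_digit_sum (fst uv) + binary_digit_sum (snd uv) = s}"
  have fD: "finite D" unfolding D_def by simp
  have WN: "W * N = 2 ^ r" using w by (simp add: W_def N_def power_add[symmetric])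
  have bij: "bij_betw (\<lambda>uv. fst uv + W * snd uv) D (digit_sum_set s r)"
  proof (rule bij_betwI[where g = "\<lambda>n. (n mod W, n div W)"])
    show "(\<lambda>uv. fst uv + W * snd uv) \<in> D \<rightarrow> digit_sum_set s r"
    proof
      fix uv assume uv: "uv \<in> D"
      then have "fst uv < W" "snd uv + 1 \<le> N" by (auto simp: D_def)
      moreover from \<open>snd uv + 1 \<le> N\<close> have "W * (snd uv + 1) \<le> W * N" by (rule mult_le_mono2)
      ultimately have "fst uv + W * snd uv < W * (snd uv + 1)" "W * (snd uv + 1) \<le> W * N" by auto
      then have "fst uv + W * snd uv < 2 ^ r" using WN by linarith
      then show "fst uv + W * snd uv \<in> digit_sum_set s r"
        using uv digit_sum_split[of "fst uv" w "snd uv"] by (auto simp: digit_sum_set_def D_def W_def)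
    qed
    show "(\<lambda>n. (n mod W, n div W)) \<in> digit_sum_set s r \<rightarrow> D"
    proof
      fix n assume n: "n \<in> digit_sum_set s r"
      then have "n < N * W" using WN by (simp add: digit_sum_set_def mult.commute)
      then have "n div W < N" by (rule less_mult_imp_div_less)
      moreover have "n mod W < W" using W0 by simp
      moreover have "binary_digit_sum (n mod W) + binary_digit_sum (n div W) = s"
        using digit_sum_split[of "n mod W" w "n div W"] n \<open>n mod W < W\<close> by (simp add: W_def digit_sum_set_def)
      ultimately show "(n mod W, n div W) \<in> D" by (simp add: D_def)
    qed
  qed (use W0 in \<open>auto simp: D_def\<close>)
  define U where "U t = digit_sum_set t w" for t
  define V where "V t = {v. v < N \<and> t + binary_digit_sum v = s}" for t
  have fV: "finite (V t)" for t unfolding V_def by simp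
  have grp: "(\<Sum>uv\<in>D. h uv) = (\<Sum>t\<le>w. \<Sum>v\<in>V t. \<Sum>u\<in>U t. h (u, v))" for h :: "nat \<times> nat \<Rightarrow> 'c :: comm_monoid_add"
  proof -
    have "(\<Sum>uv\<in>D. h uv) = (\<Sum>t\<le>w. \<Sum>uv | uv \<in> D \<and> binary_digit_sum (fst uv) = t. h uv)"
      by (rule sum.group[symmetric]) (use fD digit_sum_le in \<open>auto simp: D_def W_def\<close>)
    also have "\<dots> = (\<Sum>t\<le>w. \<Sum>v\<in>V t. \<Sum>u\<in>U t. h (u, v))"
    proof (rule sum.cong[OF refl])
      fix t
      have "{uv \<in> D. binary_digit_sum (fst uv) = t} = U t \<times> V t"
        by (auto simp: D_def U_def V_def digit_sum_set_def W_def)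
      then have "(\<Sum>uv | uv \<in> D \<and> binary_digit_sum (fst uv) = t. h uv) = (\<Sum>u\<in>U t. \<Sum>v\<in>V t. h (u, v))"
        by (simp add: sum.cartesian_product)
      then show "(\<Sum>uv | uv \<in> D \<and> binary_digit_sum (fst uv) = t. h uv) = (\<Sum>v\<in>V t. \<Sum>u\<in>U t. h (u, v))"
        by (simp add: sum.swap[of _ "U t"])
    qed
    finally show ?thesis .
  qed
  define \<phi> where "\<phi> u v = ee (real l * poly f (real (u + W * v)))" for u v
  have "S_sum f r l s = (\<Sum>n\<in>digit_sum_set s r. ee (real l * poly f (real n)))"
    unfolding S_sum_def e2pi_ee ..
  also have "\<dots> = (\<Sum>uv\<in>D. \<phi> (fst uv) (snd uv))"
    unfolding \<phi>_def by (rule sum.reindex_bij_betw[OF bij, symmetric])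
  also have "\<dots> = (\<Sum>t\<le>w. \<Sum>v\<in>V t. \<Sum>u\<in>U t. \<phi> u v)" by (subst grp) simp
  finally have S: "S_sum f r l s = (\<Sum>t\<le>w. \<Sum>v\<in>V t. \<Sum>u\<in>U t. \<phi> u v)" .
  have inner: "norm (\<Sum>v\<in>V t. \<Sum>u\<in>U t. \<phi> u v) ^ 2 \<le> real (card (V t)) * (real (card (U t)) * Q)" for t
  proof -
    have "norm (\<Sum>v\<in>V t. \<Sum>u\<in>U t. \<phi> u v) ^ 2 \<le> (\<Sum>v\<in>V t. norm (\<Sum>u\<in>U t. \<phi> u v)) ^ 2"
      by (intro power_mono norm_sum) auto
    also have "\<dots> \<le> real (card (V t)) ^ (2 - 1) * (\<Sum>v\<in>V t. norm (\<Sum>u\<in>U t. \<phi> u v) ^ 2)"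
      by (rule power_mean) (auto simp: fV)
    \<comment> \<open>Positivity removes the digit condition on \<open>v\<close>, so that the
      differenced sums run over a full interval.\<close>
    also have "(\<Sum>v\<in>V t. norm (\<Sum>u\<in>U t. \<phi> u v) ^ 2) \<le> (\<Sum>v<N. norm (\<Sum>u\<in>U t. \<phi> u v) ^ 2)"
      by (rule sum_mono2) (auto simp: V_def)
    also have "(\<Sum>v<N. norm (\<Sum>u\<in>U t. \<phi> u v) ^ 2) \<le> real (card (U t)) * Q"
      unfolding \<phi>_def N_def W_def by (rule blk) (auto simp: U_def digit_sum_set_def)
    finally show ?thesis by (simp add: mult_left_mono)
  qed
  have "norm (S_sum f r l s) ^ 2 \<le> (\<Sum>t\<le>w. norm (\<Sum>v\<in>V t. \<Sum>u\<in>U t. \<phi> u v)) ^ 2"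
    unfolding S by (intro power_mono norm_sum) auto
  also have "\<dots> \<le> real (card {..w}) ^ (2 - 1) * (\<Sum>t\<le>w. norm (\<Sum>v\<in>V t. \<Sum>u\<in>U t. \<phi> u v) ^ 2)"
    by (rule power_mean) auto
  also have "\<dots> \<le> real (w + 1) * (\<Sum>t\<le>w. real (card (V t)) * (real (card (U t)) * Q))"
    unfolding card_atMost by (simp, intro mult_left_mono sum_mono inner)
  also have "\<dots> = real (w + 1) * ((\<Sum>t\<le>w. \<Sum>v\<in>V t. \<Sum>u\<in>U t. 1) * Q)"
    by (simp add: sum_distrib_left mult_ac)
  also have "(\<Sum>t\<le>w. \<Sum>v\<in>V t. \<Sum>u\<in>U t. (1::real)) = (\<Sum>uv\<in>D. 1)" by (subst grp) simp
  also have "\<dots> = real (r choose s)" using bij_betw_same_card[OF bij] card_digit_sum_set[of s r] by simp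
  finally show ?thesis by (simp add: mult.assoc)
qed

section \<open>Optimisation of the block length \<open>W\<close>\<close>

lemma eventually_linear_le_powr:
  fixes c \<epsilon> :: real
  assumes "\<epsilon> > 0"
  shows "\<exists>n0. \<forall>n\<ge>n0. (real n + 1) * c \<le> 2 powr (\<epsilon> * real n)"
proof -
  define x :: real where "x = 2 powr (- \<epsilon>)"
  have x: "0 < x" "x < 1" using assms powr_less_mono[of "-\<epsilon>" 0 2] by (auto simp: x_def)
  have "(\<lambda>n. real n * x ^ n) \<longlonglongrightarrow> 0" using x by (intro powser_times_n_limit_0) auto
  moreover have "(\<lambda>n. x ^ n) \<longlonglongrightarrow> 0" using x by (intro LIMSEQ_power_zero) auto
  ultimately have "(\<lambda>n. c * (real n * x ^ n + x ^ n)) \<longlonglongrightarrow> c * (0 + 0)" by (intro tendsto_mult_left tendsto_add)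
  then have "\<forall>\<^sub>F n in sequentially. c * (real n * x ^ n + x ^ n) < 1" by (auto intro: order_tendstoD)
  then obtain n0 where n0: "\<And>n. n \<ge> n0 \<Longrightarrow> c * (real n * x ^ n + x ^ n) < 1" by (auto simp: eventually_sequentially)
  have "(real n + 1) * c \<le> 2 powr (\<epsilon> * real n)" if "n \<ge> n0" for n
  proof -
    have xn: "x ^ n * 2 powr (\<epsilon> * real n) = 1"
      by (simp add: x_def powr_realpow[symmetric] powr_powr powr_add[symmetric])
    have "(c * (real n * x ^ n + x ^ n)) * 2 powr (\<epsilon> * real n) \<le> 1 * 2 powr (\<epsilon> * real n)"
      using n0[OF that] by (intro mult_right_mono) auto
    moreover have "(c * (real n * x ^ n + x ^ n)) * 2 powr (\<epsilon> * real n) = (real n + 1) * c * (x ^ n * 2 powr (\<epsilon> * real n))"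
      by (simp add: algebra_simps)
    ultimately show ?thesis by (simp add: xn)
  qed
  then show ?thesis by blast
qed

lemma card_bound_S_sum: "norm (S_sum f r l s) \<le> real (r choose s)"
proof -
  have "norm (S_sum f r l s) \<le> (\<Sum>n\<in>digit_sum_set s r. 1)"
    unfolding S_sum_def by (intro order_trans[OF norm_sum] sum_mono) (simp only: e2pi_ee norm_ee order_refl)
  then show ?thesis by (simp add: card_digit_sum_set)
qed

lemma powr_exponent_bound:
  assumes "W > 0" "T > 0" "W * T \<le> 1" "n \<ge> 0"
  shows "W powr n * T powr n \<le> (1::real)"
  using powr_mono2[of n "W * T" 1] assms by (simp add: powr_mult)

theorem theorem2p8:
  fixes d :: nat and \<epsilon> :: real
  assumes "d \<ge> 3" and "\<epsilon> > 0"
  shows "\<exists>r\<^sub>0 :: nat. \<forall>r \<ge> r\<^sub>0. \<forall>(f :: real poly) (a :: int) (q :: int) (l :: nat) (s :: nat).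
    degree f = d \<longrightarrow> coeff f 0 = 0 \<longrightarrow>
    q \<ge> 1 \<longrightarrow> coprime a q \<longrightarrow>
    \<bar>coeff f d - real_of_int a / real_of_int q\<bar> < 1 / (real_of_int q) ^ 2 \<longrightarrow>
    l > 0 \<longrightarrow> s \<le> r \<longrightarrow>
    norm (S_sum f r l s) \<le>
      2 powr ((1 / 2 + \<epsilon>) * real r) * real (r choose s) powr (1 / 2) *
      (real l powr \<eta>\<^sub>1 d * real_of_int q powr (- \<eta>\<^sub>1 d)
       + real l powr \<theta> d * 2 powr (- \<zeta>\<^sub>1 d * real r)
       + 2 powr (- \<zeta>\<^sub>2 d * real r)
       + 2 powr (- \<zeta>\<^sub>3 d * real r) * real_of_int q powr \<eta>\<^sub>2 d) powr (1 / 2)"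
proof -
  \<comment> \<open>After squaring, \<open>2 * \<epsilon>\<close> is available: one
    \<open>\<epsilon>\<close> pays for \<open>N powr \<epsilon>\<close>, the other, through
    \<open>r0\<close>, for the constants and the factor \<open>w + 1\<close>.\<close>
  obtain C where C: "C > 0" "\<And>f a (q::nat) (W::nat) (N::nat) (l::nat) u1 u2. degree f \<le> d \<Longrightarrow> q \<ge> 1 \<Longrightarrow> coprime a (int q) \<Longrightarrow>
     \<bar>coeff f d - real_of_int a / q\<bar> < 1 / q ^ 2 \<Longrightarrow> l \<ge> 1 \<Longrightarrow> N \<ge> 1 \<Longrightarrow> u1 \<noteq> u2 \<Longrightarrow> u1 < W \<Longrightarrow> u2 < W \<Longrightarrow>
     real W ^ vexp (d - 2) \<le> N \<Longrightarrow> real l * real W ^ d * real W ^ vexp (d - 2) \<le> q \<Longrightarrow>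
     real l * real W ^ d * real W ^ vexp (d - 2) \<le> real N ^ (d - 2) \<Longrightarrow>
     real q * real W ^ vexp (d - 2) \<le> real N ^ (d - 1) \<Longrightarrow>
     diff_weyl_sum f l W N u1 u2
       \<le> C * real N * (real N / real W) * real N powr \<epsilon>"
    using offdiagonal_bound[OF assms] by blast
  obtain r0 where r0: "\<And>r. r \<ge> r0 \<Longrightarrow> (real r + 1) * (2 * (2 + C)) \<le> 2 powr (\<epsilon> * real r)"
    using eventually_linear_le_powr[OF assms(2)] by blast
  define P where "P = vexp (d - 2)"
  have P: "real P = (real d - 1) * (real d - 2)"
  proof -
    have "real P = real (d - 2) * (real (d - 2) + 1)" by (simp only: P_def vexp_def of_nat_mult of_nat_add of_nat_1)
    moreover have "real (d - 2) = real d - 2" using assms(1) by (simp add: of_nat_diff)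
    ultimately show ?thesis by simp
  qed
  have d: "real d \<ge> 3" using assms(1) by simp
  have main: "norm (S_sum f r l s) \<le>
      2 powr ((1 / 2 + \<epsilon>) * real r) * real (r choose s) powr (1 / 2) *
      (real l powr \<eta>\<^sub>1 d * real_of_int q powr (- \<eta>\<^sub>1 d)
       + real l powr \<theta> d * 2 powr (- \<zeta>\<^sub>1 d * real r)
       + 2 powr (- \<zeta>\<^sub>2 d * real r)
       + 2 powr (- \<zeta>\<^sub>3 d * real r) * real_of_int q powr \<eta>\<^sub>2 d) powr (1 / 2)"
    if r: "r \<ge> r0" and f: "degree f = d" and q1: "q \<ge> 1" and cop: "coprime a q"
      and approx: "\<bar>coeff f d - real_of_int a / real_of_int q\<bar> < 1 / (real_of_int q) ^ 2"
      and l: "l > 0" and s: "s \<le> r"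
    for r l s :: nat and f :: "real poly" and a q :: int
  proof -
    define rq where "rq = real_of_int q"
    have rq: "rq \<ge> 1" using q1 by (simp add: rq_def)
    define T1 where "T1 = real l powr \<eta>\<^sub>1 d * rq powr (- \<eta>\<^sub>1 d)"
    define T2 where "T2 = real l powr \<theta> d * 2 powr (- \<zeta>\<^sub>1 d * real r)"
    define T3 :: real where "T3 = 2 powr (- \<zeta>\<^sub>2 d * real r)"
    define T4 where "T4 = 2 powr (- \<zeta>\<^sub>3 d * real r) * rq powr \<eta>\<^sub>2 d"
    define \<Delta> where "\<Delta> = T1 + T2 + T3 + T4"
    define b where "b = real (r choose s)"
    have T: "T1 > 0" "T2 > 0" "T3 > 0" "T4 > 0" using l rq by (auto simp: T1_def T2_def T3_def T4_def)
    have \<Delta>: "\<Delta> > 0" using T by (simp add: \<Delta>_def)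
    have b0: "b \<ge> 0" by (simp add: b_def)
    have "(norm (S_sum f r l s))\<^sup>2 \<le> 2 powr (2 * \<epsilon> * real r) * 2 powr real r * b * \<Delta>"
    \<comment> \<open>For \<open>\<Delta> \<ge> 1\<close> the number of terms suffices, since
      \<open>r choose s\<close> is at most \<open>2 ^ r\<close>.\<close>
    proof (cases "\<Delta> \<ge> 1")
      case True
      have "card (digit_sum_set s r) \<le> card {..<(2::nat) ^ r}"
        by (intro card_mono) (auto simp: digit_sum_set_def)
      then have "r choose s \<le> 2 ^ r" by (simp add: card_digit_sum_set)
      then have "real (r choose s) \<le> real (2 ^ r)" by (simp only: of_nat_le_iff)
      then have "b \<le> 2 ^ r" by (simp add: b_def)
      then have b2: "b \<le> 2 powr real r" by (simp add: powr_realpow)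
      have "(norm (S_sum f r l s))\<^sup>2 \<le> b\<^sup>2" using card_bound_S_sum by (intro power_mono) (auto simp: b_def)
      also have "\<dots> \<le> 2 powr real r * b" using b2 b0 by (simp add: power2_eq_square mult_right_mono)
      also have "\<dots> \<le> (2 powr (2 * \<epsilon> * real r) * \<Delta>) * (2 powr real r * b)"
      proof -
        have "1 * 1 \<le> 2 powr (2 * \<epsilon> * real r) * \<Delta>" using True assms(2) by (intro mult_mono ge_one_powr_ge_zero) auto
        then show ?thesis using b0 mult_right_mono[of 1 "2 powr (2 * \<epsilon> * real r) * \<Delta>" "2 powr real r * b"] by simp
      qed
      finally show ?thesis by (simp add: mult_ac)
    next
      case False
      \<comment> \<open>\<open>W\<close> is the largest power of two up to
        \<open>1 / \<Delta>\<close>: the upper bound yields all four size conditions, and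
        \<open>1 / W \<le> 2 * \<Delta>\<close> turns the diagonal contribution into
        \<open>\<Delta>\<close>.\<close>
      define w where "w = nat \<lfloor>log 2 (1 / \<Delta>)\<rfloor>"
      define W :: nat where "W = 2 ^ w"
      have lg: "log 2 (1 / \<Delta>) \<ge> 0" using False \<Delta> by (subst zero_le_log_cancel_iff) auto
      have wl: "real w \<le> log 2 (1 / \<Delta>)" "log 2 (1 / \<Delta>) \<le> real w + 1"
        using lg by (auto simp: w_def)
      have W1: "real W \<le> 1 / \<Delta>"
      proof -
        have "2 powr real w \<le> 2 powr (log 2 (1 / \<Delta>))" using wl by (intro powr_mono) auto
        then show ?thesis using \<Delta> by (simp add: W_def powr_realpow)
      qed
      have W2: "1 / real W \<le> 2 * \<Delta>"
      proof -
        have "2 powr (log 2 (1 / \<Delta>)) \<le> 2 powr (real w + 1)" using wl by (intro powr_mono) auto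
        then have "1 / \<Delta> \<le> 2 * real W" using \<Delta> by (simp add: W_def powr_add powr_realpow)
        then show ?thesis using \<Delta> by (simp add: W_def field_simps)
      qed
      have Wp: "real W > 0" "W \<ge> 1" by (auto simp: W_def)
      have WT: "real W * t \<le> 1" if "t \<le> \<Delta>" for t
      proof -
        have "real W * t \<le> real W * \<Delta>" using that by (intro mult_left_mono) auto
        also have "\<dots> \<le> 1" using W1 \<Delta> by (simp add: field_simps)
        finally show ?thesis .
      qed
      have Wpow: "real W powr real n = real W ^ n" for n using Wp by (simp add: powr_realpow)
      define R :: real where "R = 2 ^ r"
      have R: "R > 0" "R = 2 powr real r" by (auto simp: R_def powr_realpow)
      \<comment> \<open>As \<open>W * T1 \<le> 1\<close>, raising to the power
        \<open>P + d = 1 / \<eta>\<^sub>1 d\<close> clears the exponents of \<open>T1\<close>.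
        \<open>E2\<close>, \<open>E3\<close> and \<open>E4\<close> arise alike from
        \<open>T2\<close>, \<open>T3\<close> and \<open>T4\<close>.\<close>
      have E1: "real W ^ (P + d) * (real l / rq) \<le> 1"
      proof -
        have e: "\<eta>\<^sub>1 d * real (P + d) = 1"
        proof -
          have "real (P + d) = real d ^ 2 - 2 * real d + 2" by (simp add: P power2_eq_square algebra_simps)
          moreover have "real d ^ 2 - 2 * real d + 2 > 0"
          proof -
            have "(real d - 1)\<^sup>2 + 1 > 0" by (simp add: add_nonneg_pos)
            then show ?thesis by (simp add: power2_eq_square algebra_simps)
          qed
          ultimately show ?thesis by (simp add: \<eta>\<^sub>1_def)
        qed
        have "real W powr real (P + d) * T1 powr real (P + d) \<le> 1"
          using Wp T WT[of T1] by (intro powr_exponent_bound) (auto simp: \<Delta>_def)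
        moreover have "T1 powr real (P + d) = real l / rq"
        proof -
          have "T1 powr real (P + d) = (real l powr \<eta>\<^sub>1 d) powr real (P + d) * (rq powr (- \<eta>\<^sub>1 d)) powr real (P + d)"
            unfolding T1_def by (rule powr_mult)
          also have "\<dots> = real l powr (\<eta>\<^sub>1 d * real (P + d)) * rq powr (- (\<eta>\<^sub>1 d * real (P + d)))"
            by (simp only: powr_powr mult_minus_left)
          also have "\<dots> = real l / rq" unfolding e using l rq by (simp add: powr_minus divide_inverse)
          finally show ?thesis .
        qed
        ultimately show ?thesis by (simp add: Wpow del: of_nat_add)
      qed
      have E2: "real W ^ (P + d + (d - 2)) * real l \<le> R ^ (d - 2)"
      proof -
        have d2: "real (d - 2) = real d - 2" using assms(1) by (simp add: of_nat_diff)
        have n: "real (P + d + (d - 2)) = real d * (real d - 1)" unfolding of_nat_add P d2 by (simp add: algebra_simps)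
        have e: "\<theta> d * real (P + d + (d - 2)) = 1" "\<zeta>\<^sub>1 d * real r * real (P + d + (d - 2)) = real r * real (d - 2)"
          unfolding n d2 using d by (auto simp: \<theta>_def \<zeta>\<^sub>1_def)
        have "real W powr real (P + d + (d - 2)) * T2 powr real (P + d + (d - 2)) \<le> 1"
          using Wp T WT[of T2] by (intro powr_exponent_bound) (auto simp: \<Delta>_def)
        moreover have "T2 powr real (P + d + (d - 2)) = real l * (1 / R ^ (d - 2))"
        proof -
          have "T2 powr real (P + d + (d - 2)) = (real l powr \<theta> d) powr real (P + d + (d - 2)) * (2 powr (- \<zeta>\<^sub>1 d * real r)) powr real (P + d + (d - 2))"
            unfolding T2_def by (rule powr_mult)
          also have "(real l powr \<theta> d) powr real (P + d + (d - 2)) = real l" unfolding powr_powr e(1) using l by simp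
          also have "(2 powr (- \<zeta>\<^sub>1 d * real r)) powr real (P + d + (d - 2)) = 2 powr (- (\<zeta>\<^sub>1 d * real r * real (P + d + (d - 2))))"
            by (simp only: powr_powr mult_minus_left)
          also have "\<dots> = 1 / (2 powr real r) powr real (d - 2)" unfolding e(2) by (simp add: powr_minus powr_powr divide_inverse)
          also have "(2 powr real r) powr real (d - 2) = R ^ (d - 2)" using R by (simp add: powr_realpow)
          finally show ?thesis .
        qed
        ultimately have "real W ^ (P + d + (d - 2)) * (real l * (1 / R ^ (d - 2))) \<le> 1" by (simp only: Wpow)
        then show ?thesis using R by (simp add: field_simps)
      qed
      have E3: "real W ^ (P + 1) \<le> R"
      proof -
        have n: "real (P + 1) = real d ^ 2 - 3 * real d + 3" unfolding of_nat_add P by (simp add: power2_eq_square algebra_simps)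
        have "real (P + 1) > 0" by simp
        then have e: "\<zeta>\<^sub>2 d * real r * real (P + 1) = real r" unfolding n by (simp add: \<zeta>\<^sub>2_def)
        have "real W powr real (P + 1) * T3 powr real (P + 1) \<le> 1"
          using Wp T WT[of T3] by (intro powr_exponent_bound) (auto simp: \<Delta>_def)
        moreover have "T3 powr real (P + 1) = 1 / R"
        proof -
          have "T3 powr real (P + 1) = 2 powr (- (\<zeta>\<^sub>2 d * real r * real (P + 1)))"
            unfolding T3_def by (simp only: powr_powr mult_minus_left)
          then show ?thesis unfolding e R(2) by (simp add: powr_minus divide_inverse)
        qed
        ultimately have "real W ^ (P + 1) * (1 / R) \<le> 1" by (simp only: Wpow)
        then show ?thesis using R by (simp add: field_simps)
      qed
      have E4: "real W ^ (P + (d - 1)) * rq \<le> R ^ (d - 1)"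
      proof -
        have d1: "real (d - 1) = real d - 1" using assms(1) by (simp add: of_nat_diff)
        have n: "real (P + (d - 1)) = (real d - 1) ^ 2" unfolding of_nat_add P d1 by (simp add: power2_eq_square algebra_simps)
        have e: "\<eta>\<^sub>2 d * real (P + (d - 1)) = 1" "\<zeta>\<^sub>3 d * real r * real (P + (d - 1)) = real r * real (d - 1)"
          unfolding n d1 using d by (auto simp: \<eta>\<^sub>2_def \<zeta>\<^sub>3_def power2_eq_square)
        have "real W powr real (P + (d - 1)) * T4 powr real (P + (d - 1)) \<le> 1"
          using Wp T WT[of T4] by (intro powr_exponent_bound) (auto simp: \<Delta>_def)
        moreover have "T4 powr real (P + (d - 1)) = (1 / R ^ (d - 1)) * rq"
        proof -
          have "T4 powr real (P + (d - 1)) = (2 powr (- \<zeta>\<^sub>3 d * real r)) powr real (P + (d - 1)) * (rq powr \<eta>\<^sub>2 d) powr real (P + (d - 1))"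
            unfolding T4_def by (rule powr_mult)
          also have "(rq powr \<eta>\<^sub>2 d) powr real (P + (d - 1)) = rq" unfolding powr_powr e(1) using rq by simp
          also have "(2 powr (- \<zeta>\<^sub>3 d * real r)) powr real (P + (d - 1)) = 2 powr (- (\<zeta>\<^sub>3 d * real r * real (P + (d - 1))))"
            by (simp only: powr_powr mult_minus_left)
          also have "\<dots> = 1 / (2 powr real r) powr real (d - 1)" unfolding e(2) by (simp add: powr_minus powr_powr divide_inverse)
          also have "(2 powr real r) powr real (d - 1) = R ^ (d - 1)" using R by (simp add: powr_realpow)
          finally show ?thesis .
        qed
        ultimately have "real W ^ (P + (d - 1)) * ((1 / R ^ (d - 1)) * rq) \<le> 1" by (simp only: Wpow)
        then show ?thesis using R by (simp add: field_simps)
      qed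
      have wr: "w \<le> r"
      proof -
        have "real W ^ 1 \<le> real W ^ (P + 1)" using Wp by (intro power_increasing) auto
        then have "real W ^ 1 \<le> R" using E3 by (rule order_trans)
        then have "(2::real) ^ w \<le> 2 ^ r" by (simp add: W_def R_def)
        then show ?thesis by simp
      qed
      define N :: nat where "N = 2 ^ (r - w)"
      have N1: "N \<ge> 1" by (simp add: N_def)
      have WN: "real W * real N = R" using wr by (simp add: W_def N_def R_def power_add[symmetric])
      \<comment> \<open>With \<open>R = W * N\<close>, the powers of \<open>W\<close> hidden in
        \<open>R\<close> cancel the surplus in the exponents of \<open>E2\<close>, \<open>E3\<close>
        and \<open>E4\<close>.\<close>
      have A1: "real W ^ P \<le> real N"
        using E3 Wp unfolding WN[symmetric] by (simp add: power_add mult.commute)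
      have A2: "real l * real W ^ d * real W ^ P \<le> rq"
        using E1 rq by (simp add: power_add field_simps)
      have A3: "real l * real W ^ d * real W ^ P \<le> real N ^ (d - 2)"
      proof -
        have "real W ^ (d - 2) * (real l * real W ^ d * real W ^ P) \<le> real W ^ (d - 2) * real N ^ (d - 2)"
          using E2 unfolding WN[symmetric] by (simp add: power_add power_mult_distrib mult_ac)
        then show ?thesis using Wp by (subst (asm) mult_le_cancel_left_pos) auto
      qed
      have A4: "rq * real W ^ P \<le> real N ^ (d - 1)"
      proof -
        have "real W ^ (d - 1) * (rq * real W ^ P) \<le> real W ^ (d - 1) * real N ^ (d - 1)"
          using E4 unfolding WN[symmetric] by (simp add: power_add power_mult_distrib mult_ac)
        then show ?thesis using Wp by (subst (asm) mult_le_cancel_left_pos) auto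
      qed
      define X where "X = C * real N powr \<epsilon>"
      have X: "X \<ge> 0" using C(1) by (simp add: X_def)
      define qn where "qn = nat q"
      have qn: "qn \<ge> 1" "int qn = q" "real qn = rq" using q1 by (auto simp: qn_def rq_def)
      have "(norm (S_sum f r l s))\<^sup>2 \<le> real (w + 1) * real (r choose s) * (real N * (2 + X))"
      proof (rule S_sum_square_bound[OF wr])
        fix U :: "nat set" assume U: "U \<subseteq> {..<2 ^ w}"
        have "(\<Sum>v<N. (norm (\<Sum>u\<in>U. ee (real l * poly f (real (u + W * v)))))\<^sup>2) \<le> real (card U) * (real N * (2 + X))"
        proof (rule block_bound[OF _ N1 Wp(2) X])
          fix u1 u2 assume u: "u1 \<in> U" "u2 \<in> U" "u1 \<noteq> u2"
          have "diff_weyl_sum f l W N u1 u2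
             \<le> C * real N * (real N / real W) * real N powr \<epsilon>"
            by (rule C(2)[of f qn a]) (use f qn cop approx l N1 u U A1 A2 A3 A4 in \<open>auto simp: W_def rq_def P_def\<close>)
          then show "diff_weyl_sum f l W N u1 u2
             \<le> real N * (real N / real W) * X" by (simp add: X_def mult_ac)
        qed (use U in \<open>simp add: W_def\<close>)
        then show "(\<Sum>v<2 ^ (r - w). (norm (\<Sum>u\<in>U. ee (real l * poly f (real (u + 2 ^ w * v)))))\<^sup>2) \<le> real (card U) * (real N * (2 + X))"
          by (simp add: N_def W_def)
      qed (use X in simp)
      also have "\<dots> \<le> (real r + 1) * b * ((R * (2 * \<Delta>)) * ((2 + C) * 2 powr (\<epsilon> * real r)))"
      proof (intro mult_mono)
        have "real N = R * (1 / real W)" using WN Wp by (simp add: field_simps)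
        also have "\<dots> \<le> R * (2 * \<Delta>)" using W2 R by (intro mult_left_mono) auto
        finally show "real N \<le> R * (2 * \<Delta>)" .
        have g1: "1 \<le> 2 powr (\<epsilon> * real r)" using assms(2) by (intro ge_one_powr_ge_zero) auto
        have "real N \<le> 2 powr real r" by (simp add: N_def powr_realpow)
        then have "real N powr \<epsilon> \<le> (2 powr real r) powr \<epsilon>" using assms(2) by (intro powr_mono2) auto
        then have "real N powr \<epsilon> \<le> 2 powr (\<epsilon> * real r)" by (simp add: powr_powr mult.commute)
        then have "X \<le> C * 2 powr (\<epsilon> * real r)" unfolding X_def using C(1) by (intro mult_left_mono) auto
        then show "2 + X \<le> (2 + C) * 2 powr (\<epsilon> * real r)" using g1 by (simp add: distrib_right)
      qed (use wr b0 X \<Delta> R C in \<open>auto simp: b_def\<close>)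
      also have "\<dots> = ((real r + 1) * (2 * (2 + C))) * (2 powr (\<epsilon> * real r) * R * b * \<Delta>)" by (simp add: mult_ac)
      also have "\<dots> \<le> 2 powr (\<epsilon> * real r) * (2 powr (\<epsilon> * real r) * R * b * \<Delta>)"
        using r0[OF r] b0 \<Delta> R by (intro mult_right_mono) auto
      also have "\<dots> = 2 powr (2 * \<epsilon> * real r) * 2 powr real r * b * \<Delta>"
      proof -
        have "2 powr (2 * \<epsilon> * real r) = 2 powr (\<epsilon> * real r) * 2 powr (\<epsilon> * real r)"
          by (simp add: powr_add[symmetric] mult.assoc)
        then show ?thesis by (simp add: R(2) mult_ac)
      qed
      finally show ?thesis .
    qed
    also have "\<dots> = (2 powr ((1 / 2 + \<epsilon>) * real r) * b powr (1 / 2) * \<Delta> powr (1 / 2))\<^sup>2"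
    proof -
      have "(b powr (1 / 2))\<^sup>2 = b" "(\<Delta> powr (1 / 2))\<^sup>2 = \<Delta>" using b0 \<Delta> by (simp_all add: powr_half_sqrt)
      moreover have "(2 powr ((1 / 2 + \<epsilon>) * real r))\<^sup>2 = 2 powr (2 * \<epsilon> * real r) * 2 powr real r"
        by (simp add: power2_eq_square powr_add[symmetric] algebra_simps)
      ultimately show ?thesis by (simp add: power_mult_distrib)
    qed
    finally have "norm (S_sum f r l s) \<le> 2 powr ((1 / 2 + \<epsilon>) * real r) * b powr (1 / 2) * \<Delta> powr (1 / 2)"
      by (rule power2_le_imp_le) simp
    then show ?thesis by (simp add: b_def \<Delta>_def T1_def T2_def T3_def T4_def rq_def)
  qed
  then show ?thesis by blast
qed

end
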